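(* Let $(\mathcal{Q}_l)_{l\ge 0}$ be a sequence of univariate quadrature operators satisfying: (A.1) for every $l\ge 0$, $\mathcal{Q}_l(f)=I(f)$ for all $f\in\mathbb{P}_l\otimes\mathcal{S}$, where $\mathbb{P}_l=\mathrm{span}\{y^i: i=0,\dots,l\}$ and $I$ is integration against the standard Gaussian measure on $\mathbb{R}$; in particular $I(H_n)=\mathcal{Q}_l(H_n)$ for $n=0,\dots,l$; (A.2) $|\mathcal{Q}_l(H_n)|<2$ for all $l\ge 0$ and all $n>l$. Let $0<q<2$, let $(\tau_j)_{j\ge 1}$ be a positive sequence with $(\tau_j^{-1})_{j\ge 1}\in\ell^q(\mathbb{N})$, and let $r$ be the smallest integer with $r>14/q$. Let $f\in L^2_{\boldsymbol{\gamma}}(Y,\mathcal{S})$ be such that $\partial^{\boldsymbol{\mu}}_{\boldsymbol{y}}f\in L^2_{\boldsymbol{\gamma}}(Y,\mathcal{S})$ for all $\boldsymbol{\mu}\in\mathcal{F}$ with $|\boldsymbol{\mu}|_\infty\le r$ and $$\sum_{\boldsymbol{\mu}\in\mathcal{F},\,|\boldsymbol{\mu}|_\infty\le r}\frac{\boldsymbol{\tau}^{2\boldsymbol{\mu}}}{\boldsymbol{\mu}!}\int_Y\|\partial^{\boldsymbol{\mu}}_{\boldsymbol{y}}f(\boldsymbol{y})\|_{\mathcal{S}}^2\,d\boldsymbol{\gamma}(\boldsymbol{y})<\infty .$$ Then there is a constant $C$, independent of $N$, such that for every $N\ge 1$ there exists an admissible index set $\Lambda_N\subset\mathcal{F}$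 with $|\Lambda_N|=N$, a set of indices corresponding to the $N$ smallest values of $b_{\boldsymbol{\nu}}$ (i.e. $b_{\boldsymbol{\nu}}\le b_{\boldsymbol{\nu}'}$ whenever $\boldsymbol{\nu}\in\Lambda_N$ and $\boldsymbol{\nu}'\in\mathcal{F}\setminus\Lambda_N$), where $$b_{\boldsymbol{\nu}}=\sum_{\boldsymbol{\mu}\in\mathcal{F},\,|\boldsymbol{\mu}|_\infty\le r}\binom{\boldsymbol{\nu}}{\boldsymbol{\mu}}\boldsymbol{\tau}^{2\boldsymbol{\mu}},\qquad \binom{\boldsymbol{\nu}}{\boldsymbol{\mu}}=\prod_{j\ge1}\binom{\nu_j}{\mu_j},$$ such that $$\|I(f)-\mathcal{Q}_{\Lambda_N}(f)\|_{\mathcal{S}}\le C\,(N+1)^{-s},\qquad s=\frac1q-\frac12 .$$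
   Context: Notation: $\mathbb{N}=\{0,1,2,\dots\}$ for index values; coordinates are indexed by $j\ge 1$. $\mathcal{S}$ is a Banach space. $Y=\mathbb{R}^\infty$ (sequences $\boldsymbol{y}=(y_j)_{j\ge1}$) with the $\sigma$-algebra generated by the Borel cylinders and the product $\boldsymbol{\gamma}$ of standard Gaussian measures on $\mathbb{R}$ (density $\rho(y)=\frac{1}{\sqrt{2\pi}}e^{-y^2/2}$); finitely many dimensions $J$ are the special case $y_j=0$ for $j>J$. $L^2_{\boldsymbol{\gamma}}(Y,\mathcal{S})$ is the space of $f:Y\to\mathcal{S}$ with $\int_Y\|f\|_{\mathcal{S}}^2\,d\boldsymbol{\gamma}<\infty$. $I(f)=\int_Y f\,d\boldsymbol{\gamma}$; on univariate functions, $I(f)=\int_{\mathbb{R}}f\rho\,dy$. $\mathcal{F}$ is the set of $\boldsymbol{\nu}=(\nu_1,\nu_2,\dots)$ with $\nu_j\in\mathbb{N}$ and $\sum_j\nu_j<\infty$; $\mathbb{J}_{\boldsymbol{\nu}}=\{j:\nu_j\ne0\}$; $|\boldsymbol{\nu}|_\infty=\max_j\nu_j$; $\boldsymbol{\mu}!=\prod_j\mu_j!$; $\boldsymbol{\tau}^{2\boldsymbol{\mu}}=\prod_j\tau_j^{2\mu_j}$; $\partial^{\boldsymbol{\mu}}_{\boldsymbol{y}}f=(\prod_j\partial_{y_j}^{\mu_j})f$; $\binom{n}{m}=0$ if $m>n$. A set $\Lambda\subset\mathcal{F}$ is admissible (downward closed) if $\boldsymbol{\nu}\in\Lambda$ and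 $\mu_j\le\nu_j$ for all $j$ imply $\boldsymbol{\mu}\in\Lambda$. Hermite polynomials, orthonormal with respect to $\rho$: $H_n(y)=\frac{(-1)^n}{\sqrt{n!}}\frac{\rho^{(n)}(y)}{\rho(y)}$, $n\ge0$. Univariate quadrature: $\mathcal{Q}_l(f)=\sum_{k=0}^{m_l-1}w_k^lf(y_k^l)$ with points $y^l_k\in\mathbb{R}$, weights $w^l_k\in\mathbb{R}$, $m_0=1$, $m_l<m_{l+1}$, and $\mathcal{Q}_0(f)=f(0)$ (i.e. $y_0^0=0$, $w_0^0=1$). Difference operators: $\triangle_l=\mathcal{Q}_l-\mathcal{Q}_{l-1}$, with $\mathcal{Q}_{-1}=0$. For $\boldsymbol{\nu}\in\mathcal{F}$, $\mathcal{Q}_{\boldsymbol{\nu}}(f)=\bigotimes_{j\in\mathbb{J}_{\boldsymbol{\nu}}}\mathcal{Q}_{\nu_j}(f)$ is the tensor-product quadrature applying $\mathcal{Q}_{\nu_j}$ in each variable $y_j$, $j\in\mathbb{J}_{\boldsymbol{\nu}}$, with $y_j=0$ for all $j\notin\mathbb{J}_{\boldsymbol{\nu}}$; $\triangle_{\boldsymbol{\nu}}(f)=\bigotimes_{j\in\mathbb{J}_{\boldsymbol{\nu}}}(\mathcal{Q}_{\nu_j}-\mathcal{Q}_{\nu_j-1})(f)$, likewise with $y_j=0$ for $j\notin\mathbb{J}_{\boldsymbol{\nu}}$. The sparse quadrature on an admissible set $\Lambda$ is $\mathcal{Q}_\Lambda(f)=\sum_{\boldsymbol{\nu}\in\Lam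bda}\triangle_{\boldsymbol{\nu}}(f)$.
   Formalization: Since f in L²_γ is only defined up to null sets while Q_Λ evaluates it at finitely supported sequences (a null set), f is assumed to take there its precise values, the limits of averages over shrinking cylinders; otherwise the indicator of such sequences is a counterexample. *)

theory Defs
  imports "HOL-Probability.Probability"
begin

section \<open>Bochner integral in an arbitrary Banach space\<close>

text \<open>The Bochner integral of HOL-Analysis needs a second countable codomain, i.e. a separable
  Banach space. The definitions below are the library ones with Borel measurability replaced by
  strong measurability; on second countable spaces they agree with the library
  (lemmas \<open>strongly_measurable_iff_borel\<close> and \<open>bochner_int_eq_integral\<close>).\<close>

definition strongly_measurable :: "'y measure \<Rightarrow> ('y \<Rightarrow> 's::real_normed_vector) \<Rightarrow> bool" where
  "strongly_measurable M f \<longleftrightarrow>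
     (\<exists>s. (\<forall>n::nat. simple_function M (s n)) \<and> (\<forall>y\<in>space M. (\<lambda>n. s n y) \<longlonglongrightarrow> f y))"

definition bochner_has_int :: "'y measure \<Rightarrow> ('y \<Rightarrow> 's::real_normed_vector) \<Rightarrow> 's \<Rightarrow> bool" where
  "bochner_has_int M f x \<longleftrightarrow> strongly_measurable M f \<and>
     (\<exists>s. (\<forall>n::nat. Bochner_Integration.simple_bochner_integrable M (s n)) \<and>
          (\<lambda>n. \<integral>\<^sup>+y. ennreal (norm (f y - s n y)) \<partial>M) \<longlonglongrightarrow> 0 \<and>
          (\<lambda>n. Bochner_Integration.simple_bochner_integral M (s n)) \<longlonglongrightarrow> x)"

definition bochner_int :: "'y measure \<Rightarrow> ('y \<Rightarrow> 's::real_normed_vector) \<Rightarrow> 's" where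
  "bochner_int M f = (if \<exists>x. bochner_has_int M f x then THE x. bochner_has_int M f x else 0)"

lemma strongly_measurable_iff_borel:
  fixes f :: "'y \<Rightarrow> 's::{real_normed_vector, second_countable_topology}"
  shows "strongly_measurable M f \<longleftrightarrow> f \<in> borel_measurable M"
proof
  assume "strongly_measurable M f"
  then obtain s where s: "\<forall>n::nat. simple_function M (s n)"
      "\<forall>y\<in>space M. (\<lambda>n. s n y) \<longlonglongrightarrow> f y"
    unfolding strongly_measurable_def by (elim exE conjE) rule
  show "f \<in> borel_measurable M"
  proof (rule borel_measurable_LIMSEQ_metric)
    show "s n \<in> borel_measurable M" for n
      using s(1) by (intro borel_measurable_simple_function) simp
    show "(\<lambda>n. s n y) \<longlonglongrightarrow> f y" if "y \<in> space M" for y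
      using s(2) that by simp
  qed
next
  assume "f \<in> borel_measurable M"
  from borel_measurable_implies_sequence_metric[OF this, of 0]
  show "strongly_measurable M f"
    unfolding strongly_measurable_def by (elim exE conjE) (intro exI conjI)
qed

lemma bochner_int_eq_integral:
  fixes f :: "'y \<Rightarrow> 's::{banach, second_countable_topology}"
  shows "bochner_int M f = integral\<^sup>L M f"
proof -
  have "bochner_has_int M f = has_bochner_integral M f"
    unfolding bochner_has_int_def has_bochner_integral.simps strongly_measurable_iff_borel
    by (intro ext) blast
  then show ?thesis
    by (simp add: bochner_int_def lebesgue_integral_def)
qed

definition L2 :: "'y measure \<Rightarrow> ('y \<Rightarrow> 's::real_normed_vector) set" where
  "L2 M = {f. strongly_measurable M f \<and> integrable M (\<lambda>y. (norm (f y))\<^sup>2)}"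


section \<open>Gaussian measure and multi-indices\<close>

text \<open>Coordinates are numbered from 0, so that \<open>y 0, y 1, \<dots>\<close> are the first, second, \dots
  coordinate of the sequence.\<close>

definition gauss1 :: "real measure" where
  "gauss1 = density lborel (\<lambda>t. ennreal (std_normal_density t))"

definition gauss :: "(nat \<Rightarrow> real) measure" where
  "gauss = PiM UNIV (\<lambda>_. gauss1)"

definition supp :: "(nat \<Rightarrow> nat) \<Rightarrow> nat set" where
  "supp \<nu> = {j. \<nu> j \<noteq> 0}"

definition multi_indices :: "(nat \<Rightarrow> nat) set" where
  "multi_indices = {\<nu>. finite (supp \<nu>)}"

definition multi_indices_le :: "nat \<Rightarrow> (nat \<Rightarrow> nat) set" where
  "multi_indices_le r = {\<mu> \<in> multi_indices. \<forall>j. \<mu> j \<le> r}"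

definition admissible :: "(nat \<Rightarrow> nat) set \<Rightarrow> bool" where
  "admissible \<Lambda> \<longleftrightarrow> \<Lambda> \<subseteq> multi_indices \<and>
     (\<forall>\<nu>\<in>\<Lambda>. \<forall>\<mu>\<in>multi_indices. (\<forall>j. \<mu> j \<le> \<nu> j) \<longrightarrow> \<mu> \<in> \<Lambda>)"

text \<open>In the following products all factors outside \<open>supp \<mu>\<close> are 1.\<close>

definition mfact :: "(nat \<Rightarrow> nat) \<Rightarrow> real" where
  "mfact \<mu> = (\<Prod>j\<in>supp \<mu>. fact (\<mu> j))"

definition weight :: "(nat \<Rightarrow> real) \<Rightarrow> (nat \<Rightarrow> nat) \<Rightarrow> real" where
  "weight \<tau> \<mu> = (\<Prod>j\<in>supp \<mu>. \<tau> j ^ (2 * \<mu> j))"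

definition mbinom :: "(nat \<Rightarrow> nat) \<Rightarrow> (nat \<Rightarrow> nat) \<Rightarrow> real" where
  "mbinom \<nu> \<mu> = (\<Prod>j\<in>supp \<mu>. real (\<nu> j choose \<mu> j))"

text \<open>Only the finitely many \<open>\<mu> \<le> \<nu>\<close> contribute to this sum.\<close>

definition b_val :: "nat \<Rightarrow> (nat \<Rightarrow> real) \<Rightarrow> (nat \<Rightarrow> nat) \<Rightarrow> real" where
  "b_val r \<tau> \<nu> = (\<Sum>\<^sub>\<infinity>\<mu>\<in>multi_indices_le r. mbinom \<nu> \<mu> * weight \<tau> \<mu>)"


section \<open>Weak derivatives and precise values\<close>

definition test_function :: "(real \<Rightarrow> real) \<Rightarrow> bool" where
  "test_function \<psi> \<longleftrightarrow> (\<forall>n t. (deriv ^^ n) \<psi> differentiable (at t)) \<and> bounded {t. \<psi> t \<noteq> 0}"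

text \<open>\<open>weak_partial \<mu> f g\<close>: \<open>g\<close> is the derivative of order \<open>\<mu>\<close> of \<open>f\<close> in the sense of
  distributions. Test functions are products \<open>\<Prod>i\<in>I. \<psi> i (y i)\<close> in finitely many variables, whose
  linear span is dense in the smooth compactly supported functions of \<open>(y i)\<close>, \<open>i \<in> I\<close>. The
  division by the Gaussian density turns the integral over \<open>(y i)\<close>, \<open>i \<in> I\<close>, into one with respect
  to Lebesgue measure, so this is the usual identity
  \<open>\<integral> g \<psi> dy = (-1)^\<bar>\<mu>\<bar> \<integral> f \<partial>\<psi> dy\<close>, integrated over the remaining variables.\<close>

definition weak_partial ::
    "(nat \<Rightarrow> nat) \<Rightarrow> ((nat \<Rightarrow> real) \<Rightarrow> 's::banach) \<Rightarrow> ((nat \<Rightarrow> real) \<Rightarrow> 's) \<Rightarrow> bool" where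
  "weak_partial \<mu> f g \<longleftrightarrow>
     (\<forall>I \<psi>. finite I \<and> supp \<mu> \<subseteq> I \<and> (\<forall>i\<in>I. test_function (\<psi> i)) \<longrightarrow>
        bochner_int gauss (\<lambda>y. (\<Prod>i\<in>I. \<psi> i (y i) / std_normal_density (y i)) *\<^sub>R g y) =
        (-1) ^ (\<Sum>i\<in>I. \<mu> i) *\<^sub>R
        bochner_int gauss
          (\<lambda>y. (\<Prod>i\<in>I. (deriv ^^ \<mu> i) (\<psi> i) (y i) / std_normal_density (y i)) *\<^sub>R f y))"

text \<open>An element of \<open>L2\<close> is a class of functions modulo null sets, while a quadrature evaluates it
  at sequences with finitely many nonzero entries, which form a null set. As usual for Sobolev
  functions, point values are those of the precise representative, i.e. limits of averages over
  shrinking neighbourhoods. The neighbourhoods are the cylinders \<open>cyl y K \<delta>\<close>, with \<open>\<delta> \<rightarrow> 0\<close> first and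
  then \<open>K \<rightarrow> \<infinity>\<close>. Every square integrable \<open>f\<close> that is continuous at the point (product topology)
  satisfies this. Without such a convention the values used by the quadrature would be arbitrary:
  the indicator function of the finitely supported sequences has all partial derivatives equal to 0
  and integral 0, but every sparse quadrature maps it to 1.\<close>

definition cyl :: "(nat \<Rightarrow> real) \<Rightarrow> nat \<Rightarrow> real \<Rightarrow> (nat \<Rightarrow> real) set" where
  "cyl y K \<delta> = {z. \<forall>j<K. \<bar>z j - y j\<bar> < \<delta>}"

definition average :: "((nat \<Rightarrow> real) \<Rightarrow> 's::banach) \<Rightarrow> (nat \<Rightarrow> real) set \<Rightarrow> 's" where
  "average f A = (1 / measure gauss A) *\<^sub>R bochner_int gauss (\<lambda>z. indicator A z *\<^sub>R f z)"

definition precise_at :: "((nat \<Rightarrow> real) \<Rightarrow> 's::banach) \<Rightarrow> (nat \<Rightarrow> real) \<Rightarrow> bool" where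
  "precise_at f y \<longleftrightarrow>
     (\<forall>\<epsilon>>0. \<forall>\<^sub>F K in sequentially. \<forall>\<^sub>F \<delta> in at_right 0. norm (average f (cyl y K \<delta>) - f y) < \<epsilon>)"


section \<open>Hermite polynomials and quadratures\<close>

definition hermite :: "nat \<Rightarrow> real \<Rightarrow> real" where
  "hermite n t = (-1) ^ n / sqrt (fact n) * ((deriv ^^ n) std_normal_density t / std_normal_density t)"

definition poly_space :: "nat \<Rightarrow> (real \<Rightarrow> 's::real_vector) set" where
  "poly_space l = {g. \<exists>c. g = (\<lambda>t. \<Sum>i\<le>l. t ^ i *\<^sub>R c i)}"

text \<open>\<open>m l\<close> is the number of points, \<open>x l k\<close> and \<open>w l k\<close> are the points and weights of level \<open>l\<close>.\<close>

definition quad ::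
    "(nat \<Rightarrow> nat) \<Rightarrow> (nat \<Rightarrow> nat \<Rightarrow> real) \<Rightarrow> (nat \<Rightarrow> nat \<Rightarrow> real) \<Rightarrow> nat \<Rightarrow> (real \<Rightarrow> 's::real_vector) \<Rightarrow> 's"
  where "quad m x w l g = (\<Sum>k<m l. w l k *\<^sub>R g (x l k))"

definition quad_diff ::
    "(nat \<Rightarrow> nat) \<Rightarrow> (nat \<Rightarrow> nat \<Rightarrow> real) \<Rightarrow> (nat \<Rightarrow> nat \<Rightarrow> real) \<Rightarrow> nat \<Rightarrow> (real \<Rightarrow> 's::real_vector) \<Rightarrow> 's"
  where "quad_diff m x w l g = quad m x w l g - (if l = 0 then 0 else quad m x w (l - 1) g)"

text \<open>\<open>tensor_op J T f\<close> applies the univariate operator \<open>T j\<close> in the variable \<open>y j\<close> for every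
  \<open>j \<in> J\<close> (in increasing order, which is irrelevant for quadratures) and sets the other variables
  to 0.\<close>

definition in_coord ::
    "((real \<Rightarrow> 's) \<Rightarrow> 's) \<Rightarrow> nat \<Rightarrow> ((nat \<Rightarrow> real) \<Rightarrow> 's) \<Rightarrow> (nat \<Rightarrow> real) \<Rightarrow> 's" where
  "in_coord T j f = (\<lambda>y. T (\<lambda>t. f (y(j := t))))"

definition tensor_op ::
    "nat set \<Rightarrow> (nat \<Rightarrow> (real \<Rightarrow> 's) \<Rightarrow> 's) \<Rightarrow> ((nat \<Rightarrow> real) \<Rightarrow> 's) \<Rightarrow> 's" where
  "tensor_op J T f = fold (\<lambda>j. in_coord (T j) j) (sorted_list_of_set J) f (\<lambda>_. 0)"

definition tensor_diff ::
    "(nat \<Rightarrow> nat) \<Rightarrow> (nat \<Rightarrow> nat \<Rightarrow> real) \<Rightarrow> (nat \<Rightarrow> nat \<Rightarrow> real) \<Rightarrow> (nat \<Rightarrow> nat)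
      \<Rightarrow> ((nat \<Rightarrow> real) \<Rightarrow> 's::real_vector) \<Rightarrow> 's"
  where "tensor_diff m x w \<nu> f = tensor_op (supp \<nu>) (\<lambda>j. quad_diff m x w (\<nu> j)) f"

definition sparse_quad ::
    "(nat \<Rightarrow> nat) \<Rightarrow> (nat \<Rightarrow> nat \<Rightarrow> real) \<Rightarrow> (nat \<Rightarrow> nat \<Rightarrow> real) \<Rightarrow> (nat \<Rightarrow> nat) set
      \<Rightarrow> ((nat \<Rightarrow> real) \<Rightarrow> 's::real_vector) \<Rightarrow> 's"
  where "sparse_quad m x w \<Lambda> f = (\<Sum>\<nu>\<in>\<Lambda>. tensor_diff m x w \<nu> f)"

end

theory Submission
  imports Defs "HOL-Computational_Algebra.Polynomial"
begin

text \<open>Composing \<open>f\<close> with a functional \<open>\<phi>\<close> of norm at most 1 that norms the quadrature error (Hahn--Banach)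
  preserves all hypotheses and constants, so the estimate reduces to real-valued \<open>f\<close>. This replaces
  Parseval's identity, which fails in a general Banach space.

  For real \<open>f\<close> with Hermite coefficients \<open>c\<^sub>\<nu>\<close>, Bessel's inequality for the derivatives gives
  \<open>\<Sum> b\<^sub>\<nu> c\<^sub>\<nu>\<^sup>2 < \<infinity>\<close>. The condition on \<open>r\<close> gives \<open>\<Sum> b\<^sub>\<nu> powr (-q/2) p\<^sub>\<nu>\<^sup>2 < \<infinity>\<close> for
  \<open>p\<^sub>\<nu> = \<Prod>(1 + 4 \<nu>\<^sub>j)\<close>, and \<open>p\<^sub>\<nu>\<close> bounds the sparse quadrature of the Hermite polynomial \<open>H\<^sub>\<nu>\<close>. Hence
  \<open>c\<^sub>\<nu>\<close> is summable, \<open>f\<close> equals its Hermite series wherever the quadrature evaluates it, and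
  the error is at most the sum of \<open>\<bar>c\<^sub>\<nu>\<bar> p\<^sub>\<nu>\<close> over \<open>\<nu> \<notin> \<Lambda>\<close>, because the quadrature is exact on
  \<open>H\<^sub>\<nu>\<close> for \<open>\<nu> \<in> \<Lambda>\<close>. By Cauchy--Schwarz the rate is that of the square root of \<open>\<Sum> p\<^sub>\<nu>\<^sup>2 / b\<^sub>\<nu>\<close> over
  \<open>\<nu> \<notin> \<Lambda>\<close>. As \<open>b\<close> is strictly increasing, any set of \<open>N\<close> smallest values is admissible.\<close>

section \<open>The Bochner integral and continuous functionals\<close>

text \<open>The quadrature evaluates \<open>f\<close> on a null set, so convergence of an expansion
  in L^2 says nothing about the values it uses. Those values are reached through cylinder averages,
  and Parseval's identity is needed only against cylinder indicators. Absolute summability of the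
  Hermite coefficients makes every exchange of limits in these averages a dominated one. Hence a
  bound on \<open>hermite n t\<close> that is crude in \<open>t\<close> but uniform in
  \<open>n\<close> is enough, here 2 exp(t^2). At t = 0 the bound has to be 1, because a multi-index
  may have arbitrarily many active coordinates in which the point has a zero entry. The rate rests
  on 1/b = b^(-q/2) (b^(-q/2))^(2/q - 1): the first factor, weighted by the squared growth, is
  summable, and the second is at most (M/(N+1))^(2/q - 1) outside the N smallest weights. Since 2/q
  - 1 = 2s, the square root from Cauchy-Schwarz gives s. The norming functional depends on the index
  set. This is harmless: the set is chosen from the weights alone, and the constants come from the
  weights and the norms of the derivatives.\<close>

text \<open>Zorn's lemma runs over graphs: subspaces of the product with \<open>real\<close> whose
  points satisfy \<open>a \<le> norm z\<close>. Linearity is then closure of the graph, and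
  single-valuedness comes for free, since a point (0, a) forces both a and -a to be at most
  0.\<close>

lemma hahn_banach_norming:
  fixes x :: "'s::real_normed_vector"
  shows "\<exists>\<phi>::'s \<Rightarrow> real. linear \<phi> \<and> (\<forall>z. \<bar>\<phi> z\<bar> \<le> norm z) \<and> \<phi> x = norm x"
proof -
  define \<A> where "\<A> = {G :: ('s \<times> real) set. subspace G \<and> (x, norm x) \<in> G \<and> (\<forall>(z, a)\<in>G. a \<le> norm z)}"
  define G0 where "G0 = span {(x, norm x)}"
  have "G0 \<in> \<A>"
  proof -
    have "\<forall>(z, a)\<in>G0. a \<le> norm z"
      unfolding G0_def span_singleton by (auto simp: mult_right_mono)
    then show ?thesis by (simp add: \<A>_def G0_def span_base)
  qed
  have "\<exists>G\<in>\<A>. \<forall>X\<in>\<A>. G \<subseteq> X \<longrightarrow> X = G"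
  proof (rule subset_Zorn_nonempty)
    show "\<A> \<noteq> {}" using \<open>G0 \<in> \<A>\<close> by blast
    fix \<C> assume "\<C> \<noteq> {}" and ch: "subset.chain \<A> \<C>"
    then obtain X0 where X0: "X0 \<in> \<C>" by blast
    have sub: "\<And>X. X \<in> \<C> \<Longrightarrow> X \<in> \<A>" and tot: "\<And>X Y. X \<in> \<C> \<Longrightarrow> Y \<in> \<C> \<Longrightarrow> X \<subseteq> Y \<or> Y \<subseteq> X"
      using ch by (auto simp: subset_chain_def)
    have "subspace (\<Union>\<C>)"
      unfolding subspace_def
    proof (intro conjI ballI allI)
      show "0 \<in> \<Union>\<C>" using X0 sub[OF X0] by (intro UnionI[OF X0]) (auto simp: \<A>_def intro: subspace_0)
    next
      fix u v assume "u \<in> \<Union>\<C>" "v \<in> \<Union>\<C>"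
      then obtain X Y where "X \<in> \<C>" "u \<in> X" "Y \<in> \<C>" "v \<in> Y" by blast
      with tot[of X Y] obtain Z where "Z \<in> \<C>" "u \<in> Z" "v \<in> Z" by blast
      then show "u + v \<in> \<Union>\<C>" using sub[of Z] by (auto simp: \<A>_def intro: subspace_add)
    next
      fix c u assume "u \<in> \<Union>\<C>"
      then show "c *\<^sub>R u \<in> \<Union>\<C>" using sub by (auto simp: \<A>_def intro: subspace_scale)
    qed
    then show "\<Union>\<C> \<in> \<A>" using sub X0 by (fastforce simp: \<A>_def)
  qed
  then obtain G where G: "G \<in> \<A>" and max: "\<And>X. X \<in> \<A> \<Longrightarrow> G \<subseteq> X \<Longrightarrow> X = G" by blast
  have sG: "subspace G" and xG: "(x, norm x) \<in> G" and le: "\<And>z a. (z, a) \<in> G \<Longrightarrow> a \<le> norm z"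
    using G by (auto simp: \<A>_def)
  have uniq: "a = b" if "(z, a) \<in> G" "(z, b) \<in> G" for z a b
  proof -
    have "(0, a - b) \<in> G" "(0, b - a) \<in> G"
      using subspace_diff[OF sG that] subspace_diff[OF sG that(2,1)] by simp_all
    then show ?thesis using le[of 0 "a - b"] le[of 0 "b - a"] by simp
  qed
  have dom: "\<exists>a. (z0, a) \<in> G" for z0
  proof -
    \<comment> \<open>The value \<alpha> to be assigned to \<open>z0\<close> must respect the norm
      bound at z - z0 and at z + z0. The triangle inequality puts every lower bound below every
      upper bound, so the supremum of the lower bounds works.\<close>
    have "\<exists>\<alpha>. \<forall>(z, a)\<in>G. a - norm (z - z0) \<le> \<alpha> \<and> \<alpha> \<le> norm (z + z0) - a"
    proof -
      have key: "a - norm (z - z0) \<le> norm (z' + z0) - a'" if "(z, a) \<in> G" "(z', a') \<in> G" for z a z' a'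
      proof -
        have "a + a' \<le> norm (z + z')" using le subspace_add[OF sG that] by simp
        also have "\<dots> = norm ((z - z0) + (z' + z0))" by simp
        also have "\<dots> \<le> norm (z - z0) + norm (z' + z0)" by (rule norm_triangle_ineq)
        finally show ?thesis by simp
      qed
      define S where "S = (\<lambda>(z, a). a - norm (z - z0)) ` G"
      have ne: "S \<noteq> {}" using xG by (auto simp: S_def)
      have bdd: "bdd_above S"
        using key[OF _ xG] by (intro bdd_aboveI[of _ "norm (x + z0) - norm x"]) (auto simp: S_def)
      have "\<forall>(z, a)\<in>G. a - norm (z - z0) \<le> Sup S \<and> Sup S \<le> norm (z + z0) - a"
      proof (intro ballI, clarify, intro conjI)
        fix z a assume za: "(z, a) \<in> G"
        show "a - norm (z - z0) \<le> Sup S"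
          using za by (intro cSup_upper[OF _ bdd]) (auto simp: S_def)
        show "Sup S \<le> norm (z + z0) - a"
          using key[OF _ za] by (intro cSup_least[OF ne]) (auto simp: S_def)
      qed
      then show ?thesis by blast
    qed
    then obtain \<alpha> where \<alpha>: "\<And>z a. (z, a) \<in> G \<Longrightarrow> a - norm (z - z0) \<le> \<alpha>"
        "\<And>z a. (z, a) \<in> G \<Longrightarrow> \<alpha> \<le> norm (z + z0) - a" by blast
    define G' where "G' = {u + v | u v. u \<in> G \<and> v \<in> span {(z0, \<alpha>)}}"
    have GG': "G \<subseteq> G'"
    proof
      fix u assume "u \<in> G"
      then have "u + 0 \<in> G'" unfolding G'_def using span_zero by blast
      then show "u \<in> G'" by simp
    qed
    have "G' \<in> \<A>"
    proof -
      have "subspace G'" unfolding G'_def by (rule subspace_sums[OF sG subspace_span])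
      moreover have "(x, norm x) \<in> G'"
        using xG GG' by blast
      moreover have "b \<le> norm y" if mem: "(y, b) \<in> G'" for y b
      proof -
        obtain z a c where za: "(z, a) \<in> G" and yb: "y = z + c *\<^sub>R z0" "b = a + c * \<alpha>"
        proof -
          obtain u c where u: "u \<in> G" "(y, b) = u + c *\<^sub>R (z0, \<alpha>)"
            using mem unfolding G'_def span_singleton by blast
          obtain z a where "u = (z, a)" by (cases u)
          with u show thesis by (intro that[of z a c]) auto
        qed
        \<comment> \<open>Dividing by the modulus of \<open>c\<close> reduces the bound at z + c z0
          to the two bounds on \<alpha>, one for each sign of \<open>c\<close>.\<close>
        show ?thesis
        proof (cases "c = 0")
          case True then show ?thesis using yb le za by simp
        next
          case False
          have sc: "((1/\<bar>c\<bar>) *\<^sub>R z, a / \<bar>c\<bar>) \<in> G"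
            using subspace_scale[OF sG za, of "1/\<bar>c\<bar>"] by simp
          show ?thesis
          proof (cases "c > 0")
            case True
            have "a / c + \<alpha> \<le> norm ((1/c) *\<^sub>R z + z0)" using \<alpha>(2)[OF sc] True by simp
            then have "c * (a / c + \<alpha>) \<le> norm (c *\<^sub>R ((1/c) *\<^sub>R z + z0))"
              using True by (simp add: mult_left_mono)
            then show ?thesis using True yb by (simp add: algebra_simps)
          next
            case F: False
            with False have c: "c < 0" by simp
            have "a / (-c) - \<alpha> \<le> norm ((1/(-c)) *\<^sub>R z - z0)" using \<alpha>(1)[OF sc] c by simp
            then have "(-c) * (a / (-c) - \<alpha>) \<le> norm ((-c) *\<^sub>R ((1/(-c)) *\<^sub>R z - z0))"
              using c by (simp only: norm_scaleR) (simp add: mult_left_mono_neg)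
            then show ?thesis using c yb by (simp add: algebra_simps)
          qed
        qed
      qed
      ultimately show ?thesis by (auto simp: \<A>_def)
    qed
    with GG' have "G' = G" using max by blast
    moreover have "0 + (z0, \<alpha>) \<in> G'"
      unfolding G'_def using subspace_0[OF sG] span_base[of "(z0, \<alpha>)" "{(z0, \<alpha>)}"] by blast
    then have "(z0, \<alpha>) \<in> G'" by simp
    ultimately show ?thesis by blast
  qed
  define \<phi> where "\<phi> z = (THE a. (z, a) \<in> G)" for z
  have \<phi>: "(z, a) \<in> G \<longleftrightarrow> \<phi> z = a" for z a
    unfolding \<phi>_def using dom[of z] uniq by (metis (mono_tags, lifting) theI')
  show ?thesis
  proof (intro exI conjI allI)
    show lin: "linear \<phi>"
    proof (rule linearI)
      show "\<phi> (a + b) = \<phi> a + \<phi> b" for a b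
        using subspace_add[OF sG, of "(a, \<phi> a)" "(b, \<phi> b)"] \<phi> by auto
      show "\<phi> (c *\<^sub>R a) = c *\<^sub>R \<phi> a" for c a
        using subspace_scale[OF sG, of "(a, \<phi> a)" c] \<phi> by auto
    qed
    show "\<phi> x = norm x" using xG \<phi> by blast
    show "\<bar>\<phi> z\<bar> \<le> norm z" for z
      using le[of z "\<phi> z"] le[of "-z" "\<phi> (-z)"] \<phi> linear_neg[OF lin, of z] by auto
  qed
qed

lemma strongly_measurable_comp:
  assumes "strongly_measurable M f" "continuous_on UNIV h"
  shows "strongly_measurable M (\<lambda>y. h (f y))"
proof -
  obtain s where s: "\<And>n::nat. simple_function M (s n)" "\<And>y. y \<in> space M \<Longrightarrow> (\<lambda>n. s n y) \<longlonglongrightarrow> f y"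
    using assms(1) unfolding strongly_measurable_def by blast
  have "(\<lambda>n. h (s n y)) \<longlonglongrightarrow> h (f y)" if "y \<in> space M" for y
    using assms(2) s(2)[OF that] by (rule continuous_on_tendsto_compose) auto
  then show ?thesis
    unfolding strongly_measurable_def
    by (intro exI[of _ "\<lambda>n y. h (s n y)"]) (auto intro: simple_function_compose1 s(1))
qed

lemma strongly_measurable_norm:
  "strongly_measurable M f \<Longrightarrow> (\<lambda>y. norm (f y)) \<in> borel_measurable M"
  using strongly_measurable_comp[of M f norm] by (simp add: strongly_measurable_iff_borel continuous_intros)

lemma strongly_measurable_scaleR:
  assumes "strongly_measurable M f" "c \<in> borel_measurable M"
  shows "strongly_measurable M (\<lambda>y. c y *\<^sub>R f y)"
proof -
  obtain s where s: "\<And>n::nat. simple_function M (s n)" "\<And>y. y \<in> space M \<Longrightarrow> (\<lambda>n. s n y) \<longlonglongrightarrow> f y"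
    using assms(1) unfolding strongly_measurable_def by blast
  obtain d where d: "\<And>n::nat. simple_function M (d n)" "\<And>y. y \<in> space M \<Longrightarrow> (\<lambda>n. d n y) \<longlonglongrightarrow> c y"
    using assms(2) unfolding strongly_measurable_iff_borel[symmetric] strongly_measurable_def by blast
  show ?thesis
    unfolding strongly_measurable_def
    by (intro exI[of _ "\<lambda>n y. d n y *\<^sub>R s n y"])
       (auto intro!: simple_function_compose2[of M "d _" "s _" "(*\<^sub>R)"] tendsto_scaleR s d)
qed

text \<open>Truncation makes the simple approximations dominated by a multiple of
  \<open>norm (f y)\<close>, so they converge in mean; their integrals are then Cauchy, and
  completeness supplies the value.\<close>

lemma bochner_has_int_exists:
  fixes f :: "'y \<Rightarrow> 's::banach"
  assumes sm: "strongly_measurable M f" and int: "integrable M (\<lambda>y. norm (f y))"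
  shows "\<exists>x. bochner_has_int M f x"
proof -
  obtain s where s: "\<And>n::nat. simple_function M (s n)" "\<And>y. y \<in> space M \<Longrightarrow> (\<lambda>n. s n y) \<longlonglongrightarrow> f y"
    using sm unfolding strongly_measurable_def by blast
  have [measurable]: "s n \<in> measurable M (count_space UNIV)" for n
    using s(1) by (rule measurable_simple_function)
  have nf[measurable]: "(\<lambda>y. norm (f y)) \<in> borel_measurable M"
    using sm by (rule strongly_measurable_norm)
  \<comment> \<open>The factor 2 leaves room: where \<open>f y\<close> is nonzero the truncation is
    eventually inactive, and where \<open>f y\<close> is 0 it forces \<open>t n y\<close> to be
    0.\<close>
  define t where "t n y = (if norm (s n y) \<le> 2 * norm (f y) then s n y else 0)" for n y
  have st: "simple_function M (t n)" for n
  proof -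
    have "t n ` space M \<subseteq> insert 0 (s n ` space M)" by (auto simp: t_def)
    moreover have "finite (s n ` space M)" using s(1) by (rule simple_functionD)
    moreover have "(\<lambda>y. norm (s n y)) \<in> borel_measurable M"
      by (rule measurable_compose[where N="count_space UNIV"]) auto
    then have "{y\<in>space M. norm (s n y) \<le> 2 * norm (f y)} \<in> sets M"
      by measurable
    then have "t n \<in> measurable M (count_space UNIV)"
      unfolding t_def[abs_def] by (intro measurable_If) auto
    ultimately show ?thesis
      by (auto simp: simple_function_def intro: finite_subset)
  qed
  have lim: "(\<lambda>n. t n y) \<longlonglongrightarrow> f y" if "y \<in> space M" for y
  proof (cases "f y = 0")
    case True
    then have "(\<lambda>n. t n y) = (\<lambda>_. f y)" by (auto simp: t_def fun_eq_iff)
    then show ?thesis by (simp only: tendsto_const)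
  next
    case False
    have "(\<lambda>n. norm (s n y)) \<longlonglongrightarrow> norm (f y)" using s(2)[OF that] by (rule tendsto_norm)
    then have "eventually (\<lambda>n. norm (s n y) < 2 * norm (f y)) sequentially"
      using False by (intro order_tendstoD(2)) auto
    then have "eventually (\<lambda>n. s n y = t n y) sequentially"
      by eventually_elim (simp add: t_def)
    then show ?thesis using s(2)[OF that] by (rule Lim_transform_eventually[rotated])
  qed
  have nt: "norm (t n y) \<le> 2 * norm (f y)" for n y by (simp add: t_def)
  have dm[measurable]: "(\<lambda>y. norm (f y - t n y)) \<in> borel_measurable M" for n
  proof (rule borel_measurable_LIMSEQ_metric)
    show "(\<lambda>y. norm (t k y - t n y)) \<in> borel_measurable M" for k
      by (rule borel_measurable_simple_function,
          rule simple_function_compose2[OF st st, of "\<lambda>a b. norm (a - b)"])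
    show "(\<lambda>k. norm (t k y - t n y)) \<longlonglongrightarrow> norm (f y - t n y)" if "y \<in> space M" for y
      by (intro tendsto_intros lim that)
  qed
  have fin: "(\<integral>\<^sup>+y. ennreal (norm (f y)) \<partial>M) < \<infinity>"
    using int by (simp add: integrable_iff_bounded)
  have sb: "Bochner_Integration.simple_bochner_integrable M (t n)" for n
  proof (rule simple_bochner_integrableI_bounded[OF st])
    have "(\<integral>\<^sup>+y. ennreal (norm (t n y)) \<partial>M) \<le> (\<integral>\<^sup>+y. 2 * ennreal (norm (f y)) \<partial>M)"
      using nt[of n] by (intro nn_integral_mono) (simp add: ennreal_mult'[symmetric] flip: ennreal_numeral)
    also have "\<dots> < \<infinity>" using fin by (simp add: nn_integral_cmult ennreal_mult_less_top)
    finally show "(\<integral>\<^sup>+y. ennreal (norm (t n y)) \<partial>M) < \<infinity>" .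
  qed
  have lim0: "(\<lambda>n. \<integral>\<^sup>+y. ennreal (norm (f y - t n y)) \<partial>M) \<longlonglongrightarrow> (\<integral>\<^sup>+y. 0 \<partial>M)"
  proof (rule nn_integral_dominated_convergence[where w="\<lambda>y. 3 * ennreal (norm (f y))"])
    show "AE y in M. ennreal (norm (f y - t n y)) \<le> 3 * ennreal (norm (f y))" for n
    proof (rule AE_I2)
      fix y
      have "norm (f y - t n y) \<le> 3 * norm (f y)"
        using norm_triangle_ineq4[of "f y" "t n y"] nt[of n y] by linarith
      then show "ennreal (norm (f y - t n y)) \<le> 3 * ennreal (norm (f y))"
        by (simp add: ennreal_mult'[symmetric] flip: ennreal_numeral)
    qed
    show "(\<integral>\<^sup>+y. 3 * ennreal (norm (f y)) \<partial>M) < \<infinity>"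
      using fin by (simp add: nn_integral_cmult ennreal_mult_less_top)
    show "AE y in M. (\<lambda>n. ennreal (norm (f y - t n y))) \<longlonglongrightarrow> 0"
    proof (rule AE_I2)
      fix y assume "y \<in> space M"
      then have "(\<lambda>n. norm (f y - t n y)) \<longlonglongrightarrow> norm (f y - f y)" by (intro tendsto_intros lim)
      then show "(\<lambda>n. ennreal (norm (f y - t n y))) \<longlonglongrightarrow> 0"
        using tendsto_ennrealI by fastforce
    qed
  qed auto
  then have lim0: "(\<lambda>n. \<integral>\<^sup>+y. ennreal (norm (f y - t n y)) \<partial>M) \<longlonglongrightarrow> 0" by simp
  have "Cauchy (\<lambda>n. Bochner_Integration.simple_bochner_integral M (t n))"
  proof (rule metric_CauchyI)
    fix e :: real assume "0 < e"
    then have "eventually (\<lambda>n. (\<integral>\<^sup>+y. ennreal (norm (f y - t n y)) \<partial>M) < ennreal (e/2)) sequentially"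
      using lim0 by (intro order_tendstoD(2)) auto
    then obtain K where K: "\<And>n. n \<ge> K \<Longrightarrow> (\<integral>\<^sup>+y. ennreal (norm (f y - t n y)) \<partial>M) < ennreal (e/2)"
      by (auto simp: eventually_sequentially)
    show "\<exists>K. \<forall>m\<ge>K. \<forall>n\<ge>K. dist (Bochner_Integration.simple_bochner_integral M (t m))
        (Bochner_Integration.simple_bochner_integral M (t n)) < e"
    proof (intro exI[of _ K] allI impI)
      fix m n assume mn: "m \<ge> K" "n \<ge> K"
      let ?I = "Bochner_Integration.simple_bochner_integral M"
      have sd: "Bochner_Integration.simple_bochner_integrable M (\<lambda>y. t m y - t n y)"
        by (rule simple_bochner_integrable_compose2[OF _ sb sb]) simp
      have "ennreal (norm (?I (t m) - ?I (t n))) = ennreal (norm (?I (\<lambda>y. t m y - t n y)))"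
        using simple_bochner_integral_diff[OF sb sb] by simp
      also have "\<dots> \<le> ennreal (Bochner_Integration.simple_bochner_integral M (\<lambda>y. norm (t m y - t n y)))"
        using simple_bochner_integral_norm_bound[OF sd] by (intro ennreal_leI) simp
      also have "\<dots> = (\<integral>\<^sup>+y. norm (t m y - t n y) \<partial>M)"
        using simple_bochner_integrable_compose2[OF _ sb sb, of "\<lambda>a b. norm (a - b)" m n]
        by (subst simple_bochner_integral_eq_nn_integral) auto
      also have "\<dots> \<le> (\<integral>\<^sup>+y. ennreal (norm (f y - t m y)) + ennreal (norm (f y - t n y)) \<partial>M)"
      proof (rule nn_integral_mono)
        fix y
        have "norm (t m y - t n y) \<le> norm (f y - t m y) + norm (f y - t n y)"
          using norm_triangle_ineq4[of "f y - t n y" "f y - t m y"] by simp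
        then show "ennreal (norm (t m y - t n y)) \<le> ennreal (norm (f y - t m y)) + ennreal (norm (f y - t n y))"
          by (simp flip: ennreal_plus)
      qed
      also have "\<dots> = (\<integral>\<^sup>+y. ennreal (norm (f y - t m y)) \<partial>M) + (\<integral>\<^sup>+y. ennreal (norm (f y - t n y)) \<partial>M)"
        by (rule nn_integral_add) auto
      also have "\<dots> < ennreal (e/2) + ennreal (e/2)"
        using K mn by (intro add_strict_mono) auto
      also have "\<dots> = ennreal e" using \<open>0 < e\<close> by (simp flip: ennreal_plus)
      finally show "dist (?I (t m)) (?I (t n)) < e"
        using \<open>0 < e\<close> by (simp add: dist_norm ennreal_less_iff)
    qed
  qed
  then obtain x where "(\<lambda>n. Bochner_Integration.simple_bochner_integral M (t n)) \<longlonglongrightarrow> x"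
    using Cauchy_convergent convergent_def by blast
  then show ?thesis
    unfolding bochner_has_int_def using sm sb lim0 by blast
qed

lemma contraction_continuous:
  fixes \<phi> :: "'s::real_normed_vector \<Rightarrow> real"
  assumes "linear \<phi>" "\<And>z. \<bar>\<phi> z\<bar> \<le> norm z"
  shows "continuous_on UNIV \<phi>"
  using assms
  by (intro linear_continuous_on bounded_linear.intro bounded_linear_axioms.intro exI[of _ 1]) auto

lemma bochner_has_int_functional:
  fixes \<phi> :: "'s::real_normed_vector \<Rightarrow> real"
  assumes f: "bochner_has_int M f x" and \<phi>: "linear \<phi>" "\<And>z. \<bar>\<phi> z\<bar> \<le> norm z"
  shows "has_bochner_integral M (\<lambda>y. \<phi> (f y)) (\<phi> x)"
proof -
  have cont: "continuous_on UNIV \<phi>" by (rule contraction_continuous[OF \<phi>])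
  obtain s where s: "\<And>n::nat. Bochner_Integration.simple_bochner_integrable M (s n)"
      "(\<lambda>n. \<integral>\<^sup>+y. ennreal (norm (f y - s n y)) \<partial>M) \<longlonglongrightarrow> 0"
      "(\<lambda>n. Bochner_Integration.simple_bochner_integral M (s n)) \<longlonglongrightarrow> x"
    and sm: "strongly_measurable M f"
    using f unfolding bochner_has_int_def by blast
  show ?thesis
  proof (rule has_bochner_integral.intros[of _ _ "\<lambda>n y. \<phi> (s n y)"])
    show "(\<lambda>y. \<phi> (f y)) \<in> borel_measurable M"
      using strongly_measurable_comp[OF sm cont] by (simp add: strongly_measurable_iff_borel)
    show "Bochner_Integration.simple_bochner_integrable M (\<lambda>y. \<phi> (s n y))" for n
      using s(1)[of n] linear_0[OF \<phi>(1)]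
        simple_bochner_integrable_compose2[of "\<lambda>a b. \<phi> a" M "s n" "s n"] by auto
    show "(\<lambda>n. \<integral>\<^sup>+y. ennreal (norm (\<phi> (f y) - \<phi> (s n y))) \<partial>M) \<longlonglongrightarrow> 0"
    proof (rule tendsto_sandwich[OF _ _ tendsto_const s(2)])
      show "eventually (\<lambda>n. (\<integral>\<^sup>+y. ennreal (norm (\<phi> (f y) - \<phi> (s n y))) \<partial>M)
          \<le> (\<integral>\<^sup>+y. ennreal (norm (f y - s n y)) \<partial>M)) sequentially"
        using \<phi>(2) by (intro always_eventually allI nn_integral_mono ennreal_leI)
          (simp flip: linear_diff[OF \<phi>(1)])
    qed auto
    show "(\<lambda>n. Bochner_Integration.simple_bochner_integral M (\<lambda>y. \<phi> (s n y))) \<longlonglongrightarrow> \<phi> x"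
      using continuous_on_tendsto_compose[OF cont s(3)]
      by (simp add: simple_bochner_integral_linear[OF \<phi>(1) s(1)])
  qed
qed

text \<open>The definite description in \<open>bochner_int\<close> needs uniqueness. A functional
  that norms the difference of two candidate values sends both to the same real integral, so the
  difference has norm 0.\<close>

lemma functional_bochner_int:
  fixes f :: "'y \<Rightarrow> 's::banach" and \<phi> :: "'s \<Rightarrow> real"
  assumes sm: "strongly_measurable M f" and int: "integrable M (\<lambda>y. norm (f y))"
    and \<phi>: "linear \<phi>" "\<And>z. \<bar>\<phi> z\<bar> \<le> norm z"
  shows "\<phi> (bochner_int M f) = (\<integral>y. \<phi> (f y) \<partial>M)"
proof -
  obtain x where x: "bochner_has_int M f x"
    using bochner_has_int_exists[OF sm int] by blast
  have uniq: "x' = x" if x': "bochner_has_int M f x'" for x'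
  proof -
    obtain \<psi> :: "'s \<Rightarrow> real" where \<psi>: "linear \<psi>" "\<And>z. \<bar>\<psi> z\<bar> \<le> norm z" "\<psi> (x' - x) = norm (x' - x)"
      using hahn_banach_norming[of "x' - x"] by auto
    have "\<psi> x' = \<psi> x"
      using bochner_has_int_functional[OF x' \<psi>(1,2)] bochner_has_int_functional[OF x \<psi>(1,2)]
      by (metis has_bochner_integral_integral_eq)
    then show ?thesis using \<psi>(3) linear_diff[OF \<psi>(1)] by simp
  qed
  have "(THE x. bochner_has_int M f x) = x"
    using x by (rule the_equality) (rule uniq)
  moreover have "\<exists>x. bochner_has_int M f x" using x by (rule exI)
  ultimately have "bochner_int M f = x" by (simp only: bochner_int_def if_True)
  then show ?thesis
    using bochner_has_int_functional[OF x \<phi>] by (simp add: has_bochner_integral_integral_eq)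
qed

section \<open>Hermite polynomials\<close>

lemma L2_real_iff:
  fixes g :: "'y \<Rightarrow> real"
  shows "g \<in> L2 M \<longleftrightarrow> g \<in> borel_measurable M \<and> integrable M (\<lambda>y. (g y)\<^sup>2)"
  by (simp add: L2_def strongly_measurable_iff_borel)

lemma L2_measurable [measurable_dest]:
  fixes g :: "'y \<Rightarrow> real"
  shows "g \<in> L2 M \<Longrightarrow> g \<in> borel_measurable M"
  by (simp add: L2_real_iff)

lemma L2_mult_integrable:
  fixes g h :: "'y \<Rightarrow> real"
  assumes "g \<in> L2 M" "h \<in> L2 M"
  shows "integrable M (\<lambda>y. g y * h y)"
proof (rule Bochner_Integration.integrable_bound)
  show "integrable M (\<lambda>y. (g y)\<^sup>2 + (h y)\<^sup>2)"
    using assms by (simp add: L2_real_iff)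
  note [measurable] = assms[THEN L2_measurable]
  show "(\<lambda>y. g y * h y) \<in> borel_measurable M" by measurable
  have "\<bar>a * b\<bar> \<le> a\<^sup>2 + b\<^sup>2" for a b :: real
    using sum_squares_bound[of "\<bar>a\<bar>" "\<bar>b\<bar>"] by (simp add: abs_mult) (metis abs_ge_zero mult_nonneg_nonneg order_trans mult_2 le_add_same_cancel1 mult.assoc)
  then show "AE y in M. norm (g y * h y) \<le> norm ((g y)\<^sup>2 + (h y)\<^sup>2)" by simp
qed

lemma L2_bound:
  fixes g G :: "'y \<Rightarrow> real"
  assumes "G \<in> L2 M" "g \<in> borel_measurable M" "\<And>y. \<bar>g y\<bar> \<le> G y"
  shows "g \<in> L2 M"
  unfolding L2_real_iff
proof
  show "integrable M (\<lambda>y. (g y)\<^sup>2)"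
  proof (rule Bochner_Integration.integrable_bound)
    show "integrable M (\<lambda>y. (G y)\<^sup>2)" using assms by (simp add: L2_real_iff)
    show "AE y in M. norm ((g y)\<^sup>2) \<le> norm ((G y)\<^sup>2)"
    proof (rule AE_I2)
      fix y
      have "\<bar>g y\<bar> \<le> \<bar>G y\<bar>" using assms(3)[of y] by linarith
      then show "norm ((g y)\<^sup>2) \<le> norm ((G y)\<^sup>2)" by (simp add: abs_le_square_iff)
    qed
  qed (use assms in simp)
qed fact

lemma L2_scale:
  fixes g :: "'y \<Rightarrow> real"
  assumes "g \<in> L2 M"
  shows "(\<lambda>y. c * g y) \<in> L2 M"
  using assms borel_measurable_times[OF borel_measurable_const, of g M c]
  by (simp add: L2_real_iff power_mult_distrib)

lemma L2_add:
  fixes g h :: "'y \<Rightarrow> real"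
  assumes "g \<in> L2 M" "h \<in> L2 M"
  shows "(\<lambda>y. g y + h y) \<in> L2 M"
  using assms L2_mult_integrable[OF assms]
  by (auto simp: L2_real_iff power2_sum mult.assoc)

lemma L2_sum:
  fixes g :: "'i \<Rightarrow> 'y \<Rightarrow> real"
  assumes "finite I" "\<And>i. i \<in> I \<Longrightarrow> g i \<in> L2 M"
  shows "(\<lambda>y. \<Sum>i\<in>I. g i y) \<in> L2 M"
  using assms
proof (induction I rule: finite_induct)
  case empty
  show ?case by (simp add: L2_real_iff)
next
  case (insert i I)
  then have "(\<lambda>y. g i y + (\<Sum>i\<in>I. g i y)) \<in> L2 M" by (intro L2_add) auto
  with insert show ?case by simp
qed

section \<open>Algebra of the Hermite polynomials\<close>

text \<open>The monic (probabilists') Hermite polynomials; the recursion is what differentiating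
  \<open>He n\<close> times the Gaussian density produces, up to sign.\<close>

primrec He :: "nat \<Rightarrow> real poly" where
  "He 0 = 1"
| "He (Suc n) = [:0, 1:] * He n - pderiv (He n)"

lemma pderiv_hermite_poly: "pderiv (He (Suc n)) = smult (real (Suc n)) (He n)"
proof (induction n)
  case (Suc n)
  have "pderiv (He (Suc (Suc n))) =
      He (Suc n) + [:0, 1:] * pderiv (He (Suc n)) - pderiv (pderiv (He (Suc n)))"
    by (subst He.simps(2)) (simp add: pderiv_diff pderiv_mult pderiv_pCons algebra_simps del: He.simps mult_pCons_left)
  also have "\<dots> = He (Suc n) + smult (real (Suc n)) ([:0, 1:] * He n - pderiv (He n))"
    unfolding Suc by (simp add: pderiv_smult smult_diff_right del: mult_pCons_left)
  also have "\<dots> = smult (real (Suc (Suc n))) (He (Suc n))"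
    by (simp only: He.simps(2)[of n, symmetric] of_nat_Suc[of "Suc n"] smult_add_left smult_1_left)
  finally show ?case .
qed (simp add: pderiv_pCons)

text \<open>Three-term recurrence, obtained by eliminating the derivative from the defining
  recursion. For n = 0 the truncated index \<open>n - 1\<close> is harmless because its coefficient
  is 0.\<close>

lemma pCons_mult_hermite_poly:
  "[:0, 1:] * He n = He (Suc n) + smult (real n) (He (n - 1))"
proof (cases n)
  case (Suc k)
  have "He (Suc n) = [:0, 1:] * He n - smult (real n) (He (n - 1))"
    by (subst He.simps(2)) (simp only: Suc pderiv_hermite_poly diff_Suc_1)
  then show ?thesis by simp
qed simp

text \<open>A smooth function is carried around as the sequence of all its derivatives. Iterates of
  \<open>deriv\<close> are then read off, with no differentiability side conditions at each
  order.\<close>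

definition derivs :: "(nat \<Rightarrow> real \<Rightarrow> real) \<Rightarrow> bool" where
  "derivs g \<longleftrightarrow> (\<forall>k t. (g k has_real_derivative g (Suc k) t) (at t))"

lemma derivs_funpow_deriv:
  assumes "derivs g"
  shows "(deriv ^^ k) (g 0) = g k"
proof (induction k)
  case (Suc k)
  have "deriv (g k) t = g (Suc k) t" for t
    using assms by (auto simp: derivs_def intro: DERIV_imp_deriv)
  then show ?case by (simp add: Suc fun_eq_iff)
qed simp

lemma has_derivative_std_normal:
  "(std_normal_density has_real_derivative - t * std_normal_density t) (at t)"
  unfolding std_normal_density_def
  by (auto intro!: derivative_eq_intros simp: power2_eq_square field_simps)

lemma derivs_std_normal:
  "derivs (\<lambda>k t. (-1) ^ k * poly (He k) t * std_normal_density t)"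
  unfolding derivs_def
  by (auto intro!: derivative_eq_intros has_derivative_std_normal poly_DERIV simp: algebra_simps)

lemma std_normal_funpow_deriv:
  "(deriv ^^ k) std_normal_density t = (-1) ^ k * poly (He k) t * std_normal_density t"
  using derivs_funpow_deriv[OF derivs_std_normal, of k] by (simp add: fun_eq_iff)

lemma hermite_eq_poly: "hermite n t = poly (He n) t / sqrt (fact n)"
  using normal_density_pos[of 1 0 t]
  by (simp add: hermite_def std_normal_funpow_deriv flip: power_add mult.assoc)

lemma hermite_0 [simp]: "hermite 0 t = 1"
  by (simp add: hermite_eq_poly)

section \<open>Moments and orthogonality under the one-dimensional Gaussian measure\<close>

lemma sets_gauss1 [simp, measurable_cong]: "sets gauss1 = sets borel"
  and space_gauss1 [simp]: "space gauss1 = UNIV"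
  by (simp_all add: gauss1_def)

lemma prob_space_gauss1: "prob_space gauss1"
  unfolding gauss1_def by (rule prob_space_normal_density) simp

lemma borel_measurable_gauss1 [simp]: "borel_measurable gauss1 = borel_measurable borel"
  by (rule measurable_cong_sets) simp_all

lemma integrable_gauss1_iff:
  fixes g :: "real \<Rightarrow> real"
  assumes "g \<in> borel_measurable borel"
  shows "integrable gauss1 g \<longleftrightarrow> integrable lborel (\<lambda>t. std_normal_density t * g t)"
  unfolding gauss1_def using assms by (subst integrable_density) auto

lemma integral_gauss1:
  fixes g :: "real \<Rightarrow> real"
  assumes "g \<in> borel_measurable borel"
  shows "(\<integral>t. g t \<partial>gauss1) = (\<integral>t. std_normal_density t * g t \<partial>lborel)"
  unfolding gauss1_def using assms by (subst integral_density) auto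

lemma borel_measurable_poly [measurable]: "poly (p :: real poly) \<in> borel_measurable borel"
  by (intro borel_measurable_continuous_onI continuous_intros)

lemma integrable_gauss1_poly: "integrable gauss1 (poly p)"
proof -
  have "integrable gauss1 (\<lambda>t. \<Sum>i\<le>degree p. coeff p i * t ^ i)"
    by (intro Bochner_Integration.integrable_sum integrable_mult_right)
       (auto simp: integrable_gauss1_iff integrable_std_normal_moment)
  then show ?thesis by (simp add: poly_altdef[abs_def])
qed

lemma L2_poly: "poly p \<in> L2 gauss1"
  using integrable_gauss1_poly[of "p ^ 2"] unfolding L2_real_iff borel_measurable_gauss1
  by (simp add: poly_power[abs_def])

lemma L2_hermite: "hermite n \<in> L2 gauss1"
proof -
  have "hermite n = (\<lambda>t. (1 / sqrt (fact n)) * poly (He n) t)"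
    by (simp add: fun_eq_iff hermite_eq_poly)
  then show ?thesis using L2_scale[OF L2_poly] by metis
qed

lemma integral_gauss1_moments:
  "(\<integral>t. t \<partial>gauss1) = 0"
  "(\<integral>t. t ^ Suc (Suc k) \<partial>gauss1) = real (Suc k) * (\<integral>t. t ^ k \<partial>gauss1)"
proof -
  show "(\<integral>t. t \<partial>gauss1) = 0"
    using integral_std_normal_moment_odd[of 0] by (simp add: integral_gauss1)
  show "(\<integral>t. t ^ Suc (Suc k) \<partial>gauss1) = real (Suc k) * (\<integral>t. t ^ k \<partial>gauss1)"
  proof (cases "even k")
    case True
    then obtain j where j: "k = 2 * j" by (elim evenE)
    have "fact (Suc (Suc (2 * j))) / (2 ^ Suc j * fact (Suc j)) = real (Suc (2 * j)) * (fact (2 * j) / (2 ^ j * fact j))"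
      by (simp add: divide_simps)
    then show ?thesis
      using integral_std_normal_moment_even[of j] integral_std_normal_moment_even[of "Suc j"]
      by (simp add: integral_gauss1 j)
  next
    case False
    then obtain j where j: "k = 2 * j + 1" by (elim oddE)
    then show ?thesis
      using integral_std_normal_moment_odd[of j] integral_std_normal_moment_odd[of "Suc j"]
      by (simp add: integral_gauss1)
  qed
qed

lemma pderiv_sum: "pderiv (\<Sum>i\<in>I. f i) = (\<Sum>i\<in>I. pderiv (f i))"
  by (induction I rule: infinite_finite_induct) (simp_all add: pderiv_add)

lemma integral_gauss1_poly_sum:
  "(\<integral>t. poly (\<Sum>i\<in>I. f i) t \<partial>gauss1) = (\<Sum>i\<in>I. \<integral>t. poly (f i) t \<partial>gauss1)"
  unfolding poly_sum[abs_def] by (simp add: integrable_gauss1_poly)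

text \<open>Linearity reduces the claim to monomials, where it is the recursion of the Gaussian
  moments; no boundary terms have to be estimated.\<close>

lemma gauss1_integration_by_parts:
  "(\<integral>t. poly (pderiv p) t \<partial>gauss1) = (\<integral>t. poly ([:0, 1:] * p) t \<partial>gauss1)"
proof -
  have mono: "(\<integral>t. poly (pderiv (monom a i)) t \<partial>gauss1) = (\<integral>t. poly ([:0, 1:] * monom a i) t \<partial>gauss1)" for a :: real and i
  proof (cases i)
    case 0
    then show ?thesis using integral_gauss1_moments(1) by (simp add: pderiv_monom poly_monom)
  next
    case (Suc k)
    have "(\<integral>t. poly ([:0, 1:] * monom a i) t \<partial>gauss1) = (\<integral>t. a * t ^ Suc (Suc k) \<partial>gauss1)"
      by (rule Bochner_Integration.integral_cong) (simp_all add: Suc poly_monom)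
    moreover have "(\<integral>t. poly (pderiv (monom a i)) t \<partial>gauss1) = (\<integral>t. (a * real (Suc k)) * t ^ k \<partial>gauss1)"
      by (rule Bochner_Integration.integral_cong) (simp_all add: Suc pderiv_monom poly_monom)
    ultimately show ?thesis
      by (simp only: integral_mult_right_zero integral_gauss1_moments(2) mult.assoc)
  qed
  have p: "p = (\<Sum>i\<le>degree p. monom (coeff p i) i)"
    by (rule poly_as_sum_of_monoms[symmetric])
  have "(\<integral>t. poly (pderiv p) t \<partial>gauss1) = (\<Sum>i\<le>degree p. \<integral>t. poly (pderiv (monom (coeff p i) i)) t \<partial>gauss1)"
    by (subst p) (simp only: pderiv_sum integral_gauss1_poly_sum)
  also have "\<dots> = (\<Sum>i\<le>degree p. \<integral>t. poly ([:0, 1:] * monom (coeff p i) i) t \<partial>gauss1)"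
    by (simp only: mono)
  also have "\<dots> = (\<integral>t. poly ([:0, 1:] * p) t \<partial>gauss1)"
    by (subst (2) p) (simp only: sum_distrib_left integral_gauss1_poly_sum)
  finally show ?thesis .
qed

text \<open>Multiplication by t minus differentiation, the operator that raises \<open>He n\<close>,
  is the adjoint of differentiation under the Gaussian measure.\<close>

lemma hermite_poly_Suc_adjoint:
  "(\<integral>t. poly (He (Suc n) * p) t \<partial>gauss1) = (\<integral>t. poly (He n * pderiv p) t \<partial>gauss1)"
proof -
  have "He (Suc n) * p = [:0, 1:] * (He n * p) - pderiv (He n) * p"
    by (simp add: algebra_simps del: mult_pCons_left)
  then have "(\<integral>t. poly (He (Suc n) * p) t \<partial>gauss1) =
      (\<integral>t. poly ([:0, 1:] * (He n * p)) t \<partial>gauss1) - (\<integral>t. poly (pderiv (He n) * p) t \<partial>gauss1)"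
    by (simp add: integrable_gauss1_poly del: He.simps mult_pCons_left poly_mult)
  also have "\<dots> = (\<integral>t. poly (pderiv (He n * p)) t - poly (pderiv (He n) * p) t \<partial>gauss1)"
    by (simp only: gauss1_integration_by_parts[symmetric] Bochner_Integration.integral_diff integrable_gauss1_poly)
  also have "\<dots> = (\<integral>t. poly (He n * pderiv p) t \<partial>gauss1)"
    by (simp add: pderiv_mult algebra_simps)
  finally show ?thesis .
qed

lemma hermite_poly_orthogonal:
  "(\<integral>t. poly (He m * He n) t \<partial>gauss1) = (if m = n then fact n else 0)"
proof (induction m arbitrary: n)
  case 0
  interpret prob_space gauss1 by (rule prob_space_gauss1)
  have "measure gauss1 UNIV = 1" using prob_space by simp
  note [simp] = this
  show ?case
  proof (cases n)
    case (Suc k)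
    have "(\<integral>t. poly (He (Suc k) * 1) t \<partial>gauss1) = 0"
      unfolding hermite_poly_Suc_adjoint pderiv_1 mult_zero_right by (simp add: poly_0[abs_def])
    then show ?thesis by (simp add: Suc del: He.simps(2))
  qed (simp add: prob_space)
next
  case (Suc m)
  show ?case
  proof (cases n)
    case 0
    then show ?thesis using hermite_poly_Suc_adjoint[of m 1] by simp
  next
    case (Suc k)
    have "(\<integral>t. poly (He (Suc m) * He (Suc k)) t \<partial>gauss1) =
        real (Suc k) * (\<integral>t. poly (He m * He k) t \<partial>gauss1)"
      unfolding hermite_poly_Suc_adjoint pderiv_hermite_poly mult_smult_right poly_smult by (rule integral_mult_right_zero)
    then show ?thesis unfolding Suc.IH by (simp add: Suc del: He.simps)
  qed
qed

lemma hermite_orthonormal: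
  "(\<integral>t. hermite m t * hermite n t \<partial>gauss1) = (if m = n then 1 else 0)"
proof -
  have "(\<integral>t. hermite m t * hermite n t \<partial>gauss1) =
      (\<integral>t. (1 / (sqrt (fact m) * sqrt (fact n))) * poly (He m * He n) t \<partial>gauss1)"
    by (simp add: hermite_eq_poly)
  then show ?thesis
    unfolding integral_mult_right_zero hermite_poly_orthogonal by (simp add: abs_of_pos)
qed

lemma integral_hermite: "(\<integral>t. hermite n t \<partial>gauss1) = (if n = 0 then 1 else 0)"
  using hermite_orthonormal[of n 0] by simp

text \<open>At 0 the recurrence reads He_(n+2)(0) = -(n+1) He_n(0), and (n+1)^2 n! \<le> (n+2)!.
  After normalisation the bound is 1, so any number of coordinates with entry 0 can be multiplied
  without loss.\<close>

lemma poly_hermite_0_bound: "(poly (He n) 0)\<^sup>2 \<le> fact n"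
proof (induction n rule: induct_nat_012)
  case (ge2 n)
  have "poly (He (Suc (Suc n))) 0 = - real (Suc n) * poly (He n) 0"
    using pderiv_hermite_poly[of n] by (subst He.simps(2)) (simp add: algebra_simps del: He.simps)
  then have "(poly (He (Suc (Suc n))) 0)\<^sup>2 = (real (Suc n))\<^sup>2 * (poly (He n) 0)\<^sup>2"
    by (simp only: power_mult_distrib power2_minus)
  also have "\<dots> \<le> (real (Suc n))\<^sup>2 * fact n" using ge2(1) by (intro mult_left_mono) auto
  also have "\<dots> \<le> fact (Suc (Suc n))"
    by (simp add: power2_eq_square algebra_simps)
  finally show ?case .
qed simp_all

text \<open>The energy \<open>u'\<^sup>2 + n u\<^sup>2\<close> of a solution of Hermite's equation \<open>u'' = t u' - n u\<close> has derivative
  \<open>2 t u'\<^sup>2\<close>, so it grows at most like \<open>exp t\<^sup>2\<close>.\<close>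

lemma hermite_bound: "(hermite n t)\<^sup>2 \<le> 2 * exp (t\<^sup>2)"
proof (cases n)
  case 0
  have "exp (t\<^sup>2) \<ge> 1" by simp
  with 0 show ?thesis by (simp del: one_le_exp_iff)
next
  case (Suc m)
  define u where "u = poly (He n)"
  define u1 where "u1 = poly (pderiv (He n))"
  define F where "F t = ((u1 t)\<^sup>2 + n * (u t)\<^sup>2) * exp (- t\<^sup>2)" for t :: real
  have du: "(u has_real_derivative u1 t) (at t)" for t
    unfolding u_def u1_def by (rule poly_DERIV)
  have du1: "(u1 has_real_derivative t * u1 t - n * u t) (at t)" for t
  proof -
    have "pderiv (pderiv (He n)) = [:0, 1:] * pderiv (He n) + He n - pderiv (He (Suc n))"
      by (simp add: pderiv_diff pderiv_mult pderiv_pCons del: mult_pCons_left)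
    then have "poly (pderiv (pderiv (He n))) t =
        poly ([:0, 1:] * pderiv (He n) + He n - smult (real (Suc n)) (He n)) t"
      by (simp only: pderiv_hermite_poly)
    then have "poly (pderiv (pderiv (He n))) t = t * u1 t - n * u t"
      unfolding u_def u1_def by (simp add: algebra_simps)
    then show ?thesis unfolding u1_def using poly_DERIV[of "pderiv (He n)" t] by simp
  qed
  have dF: "(F has_real_derivative - 2 * t * n * (u t)\<^sup>2 * exp (- t\<^sup>2)) (at t)" for t :: real
    unfolding F_def
    by (auto intro!: derivative_eq_intros du du1 simp: algebra_simps power2_eq_square)
  have "F t \<le> F 0"
  proof (cases "t \<ge> 0")
    case True
    show ?thesis
    proof (rule DERIV_nonpos_imp_nonincreasing[OF True])
      fix x :: real assume "0 \<le> x" "x \<le> t"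
      then show "\<exists>y. (F has_real_derivative y) (at x) \<and> y \<le> 0"
        using dF[of x] by (intro exI conjI) auto
    qed
  next
    case False
    then have "t \<le> 0" by simp
    show ?thesis
    proof (rule DERIV_nonneg_imp_nondecreasing[OF \<open>t \<le> 0\<close>])
      fix x :: real assume "t \<le> x" "x \<le> 0"
      then show "\<exists>y. (F has_real_derivative y) (at x) \<and> 0 \<le> y"
        using dF[of x] by (intro exI conjI) (auto simp: mult_nonpos_nonneg)
    qed
  qed
  also have "F 0 \<le> 2 * real n * fact n"
  proof -
    have "(u1 0)\<^sup>2 = (real n)\<^sup>2 * (poly (He m) 0)\<^sup>2"
      unfolding u1_def Suc pderiv_hermite_poly by (simp add: power_mult_distrib del: of_nat_Suc)
    also have "\<dots> \<le> (real n)\<^sup>2 * fact m" by (intro mult_left_mono poly_hermite_0_bound) auto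
    also have "\<dots> = real n * fact n" by (simp add: Suc power2_eq_square algebra_simps)
    finally have "(u1 0)\<^sup>2 \<le> real n * fact n" .
    moreover have "real n * (u 0)\<^sup>2 \<le> real n * fact n"
      unfolding u_def by (intro mult_left_mono poly_hermite_0_bound) auto
    ultimately show ?thesis by (simp add: F_def)
  qed
  also have "n * (u t)\<^sup>2 * exp (- t\<^sup>2) \<le> F t"
    unfolding F_def by (intro mult_right_mono) auto
  finally have "real n * ((u t)\<^sup>2 * exp (- t\<^sup>2)) \<le> real n * (2 * fact n)" by (simp add: algebra_simps)
  then have "(u t)\<^sup>2 * exp (- t\<^sup>2) \<le> 2 * fact n"
    using Suc by (subst (asm) mult_le_cancel_left_pos) auto
  then have "(u t)\<^sup>2 / fact n \<le> 2 * exp (t\<^sup>2)"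
    by (simp add: exp_minus field_simps)
  then show ?thesis by (simp add: hermite_eq_poly u_def power_divide)
qed

lemma hermite_abs_bound: "\<bar>hermite n t\<bar> \<le> 2 * exp (t\<^sup>2)"
proof -
  have "(hermite n t)\<^sup>2 \<le> (2 * exp (t\<^sup>2))\<^sup>2"
  proof -
    have "2 * exp (t\<^sup>2) * 1 \<le> (2 * exp (t\<^sup>2)) * (2 * exp (t\<^sup>2))"
      by (intro mult_left_mono) (use one_le_exp_iff[of "t\<^sup>2"] in \<open>simp_all del: one_le_exp_iff\<close>)
    then show ?thesis using order_trans[OF hermite_bound[of n t]] by (simp only: power2_eq_square[of "2 * _"] mult_1_right)
  qed
  then show ?thesis by (subst (asm) power2_le_iff_abs_le) simp_all
qed

lemma hermite_0_abs_bound: "\<bar>hermite n 0\<bar> \<le> 1"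
proof -
  have "(hermite n 0)\<^sup>2 \<le> 1"
    using poly_hermite_0_bound[of n] by (simp add: hermite_eq_poly power_divide)
  then show ?thesis by (simp add: abs_square_le_1)
qed


text \<open>Completeness of the Hermite polynomials in a form that needs no Hilbert space \<open>L\<^sup>2\<close>. Interval
  indicators belong to the closure: they are limits of polynomials in \<open>cos (\<omega> (t - c))\<close>, and the
  Taylor polynomials of the cosine are dominated by \<open>exp \<bar>\<omega> (t - c)\<bar>\<close>.\<close>

inductive hermite_closure :: "(real \<Rightarrow> real) \<Rightarrow> bool" where
  hermite: "hermite_closure (hermite n)"
| scale: "hermite_closure g \<Longrightarrow> hermite_closure (\<lambda>t. c * g t)"
| add: "hermite_closure g \<Longrightarrow> hermite_closure h \<Longrightarrow> hermite_closure (\<lambda>t. g t + h t)"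
| limit: "(\<And>k::nat. hermite_closure (g k)) \<Longrightarrow> G \<in> L2 gauss1 \<Longrightarrow> (\<And>k t. \<bar>g k t\<bar> \<le> G t) \<Longrightarrow>
    (\<And>t. (\<lambda>k. g k t) \<longlonglongrightarrow> h t) \<Longrightarrow> hermite_closure h"

text \<open>The induction carries an extra factor \<open>He n\<close> with \<open>n\<close>
  arbitrary: the three-term recurrence then absorbs each multiplication by t into a change of
  \<open>n\<close>.\<close>

lemma hermite_closure_poly: "hermite_closure (poly p)"
proof -
  have "hermite_closure (poly (p * He n))" for n
  proof (induction p arbitrary: n)
    case 0
    have "poly (0 * He n) = (\<lambda>t. 0 * hermite n t)" by (simp add: fun_eq_iff)
    then show ?case using hermite_closure.scale[OF hermite_closure.hermite] by metis
  next
    case (pCons a p)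
    have "hermite_closure (\<lambda>t. (a * sqrt (fact n)) * hermite n t +
        (poly (p * He (Suc n)) t + real n * poly (p * He (n - 1)) t))"
      by (intro hermite_closure.add hermite_closure.scale hermite_closure.hermite pCons.IH)
    also have "pCons a p * He n = smult a (He n) + p * ([:0, 1:] * He n)"
      by simp
    then have "pCons a p * He n = smult a (He n) +
        (p * He (Suc n) + smult (real n) (p * He (n - 1)))"
      by (simp only: pCons_mult_hermite_poly) (simp add: algebra_simps)
    then have "(\<lambda>t. (a * sqrt (fact n)) * hermite n t +
        (poly (p * He (Suc n)) t + real n * poly (p * He (n - 1)) t)) =
        poly (pCons a p * He n)"
      by (simp only: poly_add poly_smult fun_eq_iff) (simp add: hermite_eq_poly)
    finally show ?case .
  qed
  from this[of 0] show ?thesis by simp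
qed

lemma L2_gauss1_exp_linear: "(\<lambda>t. exp (a * t)) \<in> L2 gauss1"
proof -
  \<comment> \<open>Completing the square: the squared function times the density is a multiple of
    the normal density with mean 2a.\<close>
  have eq: "std_normal_density t * exp (2 * a * t) = exp (2 * a\<^sup>2) * normal_density (2 * a) 1 t" for t
    by (simp add: std_normal_density_def normal_density_def exp_add[symmetric] power2_eq_square algebra_simps)
       (simp add: field_simps exp_add[symmetric])
  have "integrable lborel (\<lambda>t. std_normal_density t * exp (2 * a * t))"
    unfolding eq by simp
  then show ?thesis
    by (simp add: L2_real_iff integrable_gauss1_iff exp_double[symmetric] mult.assoc flip: exp_of_nat_mult)
qed

lemma L2_gauss1_exp_abs: "(\<lambda>t. exp \<bar>a * (t - c)\<bar> ^ i) \<in> L2 gauss1"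
proof (rule L2_bound)
  let ?b = "real i * a"
  show "(\<lambda>t. exp (- ?b * c) * exp (?b * t) + exp (?b * c) * exp (- ?b * t)) \<in> L2 gauss1"
    by (intro L2_add L2_scale L2_gauss1_exp_linear)
  show "(\<lambda>t. exp \<bar>a * (t - c)\<bar> ^ i) \<in> borel_measurable gauss1" by measurable
  fix t
  have "exp \<bar>a * (t - c)\<bar> ^ i = exp \<bar>?b * (t - c)\<bar>"
    by (simp add: exp_of_nat_mult[symmetric] abs_mult)
  also have "\<dots> \<le> exp (?b * (t - c)) + exp (- (?b * (t - c)))"
    by (cases "?b * (t - c) \<ge> 0") (auto simp: add_increasing add_increasing2)
  also have "\<dots> = exp (- ?b * c) * exp (?b * t) + exp (?b * c) * exp (- ?b * t)"
    by (simp add: exp_add[symmetric] algebra_simps)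
  finally show "\<bar>exp \<bar>a * (t - c)\<bar> ^ i\<bar> \<le> exp (- ?b * c) * exp (?b * t) + exp (?b * c) * exp (- ?b * t)"
    by simp
qed

lemma cos_partial_sum_bound: "\<bar>\<Sum>k<M. cos_coeff k * x ^ k\<bar> \<le> exp \<bar>x\<bar>"
proof -
  have "\<bar>\<Sum>k<M. cos_coeff k * x ^ k\<bar> \<le> (\<Sum>k<M. \<bar>x\<bar> ^ k /\<^sub>R fact k)"
    by (intro sum_abs[THEN order_trans] sum_mono)
       (auto simp: cos_coeff_def abs_mult power_abs divide_simps)
  also have "\<dots> \<le> (\<Sum>k. \<bar>x\<bar> ^ k /\<^sub>R fact k)"
    by (intro sum_le_suminf summable_exp_generic) auto
  finally show ?thesis by (simp add: exp_def)
qed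

text \<open>Substituting a Taylor polynomial of the cosine into \<open>p\<close> gives a polynomial
  in t. The envelope needed for the limit is a combination of powers of the exponential majorant,
  which are square integrable.\<close>

lemma hermite_closure_poly_cos: "hermite_closure (\<lambda>t. poly p (cos (\<omega> * (t - c))))"
proof (rule hermite_closure.limit)
  define T where "T M = (\<Sum>k<M. smult (cos_coeff k) ([:- \<omega> * c, \<omega>:] ^ k))" for M
  have T: "poly (T M) t = (\<Sum>k<M. cos_coeff k * (\<omega> * (t - c)) ^ k)" for M t
    by (simp add: T_def poly_sum algebra_simps)
  show "hermite_closure (poly (pcompose p (T M)))" for M
    by (rule hermite_closure_poly)
  show "(\<lambda>t. \<Sum>i\<le>degree p. \<bar>coeff p i\<bar> * exp \<bar>\<omega> * (t - c)\<bar> ^ i) \<in> L2 gauss1"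
    by (intro L2_sum L2_scale L2_gauss1_exp_abs) auto
  show "\<bar>poly (pcompose p (T M)) t\<bar> \<le> (\<Sum>i\<le>degree p. \<bar>coeff p i\<bar> * exp \<bar>\<omega> * (t - c)\<bar> ^ i)" for M t
    unfolding poly_pcompose poly_altdef[of p]
    by (intro sum_abs[THEN order_trans] sum_mono)
       (simp add: abs_mult[of "coeff p _"] power_abs T mult_left_mono power_mono cos_partial_sum_bound)
  fix t
  have "(\<lambda>M. poly (T M) t) \<longlonglongrightarrow> cos (\<omega> * (t - c))"
    using cos_converges[of "\<omega> * (t - c)"] by (simp add: T sums_def)
  then show "(\<lambda>M. poly (pcompose p (T M)) t) \<longlonglongrightarrow> poly p (cos (\<omega> * (t - c)))"
    unfolding poly_pcompose by (intro tendsto_intros)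
qed

text \<open>Steepening ramps converge to the indicator, and Weierstrass replaces the k-th ramp on
  [-1, 1], the range of the cosine, by a polynomial with error below 1/(k+1).\<close>

lemma hermite_closure_cos_greater:
  "hermite_closure (\<lambda>t. indicator {\<kappa><..} (cos (\<omega> * (t - c))))"
proof -
  interpret prob_space gauss1 by (rule prob_space_gauss1)
  \<comment> \<open>The ramp vanishes at and below \<kappa> and equals 1 eventually at each point
    above it, which matches the strict inequality in the indicator.\<close>
  define \<phi> where "\<phi> k u = min 1 (max 0 (real k * (u - \<kappa>)))" for k u
  have "\<exists>p::real poly. \<forall>u\<in>{-1..1}. \<bar>\<phi> k u - poly p u\<bar> < 1 / Suc k" for k
  proof -
    have "continuous_on {-1..1} (\<phi> k)"
      unfolding \<phi>_def by (intro continuous_intros)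
    then obtain g where g: "real_polynomial_function g" "\<And>u. u \<in> {-1..1} \<Longrightarrow> \<bar>\<phi> k u - g u\<bar> < 1 / Suc k"
      using Stone_Weierstrass_real_polynomial_function[of "{-1..1}" "\<phi> k" "1 / Suc k"] by auto
    then obtain a n where "g = (\<lambda>x. \<Sum>i\<le>n. a i * x ^ i)"
      unfolding real_polynomial_function_iff_sum by blast
    then have "g = poly (\<Sum>i\<le>n. monom (a i) i)"
      by (simp add: fun_eq_iff poly_sum poly_monom)
    with g(2) show ?thesis by blast
  qed
  then obtain p :: "nat \<Rightarrow> real poly" where p: "\<And>k u. u \<in> {-1..1} \<Longrightarrow> \<bar>\<phi> k u - poly (p k) u\<bar> < 1 / Suc k"
    by metis
  show ?thesis
  proof (rule hermite_closure.limit)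
    show "hermite_closure (\<lambda>t. poly (p k) (cos (\<omega> * (t - c))))" for k
      by (rule hermite_closure_poly_cos)
    show "(\<lambda>t. 2::real) \<in> L2 gauss1" by (simp add: L2_real_iff)
    show "\<bar>poly (p k) (cos (\<omega> * (t - c)))\<bar> \<le> 2" for k t
    proof -
      have "\<bar>\<phi> k (cos (\<omega> * (t - c)))\<bar> \<le> 1" by (simp add: \<phi>_def)
      moreover have "1 / real (Suc k) \<le> 1" by simp
      moreover have "\<bar>\<phi> k (cos (\<omega> * (t - c))) - poly (p k) (cos (\<omega> * (t - c)))\<bar> < 1 / Suc k"
        by (rule p) simp
      ultimately show ?thesis by linarith
    qed
    fix t
    define u where "u = cos (\<omega> * (t - c))"
    have "(\<lambda>k. \<phi> k u) \<longlonglongrightarrow> indicator {\<kappa><..} u"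
    proof (cases "u > \<kappa>")
      case True
      have "eventually (\<lambda>k. real k \<ge> 1 / (u - \<kappa>)) sequentially"
        by (rule eventually_at_top_linorderI[of "nat \<lceil>1 / (u - \<kappa>)\<rceil>"]) linarith
      then have "eventually (\<lambda>k. indicator {\<kappa><..} u = \<phi> k u) sequentially"
        by eventually_elim (use True in \<open>simp add: \<phi>_def divide_simps mult.commute\<close>)
      then show ?thesis by (rule Lim_transform_eventually[OF tendsto_const])
    next
      case False
      then have "\<phi> k u = 0" for k by (simp add: \<phi>_def mult_nonneg_nonpos)
      with False show ?thesis by simp
    qed
    moreover have "(\<lambda>k. \<phi> k u - poly (p k) u) \<longlonglongrightarrow> 0"
    proof (rule tendsto_rabs_zero_cancel, rule tendsto_sandwich[OF _ _ tendsto_const LIMSEQ_inverse_real_of_nat])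
      show "eventually (\<lambda>k. \<bar>\<phi> k u - poly (p k) u\<bar> \<le> inverse (real (Suc k))) sequentially"
        using p[of u] by (intro always_eventually allI less_imp_le) (simp add: u_def inverse_eq_divide)
    qed simp
    ultimately have "(\<lambda>k. \<phi> k u - (\<phi> k u - poly (p k) u)) \<longlonglongrightarrow> indicator {\<kappa><..} u - 0"
      by (rule tendsto_diff)
    then show "(\<lambda>k. poly (p k) (cos (\<omega> * (t - c)))) \<longlonglongrightarrow> indicator {\<kappa><..} (cos (\<omega> * (t - c)))"
      by (simp add: u_def)
  qed
qed

text \<open>Up to distance \<open>L k\<close> from the centre, half a period, the cosine decreases
  with the distance, so exceeding its value at distance \<delta> means being closer than \<delta>.
  The periodic copies of the interval are pushed to infinity as \<open>L k\<close> grows.\<close>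

lemma hermite_closure_interval:
  assumes "\<delta> > 0"
  shows "hermite_closure (indicator {t. \<bar>t - c\<bar> < \<delta>})"
proof (rule hermite_closure.limit)
  interpret prob_space gauss1 by (rule prob_space_gauss1)
  define L where "L k = \<delta> + real (Suc k)" for k
  have L: "L k > 0" "L k > \<delta>" for k using assms by (simp_all add: L_def)
  show "hermite_closure (\<lambda>t. indicator {cos (pi / L k * \<delta>)<..} (cos (pi / L k * (t - c))))" for k
    by (rule hermite_closure_cos_greater)
  show "(\<lambda>t. 1::real) \<in> L2 gauss1" by (simp add: L2_real_iff)
  fix t
  have "eventually (\<lambda>k. real k \<ge> \<bar>t - c\<bar>) sequentially"
    by (rule eventually_at_top_linorderI[of "nat \<lceil>\<bar>t - c\<bar>\<rceil>"]) linarith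
  then have "eventually (\<lambda>k. indicator {t. \<bar>t - c\<bar> < \<delta>} t =
      indicator {cos (pi / L k * \<delta>)<..} (cos (pi / L k * (t - c)))) sequentially"
  proof eventually_elim
    case (elim k)
    then have "\<bar>t - c\<bar> \<le> L k" using assms by (simp add: L_def)
    then have r: "pi / L k * \<bar>t - c\<bar> \<le> pi" "0 \<le> pi / L k * \<bar>t - c\<bar>"
      using L[of k] by (simp_all add: field_simps)
    have d: "pi / L k * \<delta> \<le> pi" "0 \<le> pi / L k * \<delta>"
      using L[of k] assms by (simp_all add: field_simps)
    have "cos (pi / L k * (t - c)) = cos (pi / L k * \<bar>t - c\<bar>)"
    proof (cases "t - c \<ge> 0")
      case False
      then have "pi / L k * \<bar>t - c\<bar> = - (pi / L k * (t - c))"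
        by (simp add: minus_divide_left[symmetric] del: minus_divide_left) (simp add: algebra_simps diff_divide_distrib)
      then show ?thesis by (simp only: cos_minus)
    qed simp
    then have "cos (pi / L k * \<delta>) < cos (pi / L k * (t - c)) \<longleftrightarrow> pi / L k * \<bar>t - c\<bar> < pi / L k * \<delta>"
      using cos_mono_less_eq[OF d(2,1) r(2,1)] by simp
    also have "\<dots> \<longleftrightarrow> \<bar>t - c\<bar> < \<delta>"
      using L[of k] by (simp add: divide_simps)
    finally show ?case by (simp add: indicator_def)
  qed
  then show "(\<lambda>k. indicator {cos (pi / L k * \<delta>)<..} (cos (pi / L k * (t - c)))) \<longlonglongrightarrow> indicat_real {t. \<bar>t - c\<bar> < \<delta>} t"
    by (rule Lim_transform_eventually[OF tendsto_const])
qed (auto simp: indicator_def)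

section \<open>Gaussian product measure and weak derivatives\<close>

lemma product_prob_space_gauss1: "product_prob_space (\<lambda>_::nat. gauss1)"
  by (intro product_prob_spaceI prob_space_gauss1)

lemma prob_space_gauss: "prob_space gauss"
  unfolding gauss_def by (intro prob_space_PiM prob_space_gauss1)

lemma space_gauss [simp]: "space gauss = UNIV"
  by (simp add: gauss_def space_PiM)

lemma measurable_coordinate [measurable]: "(\<lambda>y. y i) \<in> gauss \<rightarrow>\<^sub>M borel"
proof -
  have "(\<lambda>y. y i) \<in> gauss \<rightarrow>\<^sub>M gauss1"
    unfolding gauss_def by (rule measurable_component_singleton) simp
  then show ?thesis by (simp add: measurable_cong_sets[OF refl sets_gauss1])
qed

lemma measurable_gauss_compose:
  "u \<in> borel_measurable borel \<Longrightarrow> (\<lambda>y. u (y i)) \<in> borel_measurable gauss"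
  by (rule measurable_compose[OF measurable_coordinate])

lemma
  fixes u :: "nat \<Rightarrow> real \<Rightarrow> real"
  assumes I: "finite I" and u: "\<And>i. i \<in> I \<Longrightarrow> integrable gauss1 (u i)"
  shows integrable_gauss_prod: "integrable gauss (\<lambda>y. \<Prod>i\<in>I. u i (y i))"
    and integral_gauss_prod: "(\<integral>y. (\<Prod>i\<in>I. u i (y i)) \<partial>gauss) = (\<Prod>i\<in>I. \<integral>t. u i t \<partial>gauss1)"
proof -
  interpret product_prob_space "\<lambda>_::nat. gauss1" UNIV by (rule product_prob_space_gauss1)
  have restr: "(\<lambda>y. restrict y I) \<in> gauss \<rightarrow>\<^sub>M PiM I (\<lambda>_. gauss1)"
    unfolding gauss_def by (rule measurable_restrict_subset) simp
  have D: "distr gauss (PiM I (\<lambda>_. gauss1)) (\<lambda>y. restrict y I) = PiM I (\<lambda>_. gauss1)"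
    unfolding gauss_def using I by (rule distr_PiM_restrict_finite) simp
  have m: "(\<lambda>y. \<Prod>i\<in>I. u i (y i)) \<in> borel_measurable (PiM I (\<lambda>_. gauss1))"
    using product_integrable_prod[OF I u] by (rule borel_measurable_integrable)
  have eq: "(\<Prod>i\<in>I. u i (restrict y I i)) = (\<Prod>i\<in>I. u i (y i))" for y
    by (rule prod.cong) simp_all
  have "integrable (distr gauss (PiM I (\<lambda>_. gauss1)) (\<lambda>y. restrict y I)) (\<lambda>y. \<Prod>i\<in>I. u i (y i))"
    unfolding D using I u by (rule product_integrable_prod)
  then show "integrable gauss (\<lambda>y. \<Prod>i\<in>I. u i (y i))"
    unfolding integrable_distr_eq[OF restr m] eq .
  have "(\<integral>y. (\<Prod>i\<in>I. u i (y i)) \<partial>gauss) =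
      (\<integral>y. (\<Prod>i\<in>I. u i (y i)) \<partial>distr gauss (PiM I (\<lambda>_. gauss1)) (\<lambda>y. restrict y I))"
    unfolding integral_distr[OF restr m] eq ..
  also have "\<dots> = (\<Prod>i\<in>I. \<integral>t. u i t \<partial>gauss1)"
    unfolding D using I u by (rule product_integral_prod)
  finally show "(\<integral>y. (\<Prod>i\<in>I. u i (y i)) \<partial>gauss) = (\<Prod>i\<in>I. \<integral>t. u i t \<partial>gauss1)" .
qed

lemma L2_gauss_prod:
  fixes u :: "nat \<Rightarrow> real \<Rightarrow> real"
  assumes "finite I" and u: "\<And>i. i \<in> I \<Longrightarrow> u i \<in> L2 gauss1"
  shows "(\<lambda>y. \<Prod>i\<in>I. u i (y i)) \<in> L2 gauss"
proof -
  have "(\<lambda>y. \<Prod>i\<in>I. u i (y i)) \<in> borel_measurable gauss"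
  proof (rule borel_measurable_prod)
    show "(\<lambda>y. u i (y i)) \<in> borel_measurable gauss" if "i \<in> I" for i
      using u[OF that] by (intro measurable_gauss_compose[of "u i"]) (simp add: L2_real_iff)
  qed
  moreover have "integrable gauss (\<lambda>y. \<Prod>i\<in>I. (u i (y i))\<^sup>2)"
    using assms by (intro integrable_gauss_prod) (simp_all add: L2_real_iff)
  ultimately show ?thesis by (simp add: L2_real_iff prod_power_distrib)
qed

lemma L2_const: "(\<lambda>_. c::real) \<in> L2 gauss" "(\<lambda>_. c::real) \<in> L2 gauss1"
proof -
  interpret prob_space gauss by (rule prob_space_gauss)
  show "(\<lambda>_. c) \<in> L2 gauss" by (simp add: L2_real_iff)
  interpret g: prob_space gauss1 by (rule prob_space_gauss1)
  show "(\<lambda>_. c) \<in> L2 gauss1" by (simp add: L2_real_iff)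
qed

lemma L2_integrable:
  fixes g :: "real \<Rightarrow> real"
  shows "g \<in> L2 gauss1 \<Longrightarrow> integrable gauss1 g"
  using L2_mult_integrable[OF _ L2_const(2)[of 1]] by simp

definition hermite_multi :: "(nat \<Rightarrow> nat) \<Rightarrow> (nat \<Rightarrow> real) \<Rightarrow> real" where
  "hermite_multi \<nu> y = (\<Prod>j\<in>supp \<nu>. hermite (\<nu> j) (y j))"

definition hcoeff :: "((nat \<Rightarrow> real) \<Rightarrow> real) \<Rightarrow> (nat \<Rightarrow> nat) \<Rightarrow> real" where
  "hcoeff g \<nu> = (\<integral>y. hermite_multi \<nu> y * g y \<partial>gauss)"

lemma prod_supp_superset:
  fixes h :: "nat \<Rightarrow> nat \<Rightarrow> real"
  assumes "finite J" "supp \<nu> \<subseteq> J" "\<And>j. h j 0 = 1"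
  shows "(\<Prod>j\<in>supp \<nu>. h j (\<nu> j)) = (\<Prod>j\<in>J. h j (\<nu> j))"
  using assms by (intro prod.mono_neutral_left) (auto simp: supp_def)

lemma hermite_multi_superset:
  assumes "finite J" "supp \<nu> \<subseteq> J"
  shows "hermite_multi \<nu> y = (\<Prod>j\<in>J. hermite (\<nu> j) (y j))"
  unfolding hermite_multi_def using assms
  by (rule prod_supp_superset[where h="\<lambda>j n. hermite n (y j)"]) simp

lemma L2_hermite_multi: "\<nu> \<in> multi_indices \<Longrightarrow> hermite_multi \<nu> \<in> L2 gauss"
  unfolding hermite_multi_def[abs_def]
  by (intro L2_gauss_prod L2_hermite) (simp add: multi_indices_def)

lemma finite_supp: "\<nu> \<in> multi_indices \<Longrightarrow> finite (supp \<nu>)"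
  by (simp add: multi_indices_def)

text \<open>A coordinate of \<nu> outside \<open>J\<close> meets only the constant 1, and a
  nonconstant Hermite polynomial has mean 0. Thus a function of finitely many coordinates has no
  coefficients beyond them.\<close>

lemma integral_prod_hermite_multi:
  fixes u :: "nat \<Rightarrow> real \<Rightarrow> real"
  assumes J: "finite J" and u: "\<And>j. j \<in> J \<Longrightarrow> u j \<in> L2 gauss1" and \<nu>: "\<nu> \<in> multi_indices"
  shows "(\<integral>y. hermite_multi \<nu> y * (\<Prod>j\<in>J. u j (y j)) \<partial>gauss) =
    (if supp \<nu> \<subseteq> J then \<Prod>j\<in>J. \<integral>t. hermite (\<nu> j) t * u j t \<partial>gauss1 else 0)"
proof -
  define u' where "u' j t = (if j \<in> J then u j t else 1)" for j t
  let ?K = "J \<union> supp \<nu>"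
  have K: "finite ?K" using J \<nu> by (simp add: finite_supp)
  have u'L: "u' j \<in> L2 gauss1" for j
    using u L2_const(2)[of 1] by (cases "j \<in> J") (simp_all add: u'_def[abs_def])
  have "(\<integral>y. hermite_multi \<nu> y * (\<Prod>j\<in>J. u j (y j)) \<partial>gauss) =
      (\<integral>y. (\<Prod>j\<in>?K. hermite (\<nu> j) (y j) * u' j (y j)) \<partial>gauss)"
  proof (rule Bochner_Integration.integral_cong[OF refl])
    fix y :: "nat \<Rightarrow> real"
    have "(\<Prod>j\<in>J. u j (y j)) = (\<Prod>j\<in>?K. u' j (y j))"
      using K by (intro prod.mono_neutral_cong_left) (auto simp: u'_def)
    then show "hermite_multi \<nu> y * (\<Prod>j\<in>J. u j (y j)) = (\<Prod>j\<in>?K. hermite (\<nu> j) (y j) * u' j (y j))"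
      by (simp add: hermite_multi_superset[OF K] prod.distrib)
  qed
  also have "\<dots> = (\<Prod>j\<in>?K. \<integral>t. hermite (\<nu> j) t * u' j t \<partial>gauss1)"
    by (intro integral_gauss_prod K L2_mult_integrable L2_hermite u'L)
  also have "\<dots> = (if supp \<nu> \<subseteq> J then \<Prod>j\<in>J. \<integral>t. hermite (\<nu> j) t * u j t \<partial>gauss1 else 0)"
  proof (cases "supp \<nu> \<subseteq> J")
    case True
    then have "?K = J" by blast
    then show ?thesis using True by (auto simp: u'_def intro!: prod.cong)
  next
    case False
    then obtain j where j: "j \<in> ?K" "j \<notin> J" "\<nu> j \<noteq> 0" by (auto simp: supp_def)
    have "(\<integral>t. hermite (\<nu> j) t * u' j t \<partial>gauss1) = 0"
      using j by (simp add: u'_def integral_hermite)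
    then show ?thesis using False K j(1) by (auto intro!: prod_zero)
  qed
  finally show ?thesis .
qed

lemma hermite_multi_orthonormal:
  assumes "\<mu> \<in> multi_indices" "\<nu> \<in> multi_indices"
  shows "(\<integral>y. hermite_multi \<mu> y * hermite_multi \<nu> y \<partial>gauss) = (if \<mu> = \<nu> then 1 else 0)"
proof -
  let ?J = "supp \<mu> \<union> supp \<nu>"
  have J: "finite ?J" using assms by (simp add: finite_supp)
  have "(\<integral>y. hermite_multi \<mu> y * hermite_multi \<nu> y \<partial>gauss) = (\<Prod>j\<in>?J. if \<mu> j = \<nu> j then 1 else 0)"
    unfolding hermite_multi_superset[OF J Un_upper2]
    by (subst integral_prod_hermite_multi[OF J L2_hermite assms(1)]) (simp add: hermite_orthonormal)
  also have "\<dots> = (if \<mu> = \<nu> then 1 else 0)"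
  proof (cases "\<mu> = \<nu>")
    case False
    then obtain j where "\<mu> j \<noteq> \<nu> j" by blast
    then have "j \<in> ?J" by (auto simp: supp_def)
    with \<open>\<mu> j \<noteq> \<nu> j\<close> J False show ?thesis by (auto intro!: prod_zero)
  qed simp
  finally show ?thesis .
qed

lemma bessel_inequality:
  assumes g: "g \<in> L2 gauss" and F: "finite F" "F \<subseteq> multi_indices"
  shows "(\<Sum>\<nu>\<in>F. (hcoeff g \<nu>)\<^sup>2) \<le> (\<integral>y. (g y)\<^sup>2 \<partial>gauss)"
proof -
  define S where "S y = (\<Sum>\<nu>\<in>F. hcoeff g \<nu> * hermite_multi \<nu> y)" for y
  have H: "hermite_multi \<nu> \<in> L2 gauss" if "\<nu> \<in> F" for \<nu>
    using F that by (intro L2_hermite_multi) auto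
  have S: "S \<in> L2 gauss"
    unfolding S_def by (intro L2_sum L2_scale H F)
  have gg: "integrable gauss (\<lambda>y. (g y)\<^sup>2)" using g by (simp add: L2_real_iff)
  have SS: "integrable gauss (\<lambda>y. (S y)\<^sup>2)" using S by (simp add: L2_real_iff)
  have "(\<integral>y. S y * g y \<partial>gauss) = (\<Sum>\<nu>\<in>F. hcoeff g \<nu> * (\<integral>y. hermite_multi \<nu> y * g y \<partial>gauss))"
    unfolding S_def sum_distrib_right mult.assoc
    by (simp add: L2_mult_integrable[OF H g])
  then have Sg: "(\<integral>y. S y * g y \<partial>gauss) = (\<Sum>\<nu>\<in>F. (hcoeff g \<nu>)\<^sup>2)"
    by (simp add: hcoeff_def power2_eq_square)
  have HS: "(\<integral>y. hermite_multi \<mu> y * S y \<partial>gauss) = hcoeff g \<mu>" if \<mu>: "\<mu> \<in> F" for \<mu>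
  proof -
    have "(\<integral>y. hermite_multi \<mu> y * S y \<partial>gauss) =
        (\<integral>y. (\<Sum>\<nu>\<in>F. hcoeff g \<nu> * (hermite_multi \<mu> y * hermite_multi \<nu> y)) \<partial>gauss)"
      by (simp add: S_def sum_distrib_left mult_ac)
    also have "\<dots> = (\<Sum>\<nu>\<in>F. hcoeff g \<nu> * (\<integral>y. hermite_multi \<mu> y * hermite_multi \<nu> y \<partial>gauss))"
      by (simp add: L2_mult_integrable[OF H[OF \<mu>] H])
    also have "\<dots> = (\<Sum>\<nu>\<in>F. hcoeff g \<nu> * (if \<mu> = \<nu> then 1 else 0))"
      using F \<mu> by (intro sum.cong refl arg_cong2[where f="(*)"] hermite_multi_orthonormal) auto
    also have "\<dots> = hcoeff g \<mu>" using F \<mu> by (simp add: if_distrib sum.delta cong: if_cong)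
    finally show ?thesis .
  qed
  have "(\<integral>y. (S y)\<^sup>2 \<partial>gauss) = (\<integral>y. (\<Sum>\<mu>\<in>F. hcoeff g \<mu> * (hermite_multi \<mu> y * S y)) \<partial>gauss)"
  proof (rule Bochner_Integration.integral_cong[OF refl])
    show "(S y)\<^sup>2 = (\<Sum>\<mu>\<in>F. hcoeff g \<mu> * (hermite_multi \<mu> y * S y))" for y
      unfolding power2_eq_square by (subst (1) S_def) (simp add: sum_distrib_right mult.assoc)
  qed
  also have "\<dots> = (\<Sum>\<mu>\<in>F. hcoeff g \<mu> * (\<integral>y. hermite_multi \<mu> y * S y \<partial>gauss))"
    by (simp add: L2_mult_integrable[OF H S])
  also have "\<dots> = (\<Sum>\<nu>\<in>F. (hcoeff g \<nu>)\<^sup>2)"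
    by (intro sum.cong refl) (simp add: HS power2_eq_square)
  finally have SS': "(\<integral>y. (S y)\<^sup>2 \<partial>gauss) = (\<Sum>\<nu>\<in>F. (hcoeff g \<nu>)\<^sup>2)" .
  have "0 \<le> (\<integral>y. (g y - S y)\<^sup>2 \<partial>gauss)" by simp
  also have "\<dots> = (\<integral>y. ((g y)\<^sup>2 + (S y)\<^sup>2) - 2 * (S y * g y) \<partial>gauss)"
    by (simp add: power2_diff mult_ac)
  also have "\<dots> = (\<integral>y. (g y)\<^sup>2 \<partial>gauss) - (\<Sum>\<nu>\<in>F. (hcoeff g \<nu>)\<^sup>2)"
    using gg SS L2_mult_integrable[OF S g] by (simp add: SS' Sg)
  finally show ?thesis by simp
qed

section \<open>Smooth cutoffs and Hermite polynomials as limits of test functions\<close>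

lemma derivs_mult:
  assumes "derivs a" "derivs b"
  shows "derivs (\<lambda>k t. \<Sum>i\<le>k. real (k choose i) * a i t * b (k - i) t)"
  unfolding derivs_def
proof (intro allI)
  fix k t
  have a: "(a i has_real_derivative a (Suc i) t) (at t)" and b: "(b i has_real_derivative b (Suc i) t) (at t)" for i
    using assms by (simp_all add: derivs_def)
  have "((\<lambda>t. \<Sum>i\<le>k. real (k choose i) * a i t * b (k - i) t) has_real_derivative
      (\<Sum>i\<le>k. real (k choose i) * a (Suc i) t * b (k - i) t + real (k choose i) * a i t * b (Suc (k - i)) t)) (at t)"
    by (auto intro!: derivative_eq_intros a b sum.cong simp: algebra_simps)
  also have "(\<Sum>i\<le>k. real (k choose i) * a (Suc i) t * b (k - i) t + real (k choose i) * a i t * b (Suc (k - i)) t) =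
      (\<Sum>i\<le>k. real (k choose i) * a (Suc i) t * b (k - i) t) + (\<Sum>i\<le>k. real (k choose i) * a i t * b (Suc k - i) t)"
    by (simp add: sum.distrib Suc_diff_le)
  also have "(\<Sum>i\<le>k. real (k choose i) * a i t * b (Suc k - i) t) = (\<Sum>i\<le>Suc k. real (k choose i) * a i t * b (Suc k - i) t)"
    by simp
  also have "\<dots> = a 0 t * b (Suc k) t + (\<Sum>i\<le>k. real (k choose Suc i) * a (Suc i) t * b (k - i) t)"
    by (subst sum.atMost_Suc_shift) simp
  also have "(\<Sum>i\<le>k. real (k choose i) * a (Suc i) t * b (k - i) t) + \<dots> =
      a 0 t * b (Suc k) t + (\<Sum>i\<le>k. real (Suc k choose Suc i) * a (Suc i) t * b (k - i) t)"
    by (simp add: sum.distrib[symmetric] algebra_simps)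
  also have "\<dots> = (\<Sum>i\<le>Suc k. real (Suc k choose i) * a i t * b (Suc k - i) t)"
    by (subst sum.atMost_Suc_shift) simp
  finally show "((\<lambda>t. \<Sum>i\<le>k. real (k choose i) * a i t * b (k - i) t) has_real_derivative
      (\<Sum>i\<le>Suc k. real (Suc k choose i) * a i t * b (Suc k - i) t)) (at t)" .
qed

lemma derivs_affine:
  assumes "derivs g"
  shows "derivs (\<lambda>k t. a ^ k * g k (a * t + b))"
  unfolding derivs_def
proof (intro allI)
  fix k t
  have "((\<lambda>t. g k (a * t + b)) has_real_derivative g (Suc k) (a * t + b) * a) (at t)"
    using assms unfolding derivs_def
    by (intro DERIV_chain2[where f="g k"]) (auto intro!: derivative_eq_intros)
  then show "((\<lambda>t. a ^ k * g k (a * t + b)) has_real_derivative a ^ Suc k * g (Suc k) (a * t + b)) (at t)"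
    by (auto intro!: derivative_eq_intros)
qed

lemma derivs_shift: "derivs g \<Longrightarrow> derivs (\<lambda>k. g (n + k))"
  by (simp add: derivs_def)

lemma derivs_continuous: "derivs g \<Longrightarrow> continuous_on S (g k)"
  unfolding derivs_def by (meson DERIV_continuous continuous_at_imp_continuous_on)

text \<open>The k-th derivative of exp(-1/t) is a polynomial in s = 1/t times exp(-s). Since ds/dt =
  -s^2, the polynomials satisfy P_(k+1) = s^2 (P_k - P_k').\<close>

primrec flat_poly :: "nat \<Rightarrow> real poly" where
  "flat_poly 0 = 1"
| "flat_poly (Suc k) = [:0, 0, 1:] * (flat_poly k - pderiv (flat_poly k))"

definition flat :: "nat \<Rightarrow> real \<Rightarrow> real" where
  "flat k t = (if t > 0 then poly (flat_poly k) (1 / t) * exp (- (1 / t)) else 0)"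

lemma poly_exp_tendsto_0: "((\<lambda>x::real. poly p x * exp (- x)) \<longlongrightarrow> 0) at_top"
proof -
  have "((\<lambda>x. \<Sum>i\<le>degree p. coeff p i * (x ^ i / exp x)) \<longlongrightarrow> (\<Sum>i\<le>degree p. coeff p i * 0)) at_top"
    by (intro tendsto_intros tendsto_power_div_exp_0)
  then show ?thesis by (simp add: poly_altdef sum_distrib_right sum_distrib_left exp_minus divide_inverse mult_ac)
qed

lemma derivs_flat: "derivs flat"
  unfolding derivs_def
proof (intro allI)
  fix k :: nat and t :: real
  consider "t > 0" | "t < 0" | "t = 0" by linarith
  then show "(flat k has_real_derivative flat (Suc k) t) (at t)"
  proof cases
    case 1
    have "((\<lambda>t. poly (flat_poly k) (1 / t) * exp (- (1 / t))) has_real_derivative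
        poly (pderiv (flat_poly k)) (1 / t) * (- 1 / t\<^sup>2) * exp (- (1 / t)) +
        poly (flat_poly k) (1 / t) * (exp (- (1 / t)) * (1 / t\<^sup>2))) (at t)"
      using 1 by (auto intro!: derivative_eq_intros DERIV_chain2[where f="poly (flat_poly k)"] poly_DERIV
           simp: power2_eq_square)
    also have "poly (pderiv (flat_poly k)) (1 / t) * (- 1 / t\<^sup>2) * exp (- (1 / t)) +
        poly (flat_poly k) (1 / t) * (exp (- (1 / t)) * (1 / t\<^sup>2)) = flat (Suc k) t"
      using 1 by (simp add: flat_def power2_eq_square field_simps)
    finally show ?thesis
      using 1 by (elim has_field_derivative_transform_within_open[where S="{0<..}"]) (auto simp: flat_def)
  next
    case 2
    have "((\<lambda>_. 0) has_real_derivative flat (Suc k) t) (at t)" using 2 by (simp add: flat_def)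
    then show ?thesis
      using 2 by (elim has_field_derivative_transform_within_open[where S="{..<0}"]) (auto simp: flat_def)
  next
    case 3
    \<comment> \<open>At 0 the difference quotient from the right is s P_k(s) exp(-s) with s = 1/h
      tending to infinity, so the exponential wins.\<close>
    have "((\<lambda>h. (flat k h - flat k 0) / (h - 0)) \<longlongrightarrow> 0) (at 0)"
    proof (rule filterlim_split_at)
      show "((\<lambda>h. (flat k h - flat k 0) / (h - 0)) \<longlongrightarrow> 0) (at_left 0)"
        by (rule Lim_transform_eventually[OF tendsto_const])
           (auto simp: eventually_at_filter flat_def)
      have "((\<lambda>h. poly ([:0, 1:] * flat_poly k) (inverse h) * exp (- inverse h)) \<longlongrightarrow> 0) (at_right 0)"
        by (rule filterlim_compose[OF poly_exp_tendsto_0 filterlim_inverse_at_top_right])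
      then show "((\<lambda>h. (flat k h - flat k 0) / (h - 0)) \<longlongrightarrow> 0) (at_right 0)"
        by (rule Lim_transform_eventually)
           (auto simp: eventually_at_filter flat_def field_simps)
    qed
    then show ?thesis using 3 by (simp add: has_field_derivative_iff flat_def)
  qed
qed

lemma continuous_bounded_on_interval:
  fixes g :: "real \<Rightarrow> real"
  assumes "continuous_on {a..b} g"
  shows "\<exists>C. \<forall>t\<in>{a..b}. \<bar>g t\<bar> \<le> C"
proof -
  have "bounded (g ` {a..b})"
    by (intro compact_imp_bounded compact_continuous_image assms) simp
  then show ?thesis by (auto simp: bounded_iff)
qed

lemma bump_exists:
  obtains X :: "nat \<Rightarrow> real \<Rightarrow> real" and C :: "nat \<Rightarrow> real"
  where "derivs X" "\<And>t. \<bar>t\<bar> > 1 \<Longrightarrow> X 0 t = 0" "X 0 0 \<noteq> 0" "\<And>k t. \<bar>X k t\<bar> \<le> C k"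
proof -
  \<comment> \<open>A product of two flat functions, one vanishing for t \<le> -1 and the other for
    t \<ge> 1. The sum is its k-th derivative by the Leibniz rule, with sign powers from the inner
    factor -1.\<close>
  define X where "X k t = (\<Sum>i\<le>k. real (k choose i) * (1 ^ i * flat i (1 * t + 1)) * ((-1) ^ (k - i) * flat (k - i) (-1 * t + 1)))" for k t
  have X: "derivs X"
    unfolding X_def[abs_def] by (intro derivs_mult derivs_affine derivs_flat)
  have z: "X k t = 0" if "\<bar>t\<bar> > 1" for k t
  proof (cases "t > 1")
    case True
    then show ?thesis by (simp add: X_def flat_def)
  next
    case False
    with that have "t < -1" by linarith
    then show ?thesis by (simp add: X_def flat_def)
  qed
  have "\<exists>C. \<forall>t. \<bar>X k t\<bar> \<le> C" for k
  proof -
    obtain C where C: "\<And>t. t \<in> {-1..1} \<Longrightarrow> \<bar>X k t\<bar> \<le> C"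
      using continuous_bounded_on_interval[OF derivs_continuous[OF X], of "-1" 1 k] by blast
    have "\<bar>X k t\<bar> \<le> max C 0" for t
    proof (cases "\<bar>t\<bar> > 1")
      case False
      then have "\<bar>X k t\<bar> \<le> C" by (intro C) auto
      then show ?thesis by simp
    qed (simp add: z)
    then show ?thesis by blast
  qed
  then obtain C where "\<And>k t. \<bar>X k t\<bar> \<le> C k" by metis
  moreover have "X 0 0 \<noteq> 0" by (simp add: X_def flat_def)
  ultimately show ?thesis using X z that by blast
qed

text \<open>Test functions \<open>\<chi> (t / R) H\<^sub>n(t) \<rho>(t)\<close> with a cutoff \<open>\<chi>\<close> and \<open>R \<rightarrow> \<infinity>\<close>.\<close>

lemma weak_partial_hermite_poly:
  fixes f g :: "(nat \<Rightarrow> real) \<Rightarrow> real"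
  assumes f: "f \<in> L2 gauss" and g: "g \<in> L2 gauss" and I: "finite I"
    and weak: "\<And>\<psi>. (\<And>i. i \<in> I \<Longrightarrow> test_function (\<psi> i)) \<Longrightarrow>
        (\<integral>y. (\<Prod>i\<in>I. \<psi> i (y i) / std_normal_density (y i)) * g y \<partial>gauss) =
        (-1) ^ (\<Sum>i\<in>I. \<mu> i) *
          (\<integral>y. (\<Prod>i\<in>I. (deriv ^^ \<mu> i) (\<psi> i) (y i) / std_normal_density (y i)) * f y \<partial>gauss)"
  shows "(\<integral>y. (\<Prod>i\<in>I. poly (He (\<nu> i)) (y i)) * g y \<partial>gauss) =
    (\<integral>y. (\<Prod>i\<in>I. poly (He (\<nu> i + \<mu> i)) (y i)) * f y \<partial>gauss)"
proof -
  obtain X :: "nat \<Rightarrow> real \<Rightarrow> real" and C :: "nat \<Rightarrow> real" where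
    X: "derivs X" "\<And>t. \<bar>t\<bar> > 1 \<Longrightarrow> X 0 t = 0" "X 0 0 \<noteq> 0" "\<And>k t. \<bar>X k t\<bar> \<le> C k"
    using bump_exists by blast
  define r where "r N = 1 / real (Suc N)" for N
  have r: "0 < r N" "r N \<le> 1" for N by (simp_all add: r_def)
  have r0: "r \<longlonglongrightarrow> 0"
    unfolding r_def using LIMSEQ_inverse_real_of_nat by (simp add: inverse_eq_divide)
  \<comment> \<open>\<open>A N k\<close> is the k-th derivative of the cutoff at scale N + 1,
    \<open>B n k\<close> the k-th derivative of the n-th derivative of the density, and
    \<open>\<Psi> N n k\<close> the k-th derivative of the product of the two.\<close>
  define A where "A N k t = r N ^ k * X k (r N * t + 0)" for N k t
  define B where "B n k t = (-1) ^ (n + k) * poly (He (n + k)) t * std_normal_density t" for n k t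
  define \<Psi> where "\<Psi> N n k t = (\<Sum>i\<le>k. real (k choose i) * A N i t * B n (k - i) t)" for N n k t
  have dA: "derivs (A N)" for N unfolding A_def[abs_def] by (intro derivs_affine X)
  have dB: "derivs (B n)" for n
    unfolding B_def[abs_def] using derivs_shift[OF derivs_std_normal, of n] .
  have d\<Psi>: "derivs (\<Psi> N n)" for N n unfolding \<Psi>_def[abs_def] by (intro derivs_mult dA dB)
  have \<Psi>_k: "(deriv ^^ k) (\<Psi> N n 0) = \<Psi> N n k" for N n k by (rule derivs_funpow_deriv[OF d\<Psi>])
  have test: "test_function (\<Psi> N n 0)" for N n
    unfolding test_function_def \<Psi>_k
  proof (intro conjI allI)
    show "\<Psi> N n k differentiable at t" for k t
      using d\<Psi>[of N n] unfolding derivs_def real_differentiable_def by blast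
    have "{t. \<Psi> N n 0 t \<noteq> 0} \<subseteq> {- real (Suc N)..real (Suc N)}"
    proof
      fix t assume "t \<in> {t. \<Psi> N n 0 t \<noteq> 0}"
      then have "X 0 (r N * t) \<noteq> 0" by (auto simp: \<Psi>_def A_def)
      then have "\<bar>r N * t\<bar> \<le> 1" using X(2) by force
      then have "\<bar>t\<bar> \<le> real (Suc N)" by (simp add: r_def abs_mult field_simps)
      then show "t \<in> {- real (Suc N)..real (Suc N)}" by auto
    qed
    then show "bounded {t. \<Psi> N n 0 t \<noteq> 0}" using bounded_closed_interval bounded_subset by blast
  qed
  define U where "U n k N t = \<Psi> N n k t / std_normal_density t" for N n k t
  \<comment> \<open>Powers of \<open>r N\<close> are at most 1, so this envelope for the quotients
    \<open>U n k N\<close> does not depend on \<open>N\<close>.\<close>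
  define G where "G n k t = (\<Sum>i\<le>k. real (k choose i) * C i * \<bar>poly (He (n + (k - i))) t\<bar>)" for n k t
  have Ueq: "U n k N t = (\<Sum>i\<le>k. real (k choose i) * A N i t * ((-1) ^ (n + (k - i)) * poly (He (n + (k - i))) t))" for n k N t
    using normal_density_pos[of 1 0 t]
    by (simp add: U_def \<Psi>_def B_def sum_divide_distrib mult.assoc)
  have C0: "0 \<le> C k" for k using X(4)[of k 0] by linarith
  have U_bound: "\<bar>U n k N t\<bar> \<le> G n k t" for n k N t
  proof -
    have A: "\<bar>A N i t\<bar> \<le> C i" for i
    proof -
      have "\<bar>A N i t\<bar> \<le> 1 * C i"
        unfolding A_def abs_mult using r[of N] X(4) C0 by (intro mult_mono) (auto simp: power_le_one)
      then show ?thesis by simp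
    qed
    show ?thesis
      unfolding Ueq G_def
      by (intro sum_abs[THEN order_trans] sum_mono)
         (simp add: abs_mult power_abs A mult_mono mult_left_mono mult_right_mono)
  qed
  have G: "G n k \<in> L2 gauss1" for n k
    unfolding G_def[abs_def]
  proof (intro L2_sum L2_scale)
    show "(\<lambda>t. \<bar>poly (He (n + (k - i))) t\<bar>) \<in> L2 gauss1" for i
      using L2_poly[of "He (n + (k - i))"] by (simp add: L2_real_iff)
  qed simp
  have Um: "U n k N \<in> borel_measurable borel" for n k N
    unfolding Ueq
    by (intro borel_measurable_continuous_onI continuous_intros derivs_continuous[OF dA])
  have U_lim: "(\<lambda>N. U n k N t) \<longlonglongrightarrow> X 0 0 * ((-1) ^ (n + k) * poly (He (n + k)) t)" for n k t
  proof -
    have A: "(\<lambda>N. A N i t) \<longlonglongrightarrow> 0 ^ i * X i 0" for i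
    proof -
      have "(\<lambda>N. r N * t + 0) \<longlonglongrightarrow> 0 * t + 0" by (intro tendsto_intros r0)
      then have "(\<lambda>N. r N * t + 0) \<longlonglongrightarrow> 0" by simp
      then have "(\<lambda>N. X i (r N * t + 0)) \<longlonglongrightarrow> X i 0"
        by (intro continuous_on_tendsto_compose[OF derivs_continuous[OF X(1), of UNIV]]) auto
      then show ?thesis unfolding A_def by (intro tendsto_intros r0)
    qed
    have "(\<lambda>N. U n k N t) \<longlonglongrightarrow> (\<Sum>i\<le>k. real (k choose i) * (0 ^ i * X i 0) * ((-1) ^ (n + (k - i)) * poly (He (n + (k - i))) t))"
      unfolding Ueq by (intro tendsto_intros A)
    \<comment> \<open>A derivative that falls on the cutoff carries a power of \<open>r N\<close>,
      which tends to 0; with 0 ^ 0 = 1 only the term i = 0 survives.\<close>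
    also have "(\<Sum>i\<le>k. real (k choose i) * (0 ^ i * X i 0) * ((-1) ^ (n + (k - i)) * poly (He (n + (k - i))) t)) =
        (\<Sum>i\<in>{0}. real (k choose i) * (0 ^ i * X i 0) * ((-1) ^ (n + (k - i)) * poly (He (n + (k - i))) t))"
      by (rule sum.mono_neutral_right) auto
    finally show ?thesis by simp
  qed
  let ?L = "\<lambda>k y. \<Prod>i\<in>I. X 0 0 * ((-1) ^ (\<nu> i + k i) * poly (He (\<nu> i + k i)) (y i))"
  have lim: "(\<lambda>N. \<integral>y. (\<Prod>i\<in>I. U (\<nu> i) (k i) N (y i)) * h y \<partial>gauss) \<longlonglongrightarrow>
      (\<integral>y. ?L k y * h y \<partial>gauss)"
    if h: "h \<in> L2 gauss" for h k
  proof (rule integral_dominated_convergence)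
    have [measurable]: "h \<in> borel_measurable gauss" using h by (rule L2_measurable)
    show "(\<lambda>y. ?L k y * h y) \<in> borel_measurable gauss"
      by measurable
    show "(\<lambda>y. (\<Prod>i\<in>I. U (\<nu> i) (k i) N (y i)) * h y) \<in> borel_measurable gauss" for N
    proof (rule borel_measurable_times[OF borel_measurable_prod])
      show "(\<lambda>y. U (\<nu> i) (k i) N (y i)) \<in> borel_measurable gauss" for i
        by (rule measurable_gauss_compose[OF Um])
    qed measurable
    have "(\<lambda>y. \<bar>h y\<bar>) \<in> L2 gauss" using h by (simp add: L2_real_iff)
    then show "integrable gauss (\<lambda>y. (\<Prod>i\<in>I. G (\<nu> i) (k i) (y i)) * \<bar>h y\<bar>)"
      using L2_gauss_prod[OF I, of "\<lambda>i. G (\<nu> i) (k i)"] G by (intro L2_mult_integrable) auto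
    show "AE y in gauss. (\<lambda>N. (\<Prod>i\<in>I. U (\<nu> i) (k i) N (y i)) * h y) \<longlonglongrightarrow>
        ?L k y * h y"
      by (intro AE_I2 tendsto_intros U_lim)
    show "AE y in gauss. norm ((\<Prod>i\<in>I. U (\<nu> i) (k i) N (y i)) * h y) \<le> (\<Prod>i\<in>I. G (\<nu> i) (k i) (y i)) * \<bar>h y\<bar>" for N
      by (intro AE_I2) (auto simp: abs_mult abs_prod intro!: mult_right_mono prod_mono U_bound)
  qed
  define P where "P k y = (\<Prod>i\<in>I. poly (He (\<nu> i + k i)) (y i))" for k y
  define c where "c k = (\<Prod>i\<in>I. X 0 0 * (-1) ^ (\<nu> i + k i))" for k
  have cP: "?L k y * h y = c k * (P k y * h y)" for k y h
    by (simp add: c_def P_def prod.distrib mult_ac)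
  have "(\<integral>y. (\<Prod>i\<in>I. U (\<nu> i) 0 N (y i)) * g y \<partial>gauss) =
      (-1) ^ (\<Sum>i\<in>I. \<mu> i) * (\<integral>y. (\<Prod>i\<in>I. U (\<nu> i) (\<mu> i) N (y i)) * f y \<partial>gauss)" for N
    using weak[of "\<lambda>i. \<Psi> N (\<nu> i) 0"] test by (simp add: U_def \<Psi>_k)
  moreover have "(\<lambda>N. \<integral>y. (\<Prod>i\<in>I. U (\<nu> i) 0 N (y i)) * g y \<partial>gauss) \<longlonglongrightarrow> (\<integral>y. c (\<lambda>_. 0) * (P (\<lambda>_. 0) y * g y) \<partial>gauss)"
    unfolding cP[symmetric] by (rule lim[OF g, of "\<lambda>_. 0"])
  moreover have "(\<lambda>N. (-1) ^ (\<Sum>i\<in>I. \<mu> i) * (\<integral>y. (\<Prod>i\<in>I. U (\<nu> i) (\<mu> i) N (y i)) * f y \<partial>gauss)) \<longlonglongrightarrow>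
      (-1) ^ (\<Sum>i\<in>I. \<mu> i) * (\<integral>y. c \<mu> * (P \<mu> y * f y) \<partial>gauss)"
    using lim[OF f, of \<mu>] unfolding cP by (intro tendsto_intros)
  ultimately have "(\<integral>y. c (\<lambda>_. 0) * (P (\<lambda>_. 0) y * g y) \<partial>gauss) = (-1) ^ (\<Sum>i\<in>I. \<mu> i) * (\<integral>y. c \<mu> * (P \<mu> y * f y) \<partial>gauss)"
    by (simp only: LIMSEQ_unique)
  then have "c (\<lambda>_. 0) * (\<integral>y. P (\<lambda>_. 0) y * g y \<partial>gauss) = ((-1) ^ (\<Sum>i\<in>I. \<mu> i) * c \<mu>) * (\<integral>y. P \<mu> y * f y \<partial>gauss)"
    by simp
  \<comment> \<open>The sign of the weak derivative cancels the sign in the Hermite representation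
    of the additional \<mu> derivatives of the density.\<close>
  moreover have "(-1) ^ (\<Sum>i\<in>I. \<mu> i) * c \<mu> = c (\<lambda>_. 0)"
    unfolding c_def power_sum prod.distrib[symmetric]
    by (intro prod.cong refl) (simp add: power_add flip: power_mult_distrib)
  moreover have "c (\<lambda>_. 0) \<noteq> 0" unfolding c_def using X(3) I by simp
  ultimately show ?thesis by (simp add: P_def)
qed

section \<open>The weights \<open>b\<close>\<close>

definition below :: "(nat \<Rightarrow> nat) \<Rightarrow> (nat \<Rightarrow> nat) set" where
  "below \<nu> = {\<mu>. \<forall>j. \<mu> j \<le> \<nu> j}"

lemma bij_betw_below_PiE:
  assumes "supp \<nu> \<subseteq> J"
  shows "bij_betw (\<lambda>\<mu>. restrict \<mu> J) (below \<nu>) (PiE J (\<lambda>j. {..\<nu> j}))"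
proof (rule bij_betw_byWitness[where f'="\<lambda>g j. if j \<in> J then g j else 0"])
  show "\<forall>\<mu>\<in>below \<nu>. (\<lambda>j. if j \<in> J then restrict \<mu> J j else 0) = \<mu>"
  proof
    fix \<mu> assume "\<mu> \<in> below \<nu>"
    then have "\<mu> j \<le> \<nu> j" for j by (simp add: below_def)
    then have "\<mu> j = 0" if "j \<notin> J" for j
      using assms that by (metis (mono_tags, lifting) le_zero_eq mem_Collect_eq subsetD supp_def)
    then show "(\<lambda>j. if j \<in> J then restrict \<mu> J j else 0) = \<mu>" by (auto simp: fun_eq_iff)
  qed
  show "\<forall>g\<in>PiE J (\<lambda>j. {..\<nu> j}). restrict (\<lambda>j. if j \<in> J then g j else 0) J = g"
    by (auto simp: fun_eq_iff PiE_def extensional_def)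
  show "(\<lambda>\<mu>. restrict \<mu> J) ` below \<nu> \<subseteq> PiE J (\<lambda>j. {..\<nu> j})"
    by (auto simp: below_def)
  show "(\<lambda>g j. if j \<in> J then g j else 0) ` PiE J (\<lambda>j. {..\<nu> j}) \<subseteq> below \<nu>"
    by (auto simp: below_def PiE_def Pi_def)
qed

lemma finite_below: "\<nu> \<in> multi_indices \<Longrightarrow> finite (below \<nu>)"
  using bij_betw_finite[OF bij_betw_below_PiE[OF order_refl, of \<nu>]]
  by (simp add: finite_PiE multi_indices_def)

lemma below_supp: "\<mu> \<in> below \<nu> \<Longrightarrow> supp \<mu> \<subseteq> supp \<nu>"
  by (auto simp: below_def supp_def intro: less_le_trans)

lemma below_multi_indices: "\<nu> \<in> multi_indices \<Longrightarrow> below \<nu> \<subseteq> multi_indices"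
  using below_supp by (auto simp: multi_indices_def intro: finite_subset)

text \<open>The distributive law behind every factorisation in the proof: of the weights, of sums
  over all multi-indices, and of the exactness and growth of the sparse quadrature.\<close>

lemma sum_below_prod:
  fixes a :: "nat \<Rightarrow> nat \<Rightarrow> real"
  assumes "finite J" "supp \<nu> \<subseteq> J"
  shows "(\<Sum>\<mu>\<in>below \<nu>. \<Prod>j\<in>J. a j (\<mu> j)) = (\<Prod>j\<in>J. \<Sum>n\<le>\<nu> j. a j n)"
proof -
  have "(\<Prod>j\<in>J. \<Sum>n\<le>\<nu> j. a j n) = (\<Sum>g\<in>PiE J (\<lambda>j. {..\<nu> j}). \<Prod>j\<in>J. a j (g j))"
    using assms by (intro prod_sum_PiE) auto
  also have "\<dots> = (\<Sum>\<mu>\<in>below \<nu>. \<Prod>j\<in>J. a j (restrict \<mu> J j))"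
    by (rule sum.reindex_bij_betw[OF bij_betw_below_PiE[OF assms(2)], symmetric])
  also have "\<dots> = (\<Sum>\<mu>\<in>below \<nu>. \<Prod>j\<in>J. a j (\<mu> j))"
    by (intro sum.cong prod.cong) auto
  finally show ?thesis by simp
qed

definition b_factor :: "nat \<Rightarrow> real \<Rightarrow> nat \<Rightarrow> real" where
  "b_factor r t n = (\<Sum>l\<le>r. real (n choose l) * t ^ (2 * l))"

text \<open>An index outside the box has a coordinate with \<open>\<nu> j\<close> = 0 <
  \<open>\<mu> j\<close>, where the binomial vanishes. The box has side \<open>r\<close> on the
  support of \<nu>, rather than \<open>\<nu> j\<close>, so that its factors are sums over l \<le>
  r.\<close>

lemma b_val_terms:
  fixes r :: nat
  assumes \<nu>: "\<nu> \<in> multi_indices"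
  defines "B \<equiv> below (\<lambda>j. if j \<in> supp \<nu> then r else 0)"
  shows "finite B" "B \<subseteq> multi_indices_le r" "b_val r \<tau> \<nu> = (\<Sum>\<mu>\<in>B. mbinom \<nu> \<mu> * weight \<tau> \<mu>)"
    "\<And>\<mu>. \<mu> \<in> multi_indices_le r \<Longrightarrow> \<mu> \<notin> B \<Longrightarrow> mbinom \<nu> \<mu> = 0"
proof -
  have s: "supp (\<lambda>j. if j \<in> supp \<nu> then r else 0) \<subseteq> supp \<nu>" by (auto simp: supp_def)
  then have m: "(\<lambda>j. if j \<in> supp \<nu> then r else 0) \<in> multi_indices"
    using \<nu> by (auto simp: multi_indices_def intro: finite_subset)
  show fB: "finite B" unfolding B_def by (rule finite_below[OF m])
  show sub: "B \<subseteq> multi_indices_le r"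
    using below_multi_indices[OF m] unfolding B_def multi_indices_le_def
    by (auto simp: below_def) (metis le_zero_eq zero_le)
  show z: "mbinom \<nu> \<mu> = 0" if \<mu>: "\<mu> \<in> multi_indices_le r" "\<mu> \<notin> B" for \<mu>
  proof -
    obtain j where j: "\<not> \<mu> j \<le> (if j \<in> supp \<nu> then r else 0)"
      using \<mu>(2) by (auto simp: B_def below_def)
    with \<mu>(1) have "j \<notin> supp \<nu>" "j \<in> supp \<mu>" by (auto simp: multi_indices_le_def supp_def split: if_splits)
    moreover have "finite (supp \<mu>)" using \<mu>(1) by (simp add: multi_indices_le_def multi_indices_def)
    ultimately show ?thesis unfolding mbinom_def by (auto simp: supp_def intro!: prod_zero)
  qed
  have "b_val r \<tau> \<nu> = (\<Sum>\<^sub>\<infinity>\<mu>\<in>B. mbinom \<nu> \<mu> * weight \<tau> \<mu>)"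
    unfolding b_val_def using sub z by (intro infsum_cong_neutral) auto
  then show "b_val r \<tau> \<nu> = (\<Sum>\<mu>\<in>B. mbinom \<nu> \<mu> * weight \<tau> \<mu>)"
    using fB by simp
qed

lemma b_val_eq_prod:
  assumes \<nu>: "\<nu> \<in> multi_indices"
  shows "b_val r \<tau> \<nu> = (\<Prod>j\<in>supp \<nu>. b_factor r (\<tau> j) (\<nu> j))"
proof -
  let ?m = "\<lambda>j. if j \<in> supp \<nu> then r else 0"
  have f: "finite (supp \<nu>)" using \<nu> by (rule finite_supp)
  have s: "supp ?m \<subseteq> supp \<nu>" by (auto simp: supp_def)
  have "b_val r \<tau> \<nu> = (\<Sum>\<mu>\<in>below ?m. \<Prod>j\<in>supp \<nu>. real (\<nu> j choose \<mu> j) * \<tau> j ^ (2 * \<mu> j))"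
    unfolding b_val_terms(3)[OF \<nu>]
  proof (rule sum.cong[OF refl])
    fix \<mu> assume "\<mu> \<in> below ?m"
    then have sub: "supp \<mu> \<subseteq> supp \<nu>" using below_supp s by blast
    show "mbinom \<nu> \<mu> * weight \<tau> \<mu> = (\<Prod>j\<in>supp \<nu>. real (\<nu> j choose \<mu> j) * \<tau> j ^ (2 * \<mu> j))"
      unfolding mbinom_def weight_def prod.distrib[symmetric]
      by (rule prod_supp_superset[OF f sub, where h="\<lambda>j n. real (\<nu> j choose n) * \<tau> j ^ (2 * n)"]) simp
  qed
  also have "\<dots> = (\<Prod>j\<in>supp \<nu>. \<Sum>n\<le>?m j. real (\<nu> j choose n) * \<tau> j ^ (2 * n))"
    by (rule sum_below_prod[OF f s, where a="\<lambda>j n. real (\<nu> j choose n) * \<tau> j ^ (2 * n)"])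
  also have "\<dots> = (\<Prod>j\<in>supp \<nu>. b_factor r (\<tau> j) (\<nu> j))"
    by (intro prod.cong) (auto simp: b_factor_def)
  finally show ?thesis .
qed

lemma b_factor_0 [simp]: "b_factor r t 0 = 1"
proof -
  have "b_factor r t 0 = (\<Sum>l\<in>{0}. real (0 choose l) * t ^ (2 * l))"
    unfolding b_factor_def by (rule sum.mono_neutral_right) auto
  then show ?thesis by simp
qed

lemma b_factor_mono: "m \<le> n \<Longrightarrow> b_factor r t m \<le> b_factor r t n"
  unfolding b_factor_def by (intro sum_mono mult_right_mono) (auto simp: binomial_right_mono)

lemma b_factor_pos: "0 < b_factor r t n"
  using b_factor_mono[of 0 n r t] by simp

text \<open>The term l = 1 is n t^2, which grows strictly with n; it is present because
  \<open>r\<close> is positive.\<close>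

lemma b_factor_strict_mono:
  assumes "m < n" "0 < r" "0 < t"
  shows "b_factor r t m < b_factor r t n"
  unfolding b_factor_def
proof (rule sum_strict_mono_ex1)
  show "\<forall>l\<in>{..r}. real (m choose l) * t ^ (2 * l) \<le> real (n choose l) * t ^ (2 * l)"
    using assms by (auto intro!: mult_right_mono simp: binomial_right_mono)
  show "\<exists>l\<in>{..r}. real (m choose l) * t ^ (2 * l) < real (n choose l) * t ^ (2 * l)"
    using assms by (intro bexI[of _ 1]) auto
qed simp

lemma b_val_pos: "\<nu> \<in> multi_indices \<Longrightarrow> 0 < b_val r \<tau> \<nu>"
  by (simp add: b_val_eq_prod prod_pos b_factor_pos)

lemma b_val_strict_mono:
  assumes \<nu>: "\<nu> \<in> multi_indices" and \<mu>: "\<mu> \<in> below \<nu>" "\<mu> \<noteq> \<nu>" and r: "0 < r" and \<tau>: "\<And>j. 0 < \<tau> j"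
  shows "b_val r \<tau> \<mu> < b_val r \<tau> \<nu>"
proof -
  have f: "finite (supp \<nu>)" using \<nu> by (rule finite_supp)
  have \<mu>m: "\<mu> \<in> multi_indices" using below_multi_indices[OF \<nu>] \<mu> by blast
  have le: "\<mu> j \<le> \<nu> j" for j using \<mu> by (simp add: below_def)
  obtain k where "\<mu> k \<noteq> \<nu> k" using \<mu>(2) by blast
  then have k: "\<mu> k < \<nu> k" using le[of k] by simp
  then have ks: "k \<in> supp \<nu>" by (simp add: supp_def)
  have "b_val r \<tau> \<mu> = (\<Prod>j\<in>supp \<nu>. b_factor r (\<tau> j) (\<mu> j))"
    unfolding b_val_eq_prod[OF \<mu>m]
    by (rule prod_supp_superset[OF f below_supp[OF \<mu>(1)], where h="\<lambda>j. b_factor r (\<tau> j)"]) simp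
  also have "\<dots> = b_factor r (\<tau> k) (\<mu> k) * (\<Prod>j\<in>supp \<nu> - {k}. b_factor r (\<tau> j) (\<mu> j))"
    by (rule prod.remove[OF f ks])
  also have "\<dots> < b_factor r (\<tau> k) (\<nu> k) * (\<Prod>j\<in>supp \<nu> - {k}. b_factor r (\<tau> j) (\<mu> j))"
    using b_factor_strict_mono[OF k r \<tau>] by (intro mult_strict_right_mono prod_pos b_factor_pos)
  also have "\<dots> \<le> b_factor r (\<tau> k) (\<nu> k) * (\<Prod>j\<in>supp \<nu> - {k}. b_factor r (\<tau> j) (\<nu> j))"
    by (intro mult_left_mono prod_mono conjI b_factor_mono le less_imp_le[OF b_factor_pos])
  also have "\<dots> = b_val r \<tau> \<nu>"
    unfolding b_val_eq_prod[OF \<nu>] by (rule prod.remove[OF f ks, symmetric])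
  finally show ?thesis .
qed

section \<open>Summability of a negative power of the weights\<close>

text \<open>A finite family fits into a box, over which the sum factorises into terms of the form 1
  + (sum over n \<ge> 1), each at most the exponential of \<open>s j\<close>. The bound is therefore
  independent of the family.\<close>

lemma sum_multi_indices_prod_bound:
  fixes a :: "nat \<Rightarrow> nat \<Rightarrow> real" and s :: "nat \<Rightarrow> real"
  assumes a: "\<And>j n. 0 \<le> a j n" and s: "\<And>j M. (\<Sum>n=1..M. a j n) \<le> s j" "summable s"
    and F: "finite F" "F \<subseteq> multi_indices"
  shows "(\<Sum>\<nu>\<in>F. \<Prod>j\<in>supp \<nu>. a j (\<nu> j)) \<le> exp (suminf s)"
proof -
  \<comment> \<open>An inactive coordinate is an absent factor, so the entry at 0 becomes 1 whatever
    \<open>a j 0\<close> is.\<close>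
  define a' where "a' j n = (if n = 0 then 1 else a j n)" for j n
  have s0: "0 \<le> s j" for j using s(1)[of j 0] by simp
  have fin: "finite (\<Union>\<nu>\<in>F. supp \<nu>)" using F by (auto intro: finite_supp)
  then obtain K where K: "(\<Union>\<nu>\<in>F. supp \<nu>) \<subseteq> {..<K}" using finite_nat_iff_bounded by blast
  define M where "M = Max (insert 0 (\<Union>\<nu>\<in>F. \<nu> ` supp \<nu>))"
  have M: "\<nu> j \<le> M" if "\<nu> \<in> F" for \<nu> j
  proof (cases "j \<in> supp \<nu>")
    case True
    have "finite (\<Union>\<nu>\<in>F. \<nu> ` supp \<nu>)" using F by (auto intro: finite_supp)
    then show ?thesis unfolding M_def using that True by (intro Max_ge) auto
  qed (simp add: supp_def)
  let ?m = "\<lambda>j. if j < K then M else 0"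
  have sm: "supp ?m \<subseteq> {..<K}" by (auto simp: supp_def)
  then have mm: "?m \<in> multi_indices" by (auto simp: multi_indices_def intro: finite_subset)
  have sub: "F \<subseteq> below ?m"
  proof
    fix \<nu> assume \<nu>: "\<nu> \<in> F"
    have "\<nu> j \<le> ?m j" for j
      using M[OF \<nu>, of j] K \<nu> by (cases "j < K") (auto simp: supp_def subset_iff)
    then show "\<nu> \<in> below ?m" by (simp add: below_def)
  qed
  have "(\<Sum>\<nu>\<in>F. \<Prod>j\<in>supp \<nu>. a j (\<nu> j)) = (\<Sum>\<nu>\<in>F. \<Prod>j<K. a' j (\<nu> j))"
  proof (rule sum.cong[OF refl])
    fix \<nu> assume "\<nu> \<in> F"
    then have "supp \<nu> \<subseteq> {..<K}" using K by blast
    have "(\<Prod>j\<in>supp \<nu>. a j (\<nu> j)) = (\<Prod>j\<in>supp \<nu>. a' j (\<nu> j))"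
      by (intro prod.cong) (auto simp: a'_def supp_def)
    also have "\<dots> = (\<Prod>j<K. a' j (\<nu> j))"
      using \<open>supp \<nu> \<subseteq> {..<K}\<close> by (intro prod_supp_superset) (auto simp: a'_def)
    finally show "(\<Prod>j\<in>supp \<nu>. a j (\<nu> j)) = (\<Prod>j<K. a' j (\<nu> j))" .
  qed
  also have "\<dots> \<le> (\<Sum>\<nu>\<in>below ?m. \<Prod>j<K. a' j (\<nu> j))"
    using sub a by (intro sum_mono2 finite_below mm prod_nonneg) (auto simp: a'_def)
  also have "\<dots> = (\<Prod>j<K. \<Sum>n\<le>?m j. a' j n)"
    by (rule sum_below_prod[OF _ sm]) simp
  also have "\<dots> \<le> (\<Prod>j<K. exp (s j))"
  proof (intro prod_mono conjI)
    fix j assume "j \<in> {..<K}"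
    show "0 \<le> (\<Sum>n\<le>?m j. a' j n)" using a by (intro sum_nonneg) (auto simp: a'_def)
    have "{..M} = insert 0 {1..M}" by auto
    then have "(\<Sum>n\<le>?m j. a' j n) = 1 + (\<Sum>n=1..M. a j n)"
      using \<open>j \<in> {..<K}\<close> by (auto simp: a'_def intro!: sum.cong)
    also have "\<dots> \<le> 1 + s j" using s(1) by simp
    also have "\<dots> \<le> exp (s j)" by (rule exp_ge_add_one_self)
    finally show "(\<Sum>n\<le>?m j. a' j n) \<le> exp (s j)" .
  qed
  also have "\<dots> = exp (\<Sum>j<K. s j)" by (simp add: exp_sum)
  also have "\<dots> \<le> exp (suminf s)" using s(2) s0 by (simp add: sum_le_suminf)
  finally show ?thesis .
qed

text \<open>Keep the single term l = min n r. For n \<ge> r its binomial is at least (n/r)^r; for n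
  < r it equals 1, which is larger. The minimum of the two powers of t covers both t \<ge> 1 and t <
  1.\<close>

lemma b_factor_lower:
  assumes "0 < r" "0 < n" "0 < t"
  shows "min (t ^ 2) (t ^ (2 * r)) * (real n / real r) ^ r \<le> b_factor r t n"
proof -
  define l where "l = min n r"
  have l: "1 \<le> l" "l \<le> r" "l \<le> n" using assms by (auto simp: l_def)
  have "min (t ^ 2) (t ^ (2 * r)) \<le> t ^ (2 * l)"
  proof (cases "t \<ge> 1")
    case True
    then have "t ^ 2 \<le> t ^ (2 * l)" using l by (intro power_increasing) auto
    then show ?thesis by simp
  next
    case False
    then have "t ^ (2 * r) \<le> t ^ (2 * l)" using l assms by (intro power_decreasing) auto
    then show ?thesis by simp
  qed
  moreover have "(real n / real r) ^ r \<le> real (n choose l)"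
  proof (cases "n \<ge> r")
    case True
    then show ?thesis using binomial_ge_n_over_k_pow_k[of r n, where 'a=real] by (simp add: l_def)
  next
    case False
    then have "(real n / real r) ^ r \<le> 1" using assms by (intro power_le_one) auto
    then show ?thesis using False by (simp add: l_def)
  qed
  ultimately have "min (t ^ 2) (t ^ (2 * r)) * (real n / real r) ^ r \<le> t ^ (2 * l) * real (n choose l)"
    using assms by (intro mult_mono) auto
  also have "\<dots> \<le> b_factor r t n"
    unfolding b_factor_def mult.commute[of "t ^ (2 * l)"]
    using l assms by (intro member_le_sum) auto
  finally show ?thesis .
qed

definition quad_growth :: "(nat \<Rightarrow> nat) \<Rightarrow> real" where
  "quad_growth \<nu> = (\<Prod>j\<in>supp \<nu>. 1 + 4 * real (\<nu> j))"

abbreviation b_powr_term :: "nat \<Rightarrow> (nat \<Rightarrow> real) \<Rightarrow> real \<Rightarrow> (nat \<Rightarrow> nat) \<Rightarrow> real" where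
  "b_powr_term r \<tau> q \<nu> \<equiv> b_val r \<tau> \<nu> powr (- q / 2) * (quad_growth \<nu>)\<^sup>2"

lemma quad_growth_ge_1: "1 \<le> quad_growth \<nu>"
  unfolding quad_growth_def by (intro prod_ge_1) simp

text \<open>The terms factorise over the coordinates. \<open>b_factor_lower\<close> gives the decay
  n^(-rq/2) \<le> n^(-4), by r q > 14; against the squared growth (1 + 4n)^2 \<le> 25 n^2 this
  leaves 1/n^2, summable in n, while the part depending on \<tau> is summable in j.\<close>

lemma b_val_powr_sum_bounded:
  assumes q: "0 < q" and \<tau>: "\<And>j. 0 < \<tau> j" "summable (\<lambda>j. (1 / \<tau> j) powr q)"
    and r: "14 / q < real r"
  shows "\<exists>M. \<forall>F. finite F \<longrightarrow> F \<subseteq> multi_indices \<longrightarrow>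
    (\<Sum>\<nu>\<in>F. b_powr_term r \<tau> q \<nu>) \<le> M"
proof -
  have rq: "14 < real r * q" using r q by (simp add: field_simps)
  have r0: "0 < r" using rq by (cases r) auto
  define a where "a j n = b_factor r (\<tau> j) n powr (- q / 2) * (1 + 4 * real n)\<^sup>2" for j n
  define z where "z j = (1 / \<tau> j) powr q" for j
  have z0: "0 \<le> z j" for j by (simp add: z_def)
  have zsum: "summable z" using \<tau>(2) by (simp add: z_def[abs_def])
  \<comment> \<open>What the denominator of (n/r)^r contributes after raising to the power
    -q/2.\<close>
  define R where "R = real r powr (real r * q / 2)"
  have R0: "0 \<le> R" by (simp add: R_def)
  \<comment> \<open>The two candidates for the minimum become t^(-q) and its r-th power; their sum
    bounds either one.\<close>
  have \<kappa>: "min (t ^ 2) (t ^ (2 * r)) powr (- q / 2) \<le> (1 / t) powr q + ((1 / t) powr q) ^ r" if "0 < t" for t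
  proof -
    have p: "(t ^ k) powr (- q / 2) = t powr (real k * (- q / 2))" for k
      using powr_realpow[OF that, of k] powr_powr[of t "real k" "- q / 2"] by simp
    have i: "(1 / t) powr q = t powr (- q)"
      using that by (simp add: powr_divide powr_minus_divide)
    have 1: "(t ^ 2) powr (- q / 2) = (1 / t) powr q"
      unfolding p i by simp
    have "(t powr (- q)) ^ r = t powr (- q * real r)"
      using that powr_realpow[of "t powr (- q)" r] by (simp add: powr_powr)
    then have 2: "(t ^ (2 * r)) powr (- q / 2) = ((1 / t) powr q) ^ r"
      unfolding p i by (simp add: mult.commute)
    show ?thesis unfolding min_def using 1 2 by auto
  qed
  have a_bound: "a j n \<le> (z j + z j ^ r) * (25 * R) * (1 / (real n)\<^sup>2)" if n: "1 \<le> n" for j n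
  proof -
    define \<kappa> where "\<kappa> = min (\<tau> j ^ 2) (\<tau> j ^ (2 * r))"
    have \<kappa>0: "0 < \<kappa>" using \<tau>(1)[of j] by (simp add: \<kappa>_def)
    have nr: "0 < real n / real r" using n r0 by simp
    have "b_factor r (\<tau> j) n powr (- q / 2) \<le> (\<kappa> * (real n / real r) ^ r) powr (- q / 2)"
      using b_factor_lower[OF r0, of n "\<tau> j"] n \<tau>(1) q \<kappa>0 nr
      by (intro powr_mono2') (auto simp: \<kappa>_def)
    also have "\<dots> = \<kappa> powr (- q / 2) * ((real n / real r) ^ r) powr (- q / 2)"
      using \<kappa>0 nr by (simp add: powr_mult)
    also have "((real n / real r) ^ r) powr (- q / 2) = (real n / real r) powr (- (real r * q / 2))"
      using powr_realpow[OF nr, of r] powr_powr[of "real n / real r" "real r" "- q / 2"] by simp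
    also have "\<dots> = R * real n powr (- (real r * q / 2))"
      using n r0 by (simp add: R_def powr_divide powr_minus_divide)
    also have "\<kappa> powr (- q / 2) * (R * real n powr (- (real r * q / 2))) \<le> (z j + z j ^ r) * (R * (1 / real n ^ 4))"
    proof (intro mult_mono)
      show "\<kappa> powr (- q / 2) \<le> z j + z j ^ r" unfolding \<kappa>_def z_def by (rule \<kappa>[OF \<tau>(1)])
      have "real n powr (- (real r * q / 2)) \<le> real n powr (-4)"
        using n rq by (intro powr_mono) auto
      then show "real n powr (- (real r * q / 2)) \<le> 1 / real n ^ 4"
        using n by (simp add: powr_minus_divide)
    qed (use z0 R0 in \<open>auto intro!: mult_nonneg_nonneg\<close>)
    finally have "a j n \<le> (z j + z j ^ r) * (R * (1 / real n ^ 4)) * (1 + 4 * real n)\<^sup>2"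
      unfolding a_def by (intro mult_right_mono) auto
    also have "\<dots> \<le> (z j + z j ^ r) * (R * (1 / real n ^ 4)) * (25 * (real n)\<^sup>2)"
    proof (intro mult_left_mono)
      have "(1 + 4 * real n)\<^sup>2 \<le> (5 * real n)\<^sup>2" using n by (intro power_mono) auto
      then show "(1 + 4 * real n)\<^sup>2 \<le> 25 * (real n)\<^sup>2" by (simp add: power_mult_distrib)
    qed (use z0 R0 in \<open>auto intro!: mult_nonneg_nonneg\<close>)
    also have "\<dots> = (z j + z j ^ r) * (25 * R) * (1 / (real n)\<^sup>2)"
      using n by (simp add: field_simps power_numeral_reduce)
    finally show ?thesis .
  qed
  have E: "summable (\<lambda>n. 1 / (real n)\<^sup>2)" using inverse_power_summable[of 2, where 'a=real] by (simp add: inverse_eq_divide)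
  define s where "s j = (z j + z j ^ r) * (25 * R) * (\<Sum>n. 1 / (real n)\<^sup>2)" for j
  have s1: "(\<Sum>n=1..M. a j n) \<le> s j" for j M
  proof -
    have "(\<Sum>n=1..M. a j n) \<le> (\<Sum>n=1..M. (z j + z j ^ r) * (25 * R) * (1 / (real n)\<^sup>2))"
      by (intro sum_mono a_bound) simp
    also have "\<dots> = (z j + z j ^ r) * (25 * R) * (\<Sum>n=1..M. 1 / (real n)\<^sup>2)"
      by (simp add: sum_distrib_left)
    also have "\<dots> \<le> s j"
      unfolding s_def using z0 R0 by (intro mult_left_mono sum_le_suminf E) auto
    finally show ?thesis .
  qed
  have "summable (\<lambda>j. z j ^ r)"
  proof (rule summable_comparison_test_ev[OF _ zsum])
    have "eventually (\<lambda>j. z j < 1) sequentially"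
      using summable_LIMSEQ_zero[OF zsum] by (rule order_tendstoD) simp
    then show "eventually (\<lambda>j. norm (z j ^ r) \<le> z j) sequentially"
    proof eventually_elim
      case (elim j)
      then have "z j ^ r \<le> z j ^ 1" using z0 r0 by (intro power_decreasing) auto
      then show ?case using z0 by simp
    qed
  qed
  then have s2: "summable s"
    unfolding s_def by (intro summable_mult2 summable_add zsum)
  have a0: "0 \<le> a j n" for j n by (simp add: a_def)
  have eq: "b_powr_term r \<tau> q \<nu> = (\<Prod>j\<in>supp \<nu>. a j (\<nu> j))" if "\<nu> \<in> multi_indices" for \<nu>
  proof -
    have "b_val r \<tau> \<nu> powr (- q / 2) = (\<Prod>j\<in>supp \<nu>. b_factor r (\<tau> j) (\<nu> j) powr (- q / 2))"
      unfolding b_val_eq_prod[OF that]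
      by (rule prod_powr_distrib)
    then show ?thesis
      by (simp add: quad_growth_def a_def prod.distrib prod_power_distrib)
  qed
  have "(\<Sum>\<nu>\<in>F. b_powr_term r \<tau> q \<nu>) \<le> exp (suminf s)"
    if F: "finite F" "F \<subseteq> multi_indices" for F
  proof -
    have "(\<Sum>\<nu>\<in>F. b_powr_term r \<tau> q \<nu>) = (\<Sum>\<nu>\<in>F. \<Prod>j\<in>supp \<nu>. a j (\<nu> j))"
      using F by (intro sum.cong refl eq) auto
    then show ?thesis using sum_multi_indices_prod_bound[OF a0 s1 s2 F] by simp
  qed
  then show ?thesis by blast
qed

section \<open>Choosing the smallest weights, and the tail outside them\<close>

text \<open>One minimal remaining index is added at a time; it exists because a sublevel set of
  \<open>b\<close> is finite. Ties may be broken arbitrarily.\<close>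

lemma smallest_values_exist:
  fixes b :: "(nat \<Rightarrow> nat) \<Rightarrow> real"
  assumes fin: "\<And>t. finite {\<nu>\<in>multi_indices. b \<nu> \<le> t}"
  shows "\<exists>\<Lambda>\<subseteq>multi_indices. finite \<Lambda> \<and> card \<Lambda> = N \<and> (\<forall>\<nu>\<in>\<Lambda>. \<forall>\<nu>'\<in>multi_indices - \<Lambda>. b \<nu> \<le> b \<nu>')"
proof (induction N)
  case 0
  show ?case by (intro exI[of _ "{}"]) auto
next
  case (Suc N)
  then obtain \<Lambda> where \<Lambda>: "\<Lambda> \<subseteq> multi_indices" "finite \<Lambda>" "card \<Lambda> = N"
    "\<And>\<nu> \<nu>'. \<nu> \<in> \<Lambda> \<Longrightarrow> \<nu>' \<in> multi_indices - \<Lambda> \<Longrightarrow> b \<nu> \<le> b \<nu>'" by blast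
  have "infinite multi_indices"
  proof
    assume "finite multi_indices"
    moreover have "range (\<lambda>n j. if j = 0 then n else 0) \<subseteq> multi_indices"
      by (auto simp: multi_indices_def supp_def intro: finite_subset[of _ "{0}"])
    moreover have "inj (\<lambda>n j::nat. if j = 0 then n else (0::nat))"
      by (auto simp: inj_def fun_eq_iff)
    ultimately show False using finite_subset range_inj_infinite by blast
  qed
  then have "multi_indices - \<Lambda> \<noteq> {}" using \<Lambda>(2) by (metis Diff_eq_empty_iff finite_subset)
  then obtain \<nu>0 where \<nu>0: "\<nu>0 \<in> multi_indices - \<Lambda>" by blast
  let ?S = "{\<nu> \<in> multi_indices - \<Lambda>. b \<nu> \<le> b \<nu>0}"
  have "finite ?S" by (rule finite_subset[OF _ fin[of "b \<nu>0"]]) auto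
  moreover have "?S \<noteq> {}" using \<nu>0 by auto
  ultimately obtain \<nu>1 where \<nu>1: "\<nu>1 \<in> ?S" "\<And>\<nu>. \<nu> \<in> ?S \<Longrightarrow> b \<nu>1 \<le> b \<nu>"
    using ex_min_if_finite[of "b ` ?S"] by (auto simp: image_iff) (metis linorder_not_le)
  have min: "b \<nu>1 \<le> b \<nu>" if "\<nu> \<in> multi_indices - \<Lambda>" for \<nu>
    using \<nu>1 that by (cases "b \<nu> \<le> b \<nu>0") auto
  show ?case
    using \<Lambda> \<nu>1(1) min by (intro exI[of _ "insert \<nu>1 \<Lambda>"]) auto
qed

text \<open>As the growth factor is at least 1, each member of the sublevel set contributes at least
  t^(-q/2) to sums bounded by \<open>M\<close>.\<close>

lemma finite_b_val_sublevel:
  assumes M: "\<And>F. finite F \<Longrightarrow> F \<subseteq> multi_indices \<Longrightarrow>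
      (\<Sum>\<nu>\<in>F. b_powr_term r \<tau> q \<nu>) \<le> M" and q: "0 < q"
  shows "finite {\<nu>\<in>multi_indices. b_val r \<tau> \<nu> \<le> t}" (is "finite ?S")
proof (rule ccontr)
  assume inf: "infinite ?S"
  then obtain \<nu>0 where "\<nu>0 \<in> ?S" using infinite_imp_nonempty by blast
  then have t: "0 < t" using b_val_pos[of \<nu>0 r \<tau>] by auto
  define c where "c = t powr (- q / 2)"
  have c: "0 < c" using t by (simp add: c_def)
  define n where "n = Suc (nat \<lceil>M / c\<rceil>)"
  obtain F where F: "F \<subseteq> ?S" "finite F" "card F = n"
    using infinite_arbitrarily_large[OF inf] by blast
  have "real n * c = (\<Sum>\<nu>\<in>F. c * 1)" using F by simp
  also have "\<dots> \<le> (\<Sum>\<nu>\<in>F. b_powr_term r \<tau> q \<nu>)"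
  proof (intro sum_mono mult_mono)
    fix \<nu> assume "\<nu> \<in> F"
    then show "c \<le> b_val r \<tau> \<nu> powr (- q / 2)"
      unfolding c_def using F q b_val_pos[of \<nu> r \<tau>] by (intro powr_mono2') auto
    show "1 \<le> (quad_growth \<nu>)\<^sup>2" using quad_growth_ge_1 by (rule one_le_power)
  qed auto
  also have "\<dots> \<le> M" using F by (intro M) auto
  finally have "real n \<le> M / c" using c by (simp add: field_simps)
  moreover have "M / c < real n" unfolding n_def by linarith
  ultimately show False by simp
qed

text \<open>Stechkin's argument. For \<nu> outside \<Lambda>, all N + 1 elements of
  \<open>insert \<nu> \<Lambda>\<close> have weight at most that of \<nu>, so (N + 1) b^(-q/2) \<le>
  M at \<nu>. Counting \<nu> itself produces N + 1 instead of N and makes the case of the empty set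
  meaningful; q < 2 makes the exponent 2/q - 1 positive.\<close>

lemma smallest_b_val_tail:
  assumes M: "\<And>F. finite F \<Longrightarrow> F \<subseteq> multi_indices \<Longrightarrow>
      (\<Sum>\<nu>\<in>F. b_powr_term r \<tau> q \<nu>) \<le> M" and q: "0 < q" "q < 2"
    and \<Lambda>: "\<Lambda> \<subseteq> multi_indices" "finite \<Lambda>" "card \<Lambda> = N"
      "\<And>\<nu> \<nu>'. \<nu> \<in> \<Lambda> \<Longrightarrow> \<nu>' \<in> multi_indices - \<Lambda> \<Longrightarrow> b_val r \<tau> \<nu> \<le> b_val r \<tau> \<nu>'"
    and F: "finite F" "F \<subseteq> multi_indices - \<Lambda>"
  shows "(\<Sum>\<nu>\<in>F. (quad_growth \<nu>)\<^sup>2 / b_val r \<tau> \<nu>) \<le> M * (M / (real N + 1)) powr (2 / q - 1)"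
proof -
  have M0: "0 \<le> M" using M[of "{}"] by simp
  have bound: "b_val r \<tau> \<nu> powr (- q / 2) \<le> M / (real N + 1)" if \<nu>: "\<nu> \<in> multi_indices - \<Lambda>" for \<nu>
  proof -
    have "(real N + 1) * b_val r \<tau> \<nu> powr (- q / 2) = (\<Sum>\<mu>\<in>insert \<nu> \<Lambda>. b_val r \<tau> \<nu> powr (- q / 2) * 1)"
      using \<Lambda> \<nu> by (simp add: algebra_simps)
    also have "\<dots> \<le> (\<Sum>\<mu>\<in>insert \<nu> \<Lambda>. b_powr_term r \<tau> q \<mu>)"
    proof (intro sum_mono mult_mono)
      fix \<mu> assume "\<mu> \<in> insert \<nu> \<Lambda>"
      then have "b_val r \<tau> \<mu> \<le> b_val r \<tau> \<nu>" "\<mu> \<in> multi_indices" using \<Lambda> \<nu> by auto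
      then show "b_val r \<tau> \<nu> powr (- q / 2) \<le> b_val r \<tau> \<mu> powr (- q / 2)"
        using q b_val_pos[of \<mu> r \<tau>] by (intro powr_mono2') auto
      show "1 \<le> (quad_growth \<mu>)\<^sup>2" using quad_growth_ge_1 by (rule one_le_power)
    qed auto
    also have "\<dots> \<le> M" using \<Lambda> \<nu> by (intro M) auto
    finally show ?thesis by (simp add: field_simps)
  qed
  have "(\<Sum>\<nu>\<in>F. (quad_growth \<nu>)\<^sup>2 / b_val r \<tau> \<nu>) \<le>
      (\<Sum>\<nu>\<in>F. b_powr_term r \<tau> q \<nu> * (M / (real N + 1)) powr (2 / q - 1))"
  proof (intro sum_mono)
    fix \<nu> assume "\<nu> \<in> F"
    then have \<nu>: "\<nu> \<in> multi_indices - \<Lambda>" using F by blast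
    define b where "b = b_val r \<tau> \<nu>"
    have b: "0 < b" using \<nu> b_val_pos by (simp add: b_def)
    have "(- q / 2) * (2 / q - 1) + (- q / 2) = -1" using q by (simp add: field_simps)
    then have "1 / b = b powr (- q / 2) * (b powr (- q / 2)) powr (2 / q - 1)"
      unfolding powr_powr powr_add[symmetric] using b by (simp add: add.commute powr_minus_divide)
    also have "\<dots> \<le> b powr (- q / 2) * (M / (real N + 1)) powr (2 / q - 1)"
      using bound[OF \<nu>] q by (intro mult_left_mono powr_mono2) (auto simp: b_def)
    finally have "(quad_growth \<nu>)\<^sup>2 * (1 / b) \<le> (quad_growth \<nu>)\<^sup>2 * (b powr (- q / 2) * (M / (real N + 1)) powr (2 / q - 1))"
      by (intro mult_left_mono) auto
    then show "(quad_growth \<nu>)\<^sup>2 / b_val r \<tau> \<nu> \<le> b_powr_term r \<tau> q \<nu> * (M / (real N + 1)) powr (2 / q - 1)"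
      by (simp add: b_def mult_ac)
  qed
  also have "\<dots> \<le> M * (M / (real N + 1)) powr (2 / q - 1)"
    unfolding sum_distrib_right[symmetric] using F by (intro mult_right_mono M) auto
  finally show ?thesis .
qed

lemma smallest_b_val_admissible:
  assumes \<Lambda>: "\<Lambda> \<subseteq> multi_indices" "\<And>\<nu> \<nu>'. \<nu> \<in> \<Lambda> \<Longrightarrow> \<nu>' \<in> multi_indices - \<Lambda> \<Longrightarrow> b_val r \<tau> \<nu> \<le> b_val r \<tau> \<nu>'"
    and r: "0 < r" and \<tau>: "\<And>j. 0 < \<tau> j"
  shows "admissible \<Lambda>"
  unfolding admissible_def
proof (intro conjI ballI impI)
  fix \<nu> \<mu> assume a: "\<nu> \<in> \<Lambda>" "\<mu> \<in> multi_indices" "\<forall>j. \<mu> j \<le> \<nu> j"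
  show "\<mu> \<in> \<Lambda>"
  proof (rule ccontr)
    assume "\<mu> \<notin> \<Lambda>"
    then have "b_val r \<tau> \<nu> \<le> b_val r \<tau> \<mu>" "\<mu> \<noteq> \<nu>" using a \<Lambda>(2) by auto
    moreover have "b_val r \<tau> \<mu> < b_val r \<tau> \<nu>"
      using a \<Lambda>(1) \<open>\<mu> \<noteq> \<nu>\<close> r \<tau> by (intro b_val_strict_mono) (auto simp: below_def)
    ultimately show False by simp
  qed
qed (rule \<Lambda>(1))

section \<open>Precise values and the Hermite series\<close>

text \<open>Dominated convergence for unordered sums, along an arbitrary filter because it serves
  limits in \<delta> as well as in \<open>K\<close>. The M-test makes partial sums converge
  uniformly on the parameters where the bound holds, and a uniform limit commutes with the limit
  along \<open>G\<close>.\<close>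

lemma tannery_infsum:
  fixes a :: "'i \<Rightarrow> 'k \<Rightarrow> real"
  assumes G: "G \<noteq> bot" and M: "M summable_on A"
    and bound: "eventually (\<lambda>n. \<forall>\<nu>\<in>A. \<bar>a \<nu> n\<bar> \<le> M \<nu>) G"
    and lim: "\<And>\<nu>. \<nu> \<in> A \<Longrightarrow> (a \<nu> \<longlongrightarrow> b \<nu>) G"
  shows "b summable_on A" "((\<lambda>n. \<Sum>\<^sub>\<infinity>\<nu>\<in>A. a \<nu> n) \<longlongrightarrow> (\<Sum>\<^sub>\<infinity>\<nu>\<in>A. b \<nu>)) G"
proof -
  have bM: "norm (b \<nu>) \<le> M \<nu>" if "\<nu> \<in> A" for \<nu>
  proof (rule tendsto_upperbound[OF lim[OF that, THEN tendsto_norm] _ G])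
    show "eventually (\<lambda>n. norm (a \<nu> n) \<le> M \<nu>) G"
      using bound by eventually_elim (use that in auto)
  qed
  have "(\<lambda>\<nu>. norm (b \<nu>)) summable_on A"
    by (rule summable_on_comparison_test[OF M bM]) auto
  then show b: "b summable_on A" by (rule abs_summable_summable)
  show "((\<lambda>n. \<Sum>\<^sub>\<infinity>\<nu>\<in>A. a \<nu> n) \<longlongrightarrow> (\<Sum>\<^sub>\<infinity>\<nu>\<in>A. b \<nu>)) G"
  proof (rule swap_uniform_limit')
    show "uniform_limit {n. \<forall>\<nu>\<in>A. \<bar>a \<nu> n\<bar> \<le> M \<nu>} (\<lambda>X n. \<Sum>\<nu>\<in>X. a \<nu> n)
        (\<lambda>n. \<Sum>\<^sub>\<infinity>\<nu>\<in>A. a \<nu> n) (finite_subsets_at_top A)"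
      by (rule Weierstrass_m_test_general[OF _ M]) auto
    show "eventually (\<lambda>X. ((\<lambda>n. \<Sum>\<nu>\<in>X. a \<nu> n) \<longlongrightarrow> (\<Sum>\<nu>\<in>X. b \<nu>)) G) (finite_subsets_at_top A)"
      by (rule eventually_finite_subsets_at_top_weakI) (auto intro!: tendsto_sum lim)
    show "((\<lambda>X. \<Sum>\<nu>\<in>X. b \<nu>) \<longlongrightarrow> (\<Sum>\<^sub>\<infinity>\<nu>\<in>A. b \<nu>)) (finite_subsets_at_top A)"
      using has_sum_infsum[OF b] by (simp add: has_sum_def)
    show "eventually (\<lambda>n. n \<in> {n. \<forall>\<nu>\<in>A. \<bar>a \<nu> n\<bar> \<le> M \<nu>}) G" using bound by simp
  qed simp
qed

lemma L2_abs:
  fixes h :: "'y \<Rightarrow> real"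
  assumes "h \<in> L2 M"
  shows "(\<lambda>y. \<bar>h y\<bar>) \<in> L2 M"
  using assms borel_measurable_abs[of h M] by (simp add: L2_real_iff)

lemma hermite_closure_L2: "hermite_closure v \<Longrightarrow> v \<in> L2 gauss1"
proof (induction rule: hermite_closure.induct)
  case (limit g G h)
  have [measurable]: "g k \<in> borel_measurable gauss1" for k using limit.IH by (rule L2_measurable)
  show ?case
  proof (rule L2_bound[OF limit.hyps(2)])
    show "h \<in> borel_measurable gauss1"
      by (rule borel_measurable_LIMSEQ_real[where u=g]) (use limit in auto)
    show "\<bar>h t\<bar> \<le> G t" for t
      by (rule tendsto_upperbound[OF tendsto_rabs[OF limit.hyps(4)]]) (use limit in auto)
  qed
qed (auto intro: L2_hermite L2_scale L2_add)

section \<open>Parseval's identity against a function with absolutely summable coefficients\<close>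

context
  fixes g :: "(nat \<Rightarrow> real) \<Rightarrow> real"
  assumes g: "g \<in> L2 gauss" and abs_sum: "(\<lambda>\<nu>. \<bar>hcoeff g \<nu>\<bar>) summable_on multi_indices"
begin

text \<open>One partner \<open>g\<close> is fixed, and its absolutely summable coefficients are what
  lets the identity survive dominated limits in \<open>v\<close>. Membership in L^2 is included so
  that it is preserved along with the identity.\<close>

definition parseval_at :: "((nat \<Rightarrow> real) \<Rightarrow> real) \<Rightarrow> bool" where
  "parseval_at v \<longleftrightarrow> v \<in> L2 gauss \<and>
    ((\<lambda>\<nu>. hcoeff g \<nu> * hcoeff v \<nu>) has_sum (\<integral>y. v y * g y \<partial>gauss)) multi_indices"

lemma parseval_at_hermite_multi:
  assumes "\<mu> \<in> multi_indices"
  shows "parseval_at (hermite_multi \<mu>)"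
proof -
  have "((\<lambda>\<nu>. hcoeff g \<nu> * hcoeff (hermite_multi \<mu>) \<nu>) has_sum hcoeff g \<mu>) multi_indices"
  proof (subst has_sum_cong_neutral[where T="{\<mu>}" and g="\<lambda>\<nu>. hcoeff g \<nu>"])
    show "hcoeff g \<nu> * hcoeff (hermite_multi \<mu>) \<nu> = 0" if "\<nu> \<in> multi_indices - {\<mu>}" for \<nu>
      using that assms by (simp add: hcoeff_def[of "hermite_multi \<mu>"] hermite_multi_orthonormal)
    show "hcoeff g \<nu> * hcoeff (hermite_multi \<mu>) \<nu> = hcoeff g \<nu>" if "\<nu> \<in> multi_indices \<inter> {\<mu>}" for \<nu>
      using that assms by (simp add: hcoeff_def[of "hermite_multi \<mu>"] hermite_multi_orthonormal)
    show "(hcoeff g has_sum hcoeff g \<mu>) {\<mu>}"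
      by (rule has_sum_finiteI) simp_all
  qed (use assms in auto)
  then show ?thesis
    using L2_hermite_multi[OF assms] by (simp add: parseval_at_def hcoeff_def)
qed

lemma parseval_at_scale:
  assumes "parseval_at v"
  shows "parseval_at (\<lambda>y. c * v y)"
proof -
  have "hcoeff (\<lambda>y. c * v y) \<nu> = c * hcoeff v \<nu>" for \<nu>
    by (simp add: hcoeff_def mult.left_commute)
  moreover have "((\<lambda>\<nu>. c * (hcoeff g \<nu> * hcoeff v \<nu>)) has_sum c * (\<integral>y. v y * g y \<partial>gauss)) multi_indices"
    using assms by (intro has_sum_cmult_right) (simp add: parseval_at_def)
  ultimately show ?thesis
    using assms by (simp add: parseval_at_def L2_scale mult.assoc mult.left_commute)
qed

lemma parseval_at_add:
  assumes u: "parseval_at u" and v: "parseval_at v"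
  shows "parseval_at (\<lambda>y. u y + v y)"
proof -
  have L: "u \<in> L2 gauss" "v \<in> L2 gauss" using u v by (simp_all add: parseval_at_def)
  have "hcoeff (\<lambda>y. u y + v y) \<nu> = hcoeff u \<nu> + hcoeff v \<nu>" if "\<nu> \<in> multi_indices" for \<nu>
    using L2_mult_integrable[OF L2_hermite_multi[OF that] L(1)] L2_mult_integrable[OF L2_hermite_multi[OF that] L(2)]
    by (simp add: hcoeff_def distrib_left)
  then have "((\<lambda>\<nu>. hcoeff g \<nu> * hcoeff (\<lambda>y. u y + v y) \<nu>) has_sum s) multi_indices \<longleftrightarrow>
      ((\<lambda>\<nu>. hcoeff g \<nu> * hcoeff u \<nu> + hcoeff g \<nu> * hcoeff v \<nu>) has_sum s) multi_indices" for s
    by (intro has_sum_cong) (simp add: distrib_left)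
  moreover have "(\<integral>y. (u y + v y) * g y \<partial>gauss) = (\<integral>y. u y * g y \<partial>gauss) + (\<integral>y. v y * g y \<partial>gauss)"
    using L2_mult_integrable[OF L(1) g] L2_mult_integrable[OF L(2) g] by (simp add: distrib_right)
  moreover have "((\<lambda>\<nu>. hcoeff g \<nu> * hcoeff u \<nu> + hcoeff g \<nu> * hcoeff v \<nu>) has_sum
      (\<integral>y. u y * g y \<partial>gauss) + (\<integral>y. v y * g y \<partial>gauss)) multi_indices"
    using u v by (intro has_sum_add) (simp_all only: parseval_at_def)
  ultimately show ?thesis
    unfolding parseval_at_def using L2_add[OF L] by simp
qed

text \<open>Domination by \<open>G\<close> moves the limit through the integrals, including those
  defining the coefficients. Bessel's inequality for a single index bounds all coefficients by one
  constant, so the coefficients of \<open>g\<close> furnish the majorant for the sum.\<close>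

lemma parseval_at_limit:
  assumes v: "\<And>k::nat. parseval_at (v k)" and G: "G \<in> L2 gauss" and bound: "\<And>k y. \<bar>v k y\<bar> \<le> G y"
    and lim: "\<And>y. (\<lambda>k. v k y) \<longlonglongrightarrow> u y"
  shows "parseval_at u"
proof -
  have vL: "v k \<in> L2 gauss" for k using v by (simp add: parseval_at_def)
  note [measurable] = vL[THEN L2_measurable] g[THEN L2_measurable]
  have um[measurable]: "u \<in> borel_measurable gauss"
    by (rule borel_measurable_LIMSEQ_real[where u=v]) (use lim in auto)
  have uG: "\<bar>u y\<bar> \<le> G y" for y
    by (rule tendsto_upperbound[OF tendsto_rabs[OF lim]]) (use bound in auto)
  have uL: "u \<in> L2 gauss" by (rule L2_bound[OF G um uG])
  have dom: "(\<lambda>k. \<integral>y. h y * v k y \<partial>gauss) \<longlonglongrightarrow> (\<integral>y. h y * u y \<partial>gauss)" if h: "h \<in> L2 gauss" for h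
  proof (rule integral_dominated_convergence[where w="\<lambda>y. \<bar>h y\<bar> * G y"])
    note [measurable] = h[THEN L2_measurable]
    show "(\<lambda>y. h y * u y) \<in> borel_measurable gauss" "(\<lambda>y. h y * v k y) \<in> borel_measurable gauss" for k
      by measurable
    show "integrable gauss (\<lambda>y. \<bar>h y\<bar> * G y)" by (rule L2_mult_integrable[OF L2_abs[OF h] G])
    show "AE y in gauss. (\<lambda>k. h y * v k y) \<longlonglongrightarrow> h y * u y" by (intro AE_I2 tendsto_intros lim)
    show "AE y in gauss. norm (h y * v k y) \<le> \<bar>h y\<bar> * G y" for k
      by (intro AE_I2) (simp add: abs_mult mult_left_mono bound)
  qed
  define B where "B = (\<integral>y. (G y)\<^sup>2 \<partial>gauss)"
  have coeff_bound: "\<bar>hcoeff h \<nu>\<bar> \<le> sqrt B" if h: "h \<in> L2 gauss" "\<And>y. \<bar>h y\<bar> \<le> G y" and \<nu>: "\<nu> \<in> multi_indices" for h \<nu>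
  proof -
    have "(hcoeff h \<nu>)\<^sup>2 \<le> (\<integral>y. (h y)\<^sup>2 \<partial>gauss)"
      using bessel_inequality[OF h(1), of "{\<nu>}"] \<nu> by simp
    also have "\<dots> \<le> B"
      unfolding B_def
    proof (rule integral_mono)
      show "(h y)\<^sup>2 \<le> (G y)\<^sup>2" for y using h(2)[of y] abs_le_square_iff[of "h y" "G y"] by linarith
    qed (use h G in \<open>simp_all add: L2_real_iff\<close>)
    finally show ?thesis by (rule real_le_rsqrt[of "\<bar>_\<bar>", unfolded power2_abs])
  qed
  have M: "(\<lambda>\<nu>. \<bar>hcoeff g \<nu>\<bar> * sqrt B) summable_on multi_indices"
    by (rule summable_on_cmult_left[OF abs_sum])
  have bnd: "eventually (\<lambda>k. \<forall>\<nu>\<in>multi_indices. \<bar>hcoeff g \<nu> * hcoeff (v k) \<nu>\<bar> \<le> \<bar>hcoeff g \<nu>\<bar> * sqrt B) sequentially"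
    by (intro always_eventually allI ballI) (simp add: abs_mult mult_left_mono coeff_bound[OF vL bound])
  have lm: "(\<lambda>k. hcoeff g \<nu> * hcoeff (v k) \<nu>) \<longlonglongrightarrow> hcoeff g \<nu> * hcoeff u \<nu>"
    if "\<nu> \<in> multi_indices" for \<nu>
    unfolding hcoeff_def[of "v _"] hcoeff_def[of u] by (intro tendsto_intros dom L2_hermite_multi that)
  note T = tannery_infsum[where a="\<lambda>\<nu> k. hcoeff g \<nu> * hcoeff (v k) \<nu>", OF _ M bnd lm]
  have "(\<Sum>\<^sub>\<infinity>\<nu>\<in>multi_indices. hcoeff g \<nu> * hcoeff (v k) \<nu>) = (\<integral>y. g y * v k y \<partial>gauss)" for k
    using v[of k] by (intro infsumI) (simp add: parseval_at_def mult.commute[of "g _"])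
  then have "(\<Sum>\<^sub>\<infinity>\<nu>\<in>multi_indices. hcoeff g \<nu> * hcoeff u \<nu>) = (\<integral>y. g y * u y \<partial>gauss)"
    using T(2) dom[OF g] by (simp add: LIMSEQ_unique)
  moreover have "(\<lambda>\<nu>. hcoeff g \<nu> * hcoeff u \<nu>) summable_on multi_indices"
    using T(1) by simp
  ultimately show ?thesis
    using uL has_sum_infsum by (fastforce simp: parseval_at_def mult.commute[of "g _"])
qed

lemma parseval_at_coordinate:
  assumes v: "hermite_closure v" and j: "j \<notin> J" and J: "finite J" and W: "\<And>i. i \<in> J \<Longrightarrow> u i \<in> L2 gauss1"
    and base: "\<And>n. parseval_at (\<lambda>y. hermite n (y j) * (\<Prod>i\<in>J. u i (y i)))"
  shows "parseval_at (\<lambda>y. v (y j) * (\<Prod>i\<in>J. u i (y i)))"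
  using v
proof (induction rule: hermite_closure.induct)
  case (hermite n)
  show ?case by (rule base)
next
  case (scale v c)
  then show ?case using parseval_at_scale by (simp add: mult.assoc)
next
  case (add v w)
  then show ?case using parseval_at_add by (simp add: distrib_right)
next
  case (limit v G h)
  show ?case
  proof (rule parseval_at_limit[where v="\<lambda>k y. v k (y j) * (\<Prod>i\<in>J. u i (y i))"])
    show "parseval_at (\<lambda>y. v k (y j) * (\<Prod>i\<in>J. u i (y i)))" for k by (rule limit.IH)
    have "(\<lambda>y. \<Prod>i\<in>insert j J. (if i = j then G else (\<lambda>t. \<bar>u i t\<bar>)) (y i)) \<in> L2 gauss"
      using limit.hyps(2) L2_abs[OF W] J by (intro L2_gauss_prod) auto
    moreover have "(\<Prod>i\<in>insert j J. (if i = j then G else (\<lambda>t. \<bar>u i t\<bar>)) (y i)) = G (y j) * \<bar>\<Prod>i\<in>J. u i (y i)\<bar>" for y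
      using J j by (auto simp: abs_prod intro!: arg_cong2[where f="(*)"] prod.cong)
    ultimately show "(\<lambda>y. G (y j) * \<bar>\<Prod>i\<in>J. u i (y i)\<bar>) \<in> L2 gauss" by simp
    show "\<bar>v k (y j) * (\<Prod>i\<in>J. u i (y i))\<bar> \<le> G (y j) * \<bar>\<Prod>i\<in>J. u i (y i)\<bar>" for k y
      by (simp add: abs_mult mult_right_mono limit.hyps(3))
    show "(\<lambda>k. v k (y j) * (\<Prod>i\<in>J. u i (y i))) \<longlonglongrightarrow> h (y j) * (\<Prod>i\<in>J. u i (y i))" for y
      by (intro tendsto_intros limit.hyps(4))
  qed
qed

text \<open>\<open>J\<close> counts the coordinates that may already carry arbitrary closure
  elements; the others carry Hermite polynomials. The step puts a Hermite polynomial back into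
  coordinate \<open>J\<close>, applies the induction hypothesis, and then generalises that
  coordinate alone.\<close>

lemma parseval_at_prod:
  assumes "J \<le> K" "\<And>j. j < J \<Longrightarrow> hermite_closure (u j)" "\<And>j. J \<le> j \<Longrightarrow> j < K \<Longrightarrow> \<exists>n. u j = hermite n"
  shows "parseval_at (\<lambda>y. \<Prod>j<K. u j (y j))"
  using assms
proof (induction J arbitrary: u)
  case 0
  then have "\<forall>j. \<exists>n. j < K \<longrightarrow> u j = hermite n" by auto
  then obtain n where n: "\<And>j. j < K \<Longrightarrow> u j = hermite (n j)" by metis
  define \<mu> where "\<mu> j = (if j < K then n j else 0)" for j
  have s: "supp \<mu> \<subseteq> {..<K}" by (auto simp: supp_def \<mu>_def)
  then have m: "\<mu> \<in> multi_indices" by (auto simp: multi_indices_def intro: finite_subset)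
  have "(\<lambda>y. \<Prod>j<K. u j (y j)) = hermite_multi \<mu>"
    using n by (auto simp: fun_eq_iff hermite_multi_superset[OF _ s] \<mu>_def intro!: prod.cong)
  then show ?case using parseval_at_hermite_multi[OF m] by simp
next
  case (Suc J)
  have J: "J \<in> {..<K}" using Suc.prems(1) by simp
  have split: "(\<Prod>j<K. w j (y j)) = w J (y J) * (\<Prod>j\<in>{..<K} - {J}. w j (y j))" for w :: "nat \<Rightarrow> real \<Rightarrow> real" and y
    by (rule prod.remove[OF _ J]) simp
  have "parseval_at (\<lambda>y. u J (y J) * (\<Prod>j\<in>{..<K} - {J}. u j (y j)))"
  proof (rule parseval_at_coordinate)
    show "hermite_closure (u J)" using Suc.prems(2) by simp
    show "u i \<in> L2 gauss1" if "i \<in> {..<K} - {J}" for i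
    proof (cases "i < Suc J")
      case True
      then show ?thesis using Suc.prems(2) hermite_closure_L2 by blast
    next
      case False
      then show ?thesis using Suc.prems(3)[of i] that L2_hermite by auto
    qed
    fix n
    have "parseval_at (\<lambda>y. \<Prod>j<K. (u(J := hermite n)) j (y j))"
    proof (rule Suc.IH)
      show "\<exists>n'. (u(J := hermite n)) j = hermite n'" if "J \<le> j" "j < K" for j
        using that Suc.prems(3)[of j] by (cases "j = J") auto
    qed (use Suc.prems in auto)
    moreover have "(\<Prod>j<K. (u(J := hermite n)) j (y j)) = hermite n (y J) * (\<Prod>j\<in>{..<K} - {J}. u j (y j))" for y
      unfolding split by (auto intro!: prod.cong)
    ultimately show "parseval_at (\<lambda>y. hermite n (y J) * (\<Prod>j\<in>{..<K} - {J}. u j (y j)))" by simp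
  qed auto
  then show ?case unfolding split .
qed

end

section \<open>Averages over small intervals and cylinders\<close>

definition interval_prob :: "real \<Rightarrow> real \<Rightarrow> real" where
  "interval_prob c \<delta> = (\<integral>t. indicator {t. \<bar>t - c\<bar> < \<delta>} t \<partial>gauss1)"

definition interval_mean :: "real \<Rightarrow> real \<Rightarrow> nat \<Rightarrow> real" where
  "interval_mean c \<delta> n = (\<integral>t. hermite n t * indicator {t. \<bar>t - c\<bar> < \<delta>} t \<partial>gauss1) / interval_prob c \<delta>"

lemma L2_interval: "\<delta> > 0 \<Longrightarrow> indicat_real {t. \<bar>t - c\<bar> < \<delta>} \<in> L2 gauss1"
  by (rule hermite_closure_L2[OF hermite_closure_interval])

lemma interval_prob_pos:
  assumes "\<delta> > 0"
  shows "0 < interval_prob c \<delta>"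
proof -
  let ?I = "{t. \<bar>t - c\<bar> < \<delta>}"
  have I: "?I = {c - \<delta><..<c + \<delta>}" by auto
  have [measurable]: "?I \<in> sets borel" unfolding I by simp
  \<comment> \<open>Every point of the interval has modulus at most that of \<open>c\<close> plus
    \<delta>, and the density decreases with the modulus, so \<open>m\<close> is a lower bound for
    it there.\<close>
  define m where "m = std_normal_density (\<bar>c\<bar> + \<delta>)"
  have m: "0 < m" unfolding m_def by (rule normal_density_pos) simp
  have "0 < m * (2 * \<delta>)" using m assms by simp
  also have "\<dots> = (\<integral>t. m * indicator ?I t \<partial>lborel)"
    using assms by (simp add: I)
  also have "\<dots> \<le> (\<integral>t. std_normal_density t * indicator ?I t \<partial>lborel)"
  proof (rule integral_mono)
    show "integrable lborel (\<lambda>t. m * indicat_real ?I t)"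
      using assms by (intro integrable_mult_right integrable_real_indicator) (auto simp: I)
    show "integrable lborel (\<lambda>t. std_normal_density t * indicat_real ?I t)"
      using L2_integrable[OF L2_interval[OF assms, of c]] by (subst (asm) integrable_gauss1_iff) auto
    fix t :: real
    show "m * indicator ?I t \<le> std_normal_density t * indicator ?I t"
    proof (cases "t \<in> ?I")
      case True
      then have "\<bar>t\<bar> \<le> \<bar>c\<bar> + \<delta>" by auto
      then have "\<bar>t\<bar> \<le> \<bar>\<bar>c\<bar> + \<delta>\<bar>" using assms by simp
      then have "t\<^sup>2 \<le> (\<bar>c\<bar> + \<delta>)\<^sup>2" by (simp only: abs_le_square_iff)
      then show ?thesis using True by (simp add: m_def std_normal_density_def divide_right_mono)
    qed simp
  qed
  also have "\<dots> = interval_prob c \<delta>"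
    unfolding interval_prob_def by (rule integral_gauss1[symmetric]) measurable
  finally show ?thesis .
qed

text \<open>Serves twice: with a = 0 it yields a bound uniform in \<open>n\<close>, and with the
  value at the centre it yields convergence.\<close>

lemma interval_mean_approx:
  assumes \<delta>: "\<delta> > 0" and h: "\<And>t. \<bar>t - c\<bar> < \<delta> \<Longrightarrow> \<bar>hermite n t - a\<bar> \<le> e"
  shows "\<bar>interval_mean c \<delta> n - a\<bar> \<le> e"
proof -
  let ?I = "indicat_real {t. \<bar>t - c\<bar> < \<delta>}"
  note p = interval_prob_pos[OF \<delta>, of c]
  note I = L2_interval[OF \<delta>, of c]
  have int: "integrable gauss1 (\<lambda>t. hermite n t * ?I t)" "integrable gauss1 (\<lambda>t. a * ?I t)" "integrable gauss1 (\<lambda>t. e * ?I t)"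
    by (intro L2_mult_integrable L2_hermite I L2_const integrable_mult_right L2_integrable)+
  have "\<bar>(\<integral>t. hermite n t * ?I t - a * ?I t \<partial>gauss1)\<bar> \<le> (\<integral>t. e * ?I t \<partial>gauss1)"
  proof (rule integral_abs_bound_integral[THEN order_trans, OF _ _ _ order_refl])
    show "\<bar>hermite n t * ?I t - a * ?I t\<bar> \<le> e * ?I t" for t
      using h[of t] by (cases "\<bar>t - c\<bar> < \<delta>") auto
  qed (use int in auto)
  moreover have "(\<integral>t. hermite n t * ?I t - a * ?I t \<partial>gauss1) = (interval_mean c \<delta> n - a) * interval_prob c \<delta>"
    using int p by (simp add: interval_mean_def left_diff_distrib) (simp add: interval_prob_def)
  ultimately have "\<bar>interval_mean c \<delta> n - a\<bar> * interval_prob c \<delta> \<le> e * interval_prob c \<delta>"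
    using p by (simp add: abs_mult) (simp add: interval_prob_def)
  then show ?thesis using p by simp
qed

lemma interval_mean_bound:
  assumes "0 < \<delta>" "\<delta> < 1"
  shows "\<bar>interval_mean c \<delta> n\<bar> \<le> 2 * exp ((\<bar>c\<bar> + 1)\<^sup>2)"
proof -
  have "\<bar>hermite n t - 0\<bar> \<le> 2 * exp ((\<bar>c\<bar> + 1)\<^sup>2)" if "\<bar>t - c\<bar> < \<delta>" for t
  proof -
    have "\<bar>t\<bar> \<le> \<bar>\<bar>c\<bar> + 1\<bar>" using that assms by auto
    then have "t\<^sup>2 \<le> (\<bar>c\<bar> + 1)\<^sup>2" by (simp only: abs_le_square_iff)
    then show ?thesis using hermite_abs_bound[of n t] by (simp add: order_trans)
  qed
  from interval_mean_approx[OF assms(1) this] show ?thesis by simp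
qed

lemma interval_mean_tendsto: "((\<lambda>\<delta>. interval_mean c \<delta> n) \<longlongrightarrow> hermite n c) (at_right 0)"
proof (rule tendstoI)
  fix e :: real assume e: "0 < e"
  have "isCont (hermite n) c"
    unfolding hermite_eq_poly[abs_def] by (intro continuous_intros) simp
  then obtain d where d: "0 < d" "\<And>t. dist t c < d \<Longrightarrow> dist (hermite n t) (hermite n c) < e / 2"
    using e unfolding continuous_at_eps_delta by (metis half_gt_zero dist_norm)
  have "eventually (\<lambda>\<delta>. \<delta> \<in> {0<..<d}) (at_right 0)"
    using d(1) by (intro eventually_at_right_real)
  then show "eventually (\<lambda>\<delta>. dist (interval_mean c \<delta> n) (hermite n c) < e) (at_right 0)"
  proof eventually_elim
    case (elim \<delta>)
    have "\<bar>interval_mean c \<delta> n - hermite n c\<bar> \<le> e / 2"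
      using elim d(2) by (intro interval_mean_approx) (auto simp: dist_real_def intro: less_imp_le)
    then show ?case using e by (simp add: dist_real_def)
  qed
qed

lemma indicator_cyl: "indicat_real (cyl y K \<delta>) z = (\<Prod>j<K. indicat_real {t. \<bar>t - y j\<bar> < \<delta>} (z j))"
proof (cases "z \<in> cyl y K \<delta>")
  case True
  then show ?thesis by (simp add: cyl_def)
next
  case False
  then obtain j where "j < K" "\<not> \<bar>z j - y j\<bar> < \<delta>" by (auto simp: cyl_def)
  then show ?thesis using False by (simp add: prod_zero_iff) (auto intro!: bexI[of _ j])
qed

lemma sets_cyl:
  assumes \<delta>: "\<delta> > 0"
  shows "cyl y K \<delta> \<in> sets gauss"
proof -
  have "indicat_real (cyl y K \<delta>) = (\<lambda>z. \<Prod>j<K. indicat_real {t. \<bar>t - y j\<bar> < \<delta>} (z j))"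
    by (simp add: fun_eq_iff indicator_cyl)
  moreover have "(\<lambda>z. \<Prod>j<K. indicat_real {t. \<bar>t - y j\<bar> < \<delta>} (z j)) \<in> borel_measurable gauss"
    by (intro borel_measurable_integrable integrable_gauss_prod L2_integrable L2_interval \<delta>) simp
  ultimately have "indicat_real (cyl y K \<delta>) \<in> borel_measurable gauss" by (simp only:)
  then show ?thesis
    by (simp only: borel_measurable_indicator_iff space_gauss Int_UNIV_right)
qed

lemma measure_cyl:
  assumes \<delta>: "\<delta> > 0"
  shows "measure gauss (cyl y K \<delta>) = (\<Prod>j<K. interval_prob (y j) \<delta>)"
proof -
  have "measure gauss (cyl y K \<delta>) = (\<integral>z. indicat_real (cyl y K \<delta>) z \<partial>gauss)"
    using sets_cyl[OF \<delta>] by simp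
  also have "\<dots> = (\<Prod>j<K. interval_prob (y j) \<delta>)"
    unfolding indicator_cyl interval_prob_def
    by (rule integral_gauss_prod) (auto intro: L2_integrable L2_interval \<delta>)
  finally show ?thesis .
qed

text \<open>Averaging over a cylinder kills every \<open>\<nu>\<close> not supported in its coordinates; then \<open>\<delta> \<rightarrow> 0\<close> and
  \<open>K \<rightarrow> \<infinity>\<close> under the absolutely convergent sum.\<close>

lemma precise_value_expansion:
  fixes g :: "(nat \<Rightarrow> real) \<Rightarrow> real"
  assumes g: "g \<in> L2 gauss" and abs_sum: "(\<lambda>\<nu>. \<bar>hcoeff g \<nu>\<bar>) summable_on multi_indices"
    and y: "finite {j. y j \<noteq> 0}"
    and precise: "\<And>\<epsilon>. \<epsilon> > 0 \<Longrightarrow> \<forall>\<^sub>F K in sequentially. \<forall>\<^sub>F \<delta> in at_right 0.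
      \<bar>(1 / measure gauss (cyl y K \<delta>)) * (\<integral>z. indicator (cyl y K \<delta>) z * g z \<partial>gauss) - g y\<bar> < \<epsilon>"
  shows "((\<lambda>\<nu>. hcoeff g \<nu> * hermite_multi \<nu> y) has_sum g y) multi_indices"
proof -
  let ?c = "hcoeff g"
  \<comment> \<open>\<open>A K \<delta> \<nu>\<close> is the mean of the Hermite polynomial of \<nu>
    over the cylinder, \<open>B K \<nu>\<close> its limit as \<delta> tends to 0 with
    \<open>K\<close> fixed.\<close>
  define A where "A K \<delta> \<nu> = (if supp \<nu> \<subseteq> {..<K} then \<Prod>j<K. interval_mean (y j) \<delta> (\<nu> j) else 0)" for K \<delta> and \<nu> :: "nat \<Rightarrow> nat"
  define B where "B K \<nu> = (if supp \<nu> \<subseteq> {..<K} then hermite_multi \<nu> y else 0)" for K :: nat and \<nu>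
  let ?SA = "\<lambda>K \<delta>. \<Sum>\<^sub>\<infinity>\<nu>\<in>multi_indices. ?c \<nu> * A K \<delta> \<nu>"
    and ?SB = "\<lambda>K. \<Sum>\<^sub>\<infinity>\<nu>\<in>multi_indices. ?c \<nu> * B K \<nu>"
  have avg: "(1 / measure gauss (cyl y K \<delta>)) * (\<integral>z. indicator (cyl y K \<delta>) z * g z \<partial>gauss) = ?SA K \<delta>"
    if \<delta>: "\<delta> > 0" for K \<delta>
  proof -
    let ?u = "\<lambda>j. indicat_real {t. \<bar>t - y j\<bar> < \<delta>}"
    let ?P = "\<lambda>z. \<Prod>j<K. ?u j (z j)"
    define m where "m = measure gauss (cyl y K \<delta>)"
    have m: "m = (\<Prod>j<K. interval_prob (y j) \<delta>)" "0 < m"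
      unfolding m_def measure_cyl[OF \<delta>] by (auto intro!: prod_pos interval_prob_pos \<delta>)
    have "parseval_at g ?P"
      by (rule parseval_at_prod[OF g abs_sum, of K]) (auto intro: hermite_closure_interval \<delta>)
    then have "((\<lambda>\<nu>. ?c \<nu> * hcoeff ?P \<nu>) has_sum (\<integral>z. indicator (cyl y K \<delta>) z * g z \<partial>gauss)) multi_indices"
      by (simp add: parseval_at_def[OF g abs_sum] indicator_cyl)
    moreover have "hcoeff ?P \<nu> = m * A K \<delta> \<nu>" if "\<nu> \<in> multi_indices" for \<nu>
    proof -
      have "hcoeff ?P \<nu> =
          (if supp \<nu> \<subseteq> {..<K} then \<Prod>j<K. \<integral>t. hermite (\<nu> j) t * ?u j t \<partial>gauss1 else 0)"
        unfolding hcoeff_def by (rule integral_prod_hermite_multi[OF _ _ that]) (auto intro: L2_interval \<delta>)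
      moreover have "(\<integral>t. hermite n t * ?u j t \<partial>gauss1) = interval_prob (y j) \<delta> * interval_mean (y j) \<delta> n" for n j
        using interval_prob_pos[OF \<delta>, of "y j"] by (simp add: interval_mean_def)
      ultimately show ?thesis by (simp add: A_def m prod.distrib)
    qed
    ultimately have "((\<lambda>\<nu>. ?c \<nu> * (m * A K \<delta> \<nu>)) has_sum (\<integral>z. indicator (cyl y K \<delta>) z * g z \<partial>gauss)) multi_indices"
      by (subst has_sum_cong) auto
    then have "((\<lambda>\<nu>. (1 / m) * (?c \<nu> * (m * A K \<delta> \<nu>))) has_sum (1 / m) * (\<integral>z. indicator (cyl y K \<delta>) z * g z \<partial>gauss)) multi_indices"
      by (rule has_sum_cmult_right)
    moreover have "(1 / m) * (?c \<nu> * (m * A K \<delta> \<nu>)) = ?c \<nu> * A K \<delta> \<nu>" for \<nu> using m(2) by simp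
    ultimately show ?thesis unfolding m_def[symmetric] by (simp add: infsumI)
  qed
  have limA: "((\<lambda>\<delta>. ?SA K \<delta>) \<longlongrightarrow> ?SB K) (at_right 0)" for K
  proof (rule tannery_infsum(2))
    define D where "D = (\<Prod>j<K. 2 * exp ((\<bar>y j\<bar> + 1)\<^sup>2))"
    show "(\<lambda>\<nu>. \<bar>?c \<nu>\<bar> * D) summable_on multi_indices" by (rule summable_on_cmult_left[OF abs_sum])
    have D: "0 \<le> D" by (auto simp: D_def intro!: prod_nonneg)
    have "eventually (\<lambda>\<delta>::real. \<delta> \<in> {0<..<1}) (at_right 0)" by (intro eventually_at_right_real) simp
    then show "\<forall>\<^sub>F \<delta> in at_right 0. \<forall>\<nu>\<in>multi_indices. \<bar>?c \<nu> * A K \<delta> \<nu>\<bar> \<le> \<bar>?c \<nu>\<bar> * D"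
    proof eventually_elim
      case (elim \<delta>)
      have "\<bar>A K \<delta> \<nu>\<bar> \<le> D" for \<nu>
        unfolding A_def D_def using D elim
        by (auto simp: abs_prod D_def intro!: prod_mono interval_mean_bound)
      then show ?case by (auto simp: abs_mult intro!: mult_left_mono)
    qed
    fix \<nu> :: "nat \<Rightarrow> nat"
    show "((\<lambda>\<delta>. ?c \<nu> * A K \<delta> \<nu>) \<longlongrightarrow> ?c \<nu> * B K \<nu>) (at_right 0)"
    proof (cases "supp \<nu> \<subseteq> {..<K}")
      case True
      then have "B K \<nu> = (\<Prod>j<K. hermite (\<nu> j) (y j))"
        by (simp add: B_def hermite_multi_superset[of "{..<K}"])
      with True show ?thesis by (auto simp: A_def intro!: tendsto_intros interval_mean_tendsto)
    next
      case False
      then show ?thesis by (simp add: A_def B_def)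
    qed
  qed simp
  define Y where "Y = {j. y j \<noteq> 0}"
  define D where "D = (\<Prod>j\<in>Y. 2 * exp ((y j)\<^sup>2))"
  \<comment> \<open>Coordinates where \<open>y\<close> vanishes contribute factors of modulus at
    most 1, so \<open>D\<close> involves only the finite set \<open>Y\<close> and is the same for
    all \<nu>.\<close>
  have Hbound: "\<bar>hermite_multi \<nu> y\<bar> \<le> D" if "\<nu> \<in> multi_indices" for \<nu>
  proof -
    have fin: "finite (supp \<nu> \<union> Y)" using y that by (simp add: Y_def finite_supp)
    have "\<bar>hermite_multi \<nu> y\<bar> = (\<Prod>j\<in>supp \<nu> \<union> Y. \<bar>hermite (\<nu> j) (y j)\<bar>)"
      by (simp add: hermite_multi_superset[OF fin] abs_prod)
    also have "\<dots> \<le> (\<Prod>j\<in>supp \<nu> \<union> Y. if j \<in> Y then 2 * exp ((y j)\<^sup>2) else 1)"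
      by (intro prod_mono) (auto simp: Y_def hermite_abs_bound hermite_0_abs_bound)
    also have "\<dots> = D"
      unfolding D_def using fin by (intro prod.mono_neutral_cong_right) auto
    finally show ?thesis .
  qed
  have M: "(\<lambda>\<nu>. \<bar>?c \<nu>\<bar> * D) summable_on multi_indices" by (rule summable_on_cmult_left[OF abs_sum])
  have D0: "0 \<le> D" by (auto simp: D_def intro!: prod_nonneg)
  have bnd: "\<forall>\<^sub>F K in sequentially. \<forall>\<nu>\<in>multi_indices. \<bar>?c \<nu> * B K \<nu>\<bar> \<le> \<bar>?c \<nu>\<bar> * D"
    using D0 by (intro always_eventually allI ballI) (auto simp: abs_mult B_def intro!: mult_left_mono Hbound)
  have lim: "(\<lambda>K. ?c \<nu> * B K \<nu>) \<longlonglongrightarrow> ?c \<nu> * hermite_multi \<nu> y" if \<nu>: "\<nu> \<in> multi_indices" for \<nu>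
  proof -
    obtain K0 where K0: "supp \<nu> \<subseteq> {..<K0}"
      using finite_supp[OF \<nu>] finite_nat_iff_bounded by blast
    have "eventually (\<lambda>K. ?c \<nu> * hermite_multi \<nu> y = ?c \<nu> * B K \<nu>) sequentially"
      using eventually_ge_at_top[of K0] by eventually_elim (use K0 in \<open>auto simp: B_def\<close>)
    then show ?thesis by (rule Lim_transform_eventually[OF tendsto_const])
  qed
  note T = tannery_infsum[where a="\<lambda>\<nu> K. ?c \<nu> * B K \<nu>", OF _ M bnd lim, simplified]
  \<comment> \<open>The limit in \<delta> turns the strict bound on the averages into a weak one,
    hence the start from e / 2.\<close>
  have "(\<lambda>K. ?SB K) \<longlonglongrightarrow> g y"
  proof (rule tendstoI)
    fix e :: real assume e: "0 < e"
    then have "0 < e / 2" by simp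
    from precise[OF this] show "\<forall>\<^sub>F K in sequentially. dist (?SB K) (g y) < e"
    proof eventually_elim
      case (elim K)
      note K = elim
      have "\<bar>?SB K - g y\<bar> \<le> e / 2"
      proof (rule tendsto_upperbound)
        show "((\<lambda>\<delta>. \<bar>?SA K \<delta> - g y\<bar>) \<longlongrightarrow> \<bar>?SB K - g y\<bar>) (at_right 0)"
          by (intro tendsto_intros limA)
        show "\<forall>\<^sub>F \<delta> in at_right 0. \<bar>?SA K \<delta> - g y\<bar> \<le> e / 2"
          using K eventually_at_right_less[of "0::real"]
        proof eventually_elim
          case (elim \<delta>)
          then show ?case using avg[of \<delta> K] by simp
        qed
      qed simp
      then show ?case using e by (simp add: dist_real_def)
    qed
  qed
  then have "(\<Sum>\<^sub>\<infinity>\<nu>\<in>multi_indices. ?c \<nu> * hermite_multi \<nu> y) = g y"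
    using T(2) LIMSEQ_unique by blast
  then show ?thesis using T(1) has_sum_infsum by metis
qed

section \<open>Sparse quadrature\<close>

text \<open>Integration by parts shifts the index: up to normalisation, the coefficient of
  \<open>g\<close> at \<nu> is that of \<open>f\<close> at \<nu> + \<mu>. The squared ratio of the
  normalisations is (\<nu> + \<mu>)! / \<nu>!, that is \<mu>! times the binomial, which is where the
  binomials in \<open>b_val\<close> come from.\<close>

lemma hcoeff_weak_partial:
  fixes f g :: "(nat \<Rightarrow> real) \<Rightarrow> real"
  assumes f: "f \<in> L2 gauss" and g: "g \<in> L2 gauss" and \<mu>: "\<mu> \<in> multi_indices" and \<nu>: "\<nu> \<in> multi_indices"
    and weak: "weak_partial \<mu> f g"
  shows "(hcoeff g \<nu>)\<^sup>2 = mfact \<mu> * mbinom (\<lambda>j. \<nu> j + \<mu> j) \<mu> * (hcoeff f (\<lambda>j. \<nu> j + \<mu> j))\<^sup>2"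
proof -
  let ?I = "supp \<mu> \<union> supp \<nu>" and ?\<kappa> = "\<lambda>j. \<nu> j + \<mu> j"
  have I: "finite ?I" using \<mu> \<nu> by (simp add: finite_supp)
  have s\<kappa>: "supp ?\<kappa> \<subseteq> ?I" by (auto simp: supp_def)
  define X where "X = (\<integral>y. (\<Prod>i\<in>?I. poly (He (\<nu> i)) (y i)) * g y \<partial>gauss)"
  have X: "X = (\<integral>y. (\<Prod>i\<in>?I. poly (He (\<nu> i + \<mu> i)) (y i)) * f y \<partial>gauss)"
    unfolding X_def using weak I
    by (intro weak_partial_hermite_poly f g)
       (simp_all add: weak_partial_def bochner_int_eq_integral)
  have coeff: "hcoeff h \<kappa> = (\<integral>y. (\<Prod>i\<in>?I. poly (He (\<kappa> i)) (y i)) * h y \<partial>gauss) / (\<Prod>i\<in>?I. sqrt (fact (\<kappa> i)))"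
    if "supp \<kappa> \<subseteq> ?I" for h \<kappa>
  proof -
    have "hermite_multi \<kappa> y * h y = (1 / (\<Prod>i\<in>?I. sqrt (fact (\<kappa> i)))) * ((\<Prod>i\<in>?I. poly (He (\<kappa> i)) (y i)) * h y)" for y
      by (simp add: hermite_multi_superset[OF I that] hermite_eq_poly prod_dividef)
    then show ?thesis unfolding hcoeff_def by (simp only: integral_mult_right_zero) simp
  qed
  have sq: "(\<Prod>i\<in>?I. sqrt (fact (\<kappa> i)))\<^sup>2 = (\<Prod>i\<in>?I. fact (\<kappa> i))" for \<kappa>
    unfolding prod_power_distrib by (intro prod.cong) auto
  have pos: "0 < (\<Prod>i\<in>?I. fact (\<kappa> i) :: real)" for \<kappa> by (intro prod_pos) simp
  have 1: "(hcoeff g \<nu>)\<^sup>2 * (\<Prod>i\<in>?I. fact (\<nu> i)) = X\<^sup>2"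
    using pos[of \<nu>] unfolding coeff[OF Un_upper2] power_divide sq X_def by simp
  have 2: "(hcoeff f ?\<kappa>)\<^sup>2 * (\<Prod>i\<in>?I. fact (?\<kappa> i)) = X\<^sup>2"
    using pos[of ?\<kappa>] unfolding coeff[OF s\<kappa>] power_divide sq X by simp
  have "mfact \<mu> = (\<Prod>i\<in>?I. fact (\<mu> i))"
    unfolding mfact_def using I by (intro prod_supp_superset) auto
  moreover have "mbinom ?\<kappa> \<mu> = (\<Prod>i\<in>?I. real (?\<kappa> i choose \<mu> i))"
    unfolding mbinom_def using I by (intro prod_supp_superset[where h="\<lambda>j n. real (?\<kappa> j choose n)"]) auto
  moreover have "fact k * real (n + k choose k) * fact n = fact (n + k)" for n k :: nat
  proof -
    have "fact k * fact (n + k - k) * (n + k choose k) = (fact (n + k) :: nat)"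
      by (rule binomial_fact_lemma) simp
    then have "real (fact k * fact n * (n + k choose k)) = real (fact (n + k))" by simp
    then show ?thesis by (simp only: of_nat_mult of_nat_fact mult_ac)
  qed
  ultimately have 3: "mfact \<mu> * mbinom ?\<kappa> \<mu> * (\<Prod>i\<in>?I. fact (\<nu> i)) = (\<Prod>i\<in>?I. fact (?\<kappa> i))"
    by (simp only: prod.distrib[symmetric])
  have "(hcoeff g \<nu>)\<^sup>2 * (\<Prod>i\<in>?I. fact (\<nu> i)) =
      (mfact \<mu> * mbinom ?\<kappa> \<mu> * (hcoeff f ?\<kappa>)\<^sup>2) * (\<Prod>i\<in>?I. fact (\<nu> i))"
    unfolding 1 2[symmetric] 3[symmetric] by (simp add: mult_ac)
  then show ?thesis using pos[of \<nu>] by simp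
qed

lemma mfact_pos: "0 < mfact \<mu>"
  by (auto simp: mfact_def intro!: prod_pos)

lemma weight_nonneg: "0 \<le> weight \<tau> \<mu>"
  by (auto simp: weight_def intro!: prod_nonneg)

lemma mbinom_eq_0:
  assumes "finite (supp \<mu>)" "\<mu> \<notin> below \<nu>"
  shows "mbinom \<nu> \<mu> = 0"
proof -
  obtain j where j: "\<nu> j < \<mu> j" using assms(2) by (auto simp: below_def not_le)
  then have "j \<in> supp \<mu>" by (simp add: supp_def)
  then show ?thesis unfolding mbinom_def using assms(1) j by (intro prod_zero) (auto intro!: bexI[of _ j])
qed

text \<open>For fixed \<mu>, Bessel's inequality for \<open>D \<mu>\<close> bounds the sum of
  binomial times squared coefficient by the squared norm over \<mu>!. Weighting by \<tau>^(2 \<mu>)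
  and summing over \<mu> first assembles \<open>b_val\<close>.\<close>

lemma b_val_energy:
  fixes f :: "(nat \<Rightarrow> real) \<Rightarrow> real"
  assumes f: "f \<in> L2 gauss"
    and D: "\<And>\<mu>. \<mu> \<in> multi_indices_le r \<Longrightarrow> weak_partial \<mu> f (D \<mu>) \<and> D \<mu> \<in> L2 gauss"
    and B: "\<And>S. finite S \<Longrightarrow> S \<subseteq> multi_indices_le r \<Longrightarrow>
      (\<Sum>\<mu>\<in>S. weight \<tau> \<mu> / mfact \<mu> * (\<integral>y. (D \<mu> y)\<^sup>2 \<partial>gauss)) \<le> B"
    and F: "finite F" "F \<subseteq> multi_indices"
  shows "(\<Sum>\<nu>\<in>F. b_val r \<tau> \<nu> * (hcoeff f \<nu>)\<^sup>2) \<le> B"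
proof -
  let ?c = "hcoeff f"
  \<comment> \<open>One finite set containing all nonzero terms of \<open>b_val\<close> for every
    \<nu> in \<open>F\<close>, so that the two sums can be swapped.\<close>
  define S where "S = (\<Union>\<nu>\<in>F. below (\<lambda>j. if j \<in> supp \<nu> then r else 0))"
  have S: "finite S" "S \<subseteq> multi_indices_le r"
    using F b_val_terms(1,2)[of _ r] unfolding S_def by (blast intro: finite_UN_I)+
  have b: "b_val r \<tau> \<nu> = (\<Sum>\<mu>\<in>S. mbinom \<nu> \<mu> * weight \<tau> \<mu>)" if "\<nu> \<in> F" for \<nu>
  proof -
    have \<nu>: "\<nu> \<in> multi_indices" using F that by blast
    show ?thesis
      unfolding b_val_terms(3)[OF \<nu>]
    proof (rule sum.mono_neutral_left[OF S(1)])
      show "below (\<lambda>j. if j \<in> supp \<nu> then r else 0) \<subseteq> S" using that by (auto simp: S_def)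
      show "\<forall>\<mu>\<in>S - below (\<lambda>j. if j \<in> supp \<nu> then r else 0). mbinom \<nu> \<mu> * weight \<tau> \<mu> = 0"
        using b_val_terms(4)[OF \<nu>] S(2) by auto
    qed
  qed
  have inner: "(\<Sum>\<nu>\<in>F. mbinom \<nu> \<mu> * (?c \<nu>)\<^sup>2) \<le> (\<integral>y. (D \<mu> y)\<^sup>2 \<partial>gauss) / mfact \<mu>" if "\<mu> \<in> S" for \<mu>
  proof -
    have \<mu>: "\<mu> \<in> multi_indices_le r" "\<mu> \<in> multi_indices" using S(2) that by (auto simp: multi_indices_le_def)
    define F' where "F' = {\<nu>\<in>F. \<mu> \<in> below \<nu>}"
    \<comment> \<open>The shift that undoes \<nu> + \<mu>; truncated subtraction is injective here
      because \<mu> \<le> \<nu> on \<open>F'\<close>, and indices outside \<open>F'\<close> have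
      binomial 0.\<close>
    let ?d = "\<lambda>\<nu> j. \<nu> j - \<mu> j"
    have inv: "(\<lambda>j. ?d \<nu> j + \<mu> j) = \<nu>" if "\<nu> \<in> F'" for \<nu>
      using that by (auto simp: F'_def below_def)
    have inj: "inj_on ?d F'" by (rule inj_on_inverseI[where g="\<lambda>\<nu> j. \<nu> j + \<mu> j"]) (rule inv)
    have dm: "?d ` F' \<subseteq> multi_indices"
    proof (rule image_subsetI)
      fix \<nu> assume "\<nu> \<in> F'"
      then have "\<nu> \<in> multi_indices" using F by (auto simp: F'_def)
      then show "?d \<nu> \<in> multi_indices"
        unfolding multi_indices_def supp_def by (auto elim!: rev_finite_subset)
    qed
    have "mfact \<mu> * (\<Sum>\<nu>\<in>F. mbinom \<nu> \<mu> * (?c \<nu>)\<^sup>2) = mfact \<mu> * (\<Sum>\<nu>\<in>F'. mbinom \<nu> \<mu> * (?c \<nu>)\<^sup>2)"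
      using F(1) mbinom_eq_0[OF finite_supp[OF \<mu>(2)]] unfolding F'_def
      by (intro arg_cong2[where f="(*)"] refl sum.mono_neutral_right) auto
    also have "\<dots> = (\<Sum>\<nu>\<in>F'. mfact \<mu> * mbinom (\<lambda>j. ?d \<nu> j + \<mu> j) \<mu> * (?c (\<lambda>j. ?d \<nu> j + \<mu> j))\<^sup>2)"
      by (simp add: sum_distrib_left inv mult.assoc)
    also have "\<dots> = (\<Sum>\<kappa>\<in>?d ` F'. mfact \<mu> * mbinom (\<lambda>j. \<kappa> j + \<mu> j) \<mu> * (?c (\<lambda>j. \<kappa> j + \<mu> j))\<^sup>2)"
      by (simp add: sum.reindex[OF inj])
    also have "\<dots> = (\<Sum>\<kappa>\<in>?d ` F'. (hcoeff (D \<mu>) \<kappa>)\<^sup>2)"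
      using D[OF \<mu>(1)] dm by (intro sum.cong refl hcoeff_weak_partial[symmetric] f \<mu>(2)) auto
    also have "\<dots> \<le> (\<integral>y. (D \<mu> y)\<^sup>2 \<partial>gauss)"
      using D[OF \<mu>(1)] F(1) dm by (intro bessel_inequality) (auto simp: F'_def)
    finally show ?thesis using mfact_pos[of \<mu>] by (simp add: field_simps)
  qed
  have "(\<Sum>\<nu>\<in>F. b_val r \<tau> \<nu> * (?c \<nu>)\<^sup>2) = (\<Sum>\<nu>\<in>F. \<Sum>\<mu>\<in>S. weight \<tau> \<mu> * (mbinom \<nu> \<mu> * (?c \<nu>)\<^sup>2))"
    by (intro sum.cong refl) (simp add: b sum_distrib_right sum_distrib_left mult_ac)
  also have "\<dots> = (\<Sum>\<mu>\<in>S. weight \<tau> \<mu> * (\<Sum>\<nu>\<in>F. mbinom \<nu> \<mu> * (?c \<nu>)\<^sup>2))"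
    by (subst sum.swap) (simp add: sum_distrib_left)
  also have "\<dots> \<le> (\<Sum>\<mu>\<in>S. weight \<tau> \<mu> * ((\<integral>y. (D \<mu> y)\<^sup>2 \<partial>gauss) / mfact \<mu>))"
    by (intro sum_mono mult_left_mono inner weight_nonneg)
  also have "\<dots> \<le> B" using B[OF S] by simp
  finally show ?thesis .
qed

section \<open>The quadrature of expansions and of tensor products\<close>

context
  fixes m :: "nat \<Rightarrow> nat" and x w :: "nat \<Rightarrow> nat \<Rightarrow> real"
begin

lemma linear_quad_diff:
  fixes \<phi> :: "'s::real_vector \<Rightarrow> 't::real_vector"
  assumes "linear \<phi>"
  shows "\<phi> (quad_diff m x w l g) = quad_diff m x w l (\<lambda>t. \<phi> (g t))"
  using assms by (simp add: quad_diff_def quad_def linear_diff linear_sum linear_scale linear_0)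

lemma linear_tensor_diff:
  fixes \<phi> :: "'s::real_vector \<Rightarrow> 't::real_vector"
  assumes "linear \<phi>"
  shows "\<phi> (tensor_diff m x w \<nu> g) = tensor_diff m x w \<nu> (\<lambda>y. \<phi> (g y))"
proof -
  have "\<phi> (fold (\<lambda>j. in_coord (quad_diff m x w (\<nu> j)) j) js g y) =
      fold (\<lambda>j. in_coord (quad_diff m x w (\<nu> j)) j) js (\<lambda>y. \<phi> (g y)) y" for js y
    by (induction js arbitrary: g) (simp_all add: in_coord_def linear_quad_diff[OF assms])
  then show ?thesis by (simp add: tensor_diff_def tensor_op_def)
qed

lemma linear_sparse_quad:
  fixes \<phi> :: "'s::real_vector \<Rightarrow> 't::real_vector"
  assumes "linear \<phi>"
  shows "\<phi> (sparse_quad m x w \<Lambda> g) = sparse_quad m x w \<Lambda> (\<lambda>y. \<phi> (g y))"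
  by (simp add: sparse_quad_def linear_sum[OF assms] linear_tensor_diff[OF assms])

lemma quad_diff_cmult: "quad_diff m x w l (\<lambda>t. c * g t) = c * quad_diff m x w l (g :: real \<Rightarrow> real)"
  using linear_quad_diff[of "(*) c" l g] by (simp add: linear_times)

lemma has_sum_finite_sum:
  fixes g :: "'k \<Rightarrow> 'i \<Rightarrow> real"
  assumes "finite K" "\<And>k. k \<in> K \<Longrightarrow> (g k has_sum s k) A"
  shows "((\<lambda>\<nu>. \<Sum>k\<in>K. g k \<nu>) has_sum (\<Sum>k\<in>K. s k)) A"
  using assms by (induction K rule: finite_induct) (auto intro: has_sum_add)

lemma has_sum_quad_diff:
  fixes c :: "'i \<Rightarrow> real"
  assumes "\<And>t. ((\<lambda>\<nu>. c \<nu> * G \<nu> t) has_sum g t) A"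
  shows "((\<lambda>\<nu>. c \<nu> * quad_diff m x w l (G \<nu>)) has_sum quad_diff m x w l g) A"
proof -
  have q: "((\<lambda>\<nu>. c \<nu> * quad m x w l (G \<nu>)) has_sum quad m x w l g) A" for l
  proof -
    have "((\<lambda>\<nu>. \<Sum>k<m l. w l k * (c \<nu> * G \<nu> (x l k))) has_sum (\<Sum>k<m l. w l k * g (x l k))) A"
      by (intro has_sum_finite_sum has_sum_cmult_right assms) simp
    then show ?thesis by (simp add: quad_def sum_distrib_left mult_ac)
  qed
  show ?thesis
  proof (cases l)
    case 0
    then show ?thesis using q[of 0] by (simp add: quad_diff_def)
  next
    case (Suc k)
    have "((\<lambda>\<nu>. c \<nu> * quad m x w l (G \<nu>) + - (c \<nu> * quad m x w k (G \<nu>))) has_sum quad m x w l g + - quad m x w k g) A"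
      by (intro has_sum_add q) (simp add: has_sum_uminus q)
    then show ?thesis by (simp add: quad_diff_def Suc right_diff_distrib)
  qed
qed

text \<open>The expansion is assumed only at finitely supported points. Changing one coordinate
  keeps the support finite, so the induction over the coordinates never leaves such points.\<close>

lemma has_sum_tensor_diff:
  fixes c :: "'i \<Rightarrow> real" and g :: "(nat \<Rightarrow> real) \<Rightarrow> real"
  assumes "\<And>y. finite {j. y j \<noteq> 0} \<Longrightarrow> ((\<lambda>\<nu>. c \<nu> * G \<nu> y) has_sum g y) A"
  shows "((\<lambda>\<nu>. c \<nu> * tensor_diff m x w \<mu> (G \<nu>)) has_sum tensor_diff m x w \<mu> g) A"
proof -
  let ?T = "\<lambda>j. in_coord (quad_diff m x w (\<mu> j)) j"
  have "((\<lambda>\<nu>. c \<nu> * fold ?T js (G \<nu>) y) has_sum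
      fold ?T js g y) A" if "finite {j. y j \<noteq> 0}" for js y
    using assms that
  proof (induction js arbitrary: g G y)
    case (Cons j js)
    have "((\<lambda>\<nu>. c \<nu> * fold ?T js (?T j (G \<nu>)) y) has_sum
      fold ?T js (?T j g) y) A"
    proof (rule Cons.IH[OF _ Cons.prems(2)])
      fix y :: "nat \<Rightarrow> real" assume y: "finite {j. y j \<noteq> 0}"
      have "finite {i. (y(j := t)) i \<noteq> 0}" for t
        by (rule finite_subset[of _ "insert j {j. y j \<noteq> 0}"]) (use y in auto)
      then show "((\<lambda>\<nu>. c \<nu> * ?T j (G \<nu>) y) has_sum ?T j g y) A"
        unfolding in_coord_def by (intro has_sum_quad_diff Cons.prems(1))
    qed
    then show ?case by simp
  qed simp
  from this[of "\<lambda>_. 0"] show ?thesis by (simp add: tensor_diff_def tensor_op_def)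
qed

text \<open>Once a coordinate has been processed its factor is a constant function, so the integrand
  remains a product throughout.\<close>

lemma tensor_diff_prod:
  fixes u :: "nat \<Rightarrow> real \<Rightarrow> real"
  assumes J: "finite J" "supp \<mu> \<subseteq> J"
  shows "tensor_diff m x w \<mu> (\<lambda>y. \<Prod>j\<in>J. u j (y j)) =
    (\<Prod>j\<in>J. if j \<in> supp \<mu> then quad_diff m x w (\<mu> j) (u j) else u j 0)"
proof -
  let ?T = "\<lambda>j. in_coord (quad_diff m x w (\<mu> j)) j"
  have "fold ?T js (\<lambda>y. \<Prod>j\<in>J. u j (y j)) y =
      (\<Prod>j\<in>J. if j \<in> set js then quad_diff m x w (\<mu> j) (u j) else u j (y j))"
    if "distinct js" "set js \<subseteq> J" for js y
    using that
  proof (induction js arbitrary: u)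
    case (Cons j js)
    define u' where "u' = u(j := \<lambda>_. quad_diff m x w (\<mu> j) (u j))"
    have j: "j \<in> J" using Cons.prems by simp
    have split: "(\<Prod>i\<in>J. v i) = (\<Prod>i\<in>J - {j}. v i) * v j" for v :: "nat \<Rightarrow> real"
      using prod.remove[OF J(1) j, of v] by (simp add: mult.commute)
    have "?T j (\<lambda>y. \<Prod>i\<in>J. u i (y i)) = (\<lambda>y. \<Prod>i\<in>J. u' i (y i))"
    proof
      fix y
      have "(\<Prod>i\<in>J. u i ((y(j := t)) i)) = (\<Prod>i\<in>J - {j}. u i (y i)) * u j t" for t
        unfolding split by (intro arg_cong2[where f="(*)"] prod.cong) auto
      then have "?T j (\<lambda>y. \<Prod>i\<in>J. u i (y i)) y =
          (\<Prod>i\<in>J - {j}. u i (y i)) * quad_diff m x w (\<mu> j) (u j)"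
        by (simp add: in_coord_def quad_diff_cmult)
      also have "\<dots> = (\<Prod>i\<in>J. u' i (y i))"
        unfolding split by (intro arg_cong2[where f="(*)"] prod.cong) (auto simp: u'_def)
      finally show "?T j (\<lambda>y. \<Prod>i\<in>J. u i (y i)) y = (\<Prod>i\<in>J. u' i (y i))" .
    qed
    then have "fold ?T (j # js) (\<lambda>y. \<Prod>j\<in>J. u j (y j)) y =
        (\<Prod>i\<in>J. if i \<in> set js then quad_diff m x w (\<mu> i) (u' i) else u' i (y i))"
      using Cons by simp
    also have "\<dots> = (\<Prod>i\<in>J. if i \<in> set (j # js) then quad_diff m x w (\<mu> i) (u i) else u i (y i))"
      using Cons.prems by (intro prod.cong) (auto simp: u'_def)
    finally show ?case .
  qed simp
  moreover have "finite (supp \<mu>)" using J finite_subset by blast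
  ultimately show ?thesis using J(2) by (simp add: tensor_diff_def tensor_op_def)
qed

section \<open>Exactness, growth and error of the sparse quadrature\<close>

context
  assumes points: "m 0 = 1" "x 0 0 = 0" "w 0 0 = 1"
    and exact: "\<And>l n. n \<le> l \<Longrightarrow> quad m x w l (hermite n) = (if n = 0 then 1 else 0)"
    and stable: "\<And>l n. l < n \<Longrightarrow> \<bar>quad m x w l (hermite n)\<bar> < 2"
begin

lemma quad_0: "quad m x w 0 (g :: real \<Rightarrow> real) = g 0"
  by (simp add: quad_def points)

text \<open>Levels l and l - 1 are both exact in degree n, so their values cancel.\<close>

lemma quad_diff_hermite_eq_0: "n < l \<Longrightarrow> quad_diff m x w l (hermite n) = 0"
  by (simp add: quad_diff_def exact)

lemma sum_quad_diff: "(\<Sum>l\<le>L. quad_diff m x w l (g :: real \<Rightarrow> real)) = quad m x w L g"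
  by (induction L) (simp_all add: quad_diff_def)

text \<open>Origin of the factors in \<open>quad_growth\<close>. Level 0 is the value at 0, of
  modulus at most 1; each of the n further levels is a difference of two values of modulus at most
  2. At level n itself that bound comes from exactness, at lower levels from stability.\<close>

lemma sum_abs_quad_diff_hermite: "(\<Sum>l\<le>n. \<bar>quad_diff m x w l (hermite n)\<bar>) \<le> 1 + 4 * real n"
proof -
  have 0: "\<bar>quad_diff m x w 0 (hermite n)\<bar> \<le> 1"
    by (simp add: quad_diff_def quad_0 hermite_0_abs_bound)
  have 1: "\<bar>quad_diff m x w (Suc l) (hermite n)\<bar> \<le> 4" if "l < n" for l
  proof -
    have "\<bar>quad m x w (Suc l) (hermite n)\<bar> \<le> 2"
      using stable[of "Suc l" n] exact[of n "Suc l"] that by (cases "Suc l < n") auto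
    then show ?thesis using stable[OF that] by (simp add: quad_diff_def)
  qed
  have "(\<Sum>l\<le>n. \<bar>quad_diff m x w l (hermite n)\<bar>) =
      \<bar>quad_diff m x w 0 (hermite n)\<bar> + (\<Sum>l<n. \<bar>quad_diff m x w (Suc l) (hermite n)\<bar>)"
    by (rule sum.atMost_shift)
  also have "\<dots> \<le> 1 + (\<Sum>l<n. 4)" by (intro add_mono 0 sum_mono 1) auto
  finally show ?thesis by simp
qed

lemma tensor_diff_hermite_multi:
  assumes \<mu>: "\<mu> \<in> multi_indices" and \<nu>: "\<nu> \<in> multi_indices"
  shows "tensor_diff m x w \<mu> (hermite_multi \<nu>) =
    (if \<mu> \<in> below \<nu> then \<Prod>j\<in>supp \<nu>. quad_diff m x w (\<mu> j) (hermite (\<nu> j)) else 0)"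
proof -
  let ?J = "supp \<mu> \<union> supp \<nu>"
  have J: "finite ?J" using \<mu> \<nu> by (simp add: finite_supp)
  have "tensor_diff m x w \<mu> (hermite_multi \<nu>) =
      (\<Prod>j\<in>?J. if j \<in> supp \<mu> then quad_diff m x w (\<mu> j) (hermite (\<nu> j)) else hermite (\<nu> j) 0)"
    unfolding hermite_multi_superset[OF J Un_upper2, abs_def] by (rule tensor_diff_prod[OF J Un_upper1])
  \<comment> \<open>Setting an inactive coordinate to 0 is the same as applying the level 0
    difference, since the level 0 rule is evaluation at 0. This puts both kinds of coordinate into
    one product.\<close>
  also have "\<dots> = (\<Prod>j\<in>?J. quad_diff m x w (\<mu> j) (hermite (\<nu> j)))"
    by (intro prod.cong refl) (auto simp: supp_def quad_diff_def quad_0)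
  also have "\<dots> = (if \<mu> \<in> below \<nu> then \<Prod>j\<in>supp \<nu>. quad_diff m x w (\<mu> j) (hermite (\<nu> j)) else 0)"
  proof (cases "\<mu> \<in> below \<nu>")
    case True
    then show ?thesis using below_supp[OF True] by (simp add: Un_absorb1)
  next
    case False
    then obtain j where j: "\<nu> j < \<mu> j" by (auto simp: below_def not_le)
    then have "j \<in> ?J" by (auto simp: supp_def)
    then show ?thesis using False J quad_diff_hermite_eq_0[OF j] by (auto intro!: prod_zero)
  qed
  finally show ?thesis .
qed

context
  fixes \<Lambda> :: "(nat \<Rightarrow> nat) set"
  assumes adm: "admissible \<Lambda>" and fin\<Lambda>: "finite \<Lambda>"
begin

lemma sparse_quad_hermite_multi:
  assumes \<nu>: "\<nu> \<in> multi_indices"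
  shows "sparse_quad m x w \<Lambda> (hermite_multi \<nu>) =
    (\<Sum>\<mu>\<in>\<Lambda> \<inter> below \<nu>. \<Prod>j\<in>supp \<nu>. quad_diff m x w (\<mu> j) (hermite (\<nu> j)))"
proof -
  have "\<Lambda> \<subseteq> multi_indices" using adm by (simp add: admissible_def)
  then have "sparse_quad m x w \<Lambda> (hermite_multi \<nu>) =
      (\<Sum>\<mu>\<in>\<Lambda>. if \<mu> \<in> below \<nu> then \<Prod>j\<in>supp \<nu>. quad_diff m x w (\<mu> j) (hermite (\<nu> j)) else 0)"
    unfolding sparse_quad_def by (intro sum.cong refl tensor_diff_hermite_multi \<nu>) auto
  then show ?thesis by (simp add: sum.inter_restrict[OF fin\<Lambda>])
qed

text \<open>Downward closure puts the whole box below \<nu> into \<Lambda>. The sum over it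
  factorises, and each factor telescopes to the rule of level \<open>\<nu> j\<close>, which
  integrates the polynomial of that degree exactly to 0; an empty support leaves the empty product
  1.\<close>

lemma sparse_quad_exact:
  assumes "\<nu> \<in> \<Lambda>"
  shows "sparse_quad m x w \<Lambda> (hermite_multi \<nu>) = (if supp \<nu> = {} then 1 else 0)"
proof -
  have \<nu>: "\<nu> \<in> multi_indices" using adm assms by (auto simp: admissible_def)
  have "below \<nu> \<subseteq> \<Lambda>"
    using adm assms below_multi_indices[OF \<nu>] by (auto simp: admissible_def below_def)
  then have "sparse_quad m x w \<Lambda> (hermite_multi \<nu>) = (\<Prod>j\<in>supp \<nu>. quad m x w (\<nu> j) (hermite (\<nu> j)))"
    unfolding sparse_quad_hermite_multi[OF \<nu>] sum_quad_diff[symmetric]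
    using sum_below_prod[OF finite_supp[OF \<nu>] order_refl, of "\<lambda>j l. quad_diff m x w l (hermite (\<nu> j))"]
    by (simp add: Int_absorb1)
  also have "\<dots> = (\<Prod>j\<in>supp \<nu>. 0)"
    by (intro prod.cong refl) (simp add: exact supp_def)
  finally show ?thesis using finite_supp[OF \<nu>] by (auto simp: card_gt_0_iff)
qed

text \<open>After taking absolute values the sum may be enlarged from the part of the box in
  \<Lambda> to the whole box, where it factorises. The bound is therefore independent of
  \<Lambda>.\<close>

lemma sparse_quad_growth:
  assumes \<nu>: "\<nu> \<in> multi_indices"
  shows "\<bar>sparse_quad m x w \<Lambda> (hermite_multi \<nu>)\<bar> \<le> quad_growth \<nu>"
proof -
  let ?a = "\<lambda>j l. \<bar>quad_diff m x w l (hermite (\<nu> j))\<bar>"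
  have "\<bar>sparse_quad m x w \<Lambda> (hermite_multi \<nu>)\<bar> \<le> (\<Sum>\<mu>\<in>\<Lambda> \<inter> below \<nu>. \<Prod>j\<in>supp \<nu>. ?a j (\<mu> j))"
    unfolding sparse_quad_hermite_multi[OF \<nu>] abs_prod[symmetric] by (rule sum_abs)
  also have "\<dots> \<le> (\<Sum>\<mu>\<in>below \<nu>. \<Prod>j\<in>supp \<nu>. ?a j (\<mu> j))"
    by (intro sum_mono2 finite_below \<nu> prod_nonneg) auto
  also have "\<dots> = (\<Prod>j\<in>supp \<nu>. \<Sum>l\<le>\<nu> j. ?a j l)"
    by (rule sum_below_prod[OF finite_supp[OF \<nu>] order_refl])
  also have "\<dots> \<le> quad_growth \<nu>"
    unfolding quad_growth_def
    by (intro prod_mono conjI sum_nonneg sum_abs_quad_diff_hermite) auto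
  finally show ?thesis .
qed

lemma sparse_quad_error:
  fixes f :: "(nat \<Rightarrow> real) \<Rightarrow> real" and b :: "(nat \<Rightarrow> nat) \<Rightarrow> real"
  assumes ne: "\<Lambda> \<noteq> {}"
    and expansion: "\<And>y. finite {j. y j \<noteq> 0} \<Longrightarrow>
      ((\<lambda>\<nu>. hcoeff f \<nu> * hermite_multi \<nu> y) has_sum f y) multi_indices"
    and bpos: "\<And>\<nu>. \<nu> \<in> multi_indices \<Longrightarrow> 0 < b \<nu>"
    and energy: "\<And>F. finite F \<Longrightarrow> F \<subseteq> multi_indices \<Longrightarrow> (\<Sum>\<nu>\<in>F. b \<nu> * (hcoeff f \<nu>)\<^sup>2) \<le> B"
    and tail: "\<And>F. finite F \<Longrightarrow> F \<subseteq> multi_indices - \<Lambda> \<Longrightarrow> (\<Sum>\<nu>\<in>F. (quad_growth \<nu>)\<^sup>2 / b \<nu>) \<le> T"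
  shows "\<bar>(\<integral>y. f y \<partial>gauss) - sparse_quad m x w \<Lambda> f\<bar> \<le> sqrt B * sqrt T"
proof -
  let ?c = "hcoeff f"
  have \<Lambda>m: "\<Lambda> \<subseteq> multi_indices" using adm by (simp add: admissible_def)
  have z: "(\<lambda>_. 0) \<in> multi_indices" by (simp add: multi_indices_def supp_def)
  \<comment> \<open>The only index whose Hermite polynomial has nonzero integral lies in \<Lambda>,
    so outside \<Lambda> the error is the quadrature value alone and the growth bound applies to it
    without an extra 1.\<close>
  have z\<Lambda>: "(\<lambda>_. 0) \<in> \<Lambda>" using ne adm z by (auto simp: admissible_def)
  define e where "e \<nu> = (if \<nu> = (\<lambda>_. 0) then 1 else 0) - sparse_quad m x w \<Lambda> (hermite_multi \<nu>)" for \<nu> :: "nat \<Rightarrow> nat"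
  have s0: "supp \<nu> = {} \<longleftrightarrow> \<nu> = (\<lambda>_. 0)" for \<nu> by (auto simp: supp_def fun_eq_iff)
  have e0: "e \<nu> = 0" if "\<nu> \<in> \<Lambda>" for \<nu>
    by (simp add: e_def sparse_quad_exact[OF that] s0)
  have e1: "\<bar>e \<nu>\<bar> \<le> quad_growth \<nu>" if "\<nu> \<in> multi_indices - \<Lambda>" for \<nu>
    using sparse_quad_growth[of \<nu>] that z\<Lambda> by (auto simp: e_def)
  have "((\<lambda>\<nu>. \<Sum>\<mu>\<in>\<Lambda>. ?c \<nu> * tensor_diff m x w \<mu> (hermite_multi \<nu>)) has_sum (\<Sum>\<mu>\<in>\<Lambda>. tensor_diff m x w \<mu> f)) multi_indices"
    by (intro has_sum_finite_sum fin\<Lambda> has_sum_tensor_diff expansion)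
  then have Q: "((\<lambda>\<nu>. ?c \<nu> * sparse_quad m x w \<Lambda> (hermite_multi \<nu>)) has_sum sparse_quad m x w \<Lambda> f) multi_indices"
    by (simp add: sparse_quad_def sum_distrib_left)
  have "hermite_multi (\<lambda>_. 0) = (\<lambda>_. 1)" by (simp add: fun_eq_iff hermite_multi_def supp_def)
  then have c0: "?c (\<lambda>_. 0) = (\<integral>y. f y \<partial>gauss)" by (simp add: hcoeff_def)
  have "((\<lambda>\<nu>. ?c \<nu> * (if \<nu> = (\<lambda>_. 0) then 1 else 0)) has_sum (\<integral>y. f y \<partial>gauss)) multi_indices"
    unfolding c0[symmetric]
  proof (subst has_sum_cong_neutral[where T="{\<lambda>_. 0}" and g="?c"])
    show "(?c has_sum ?c (\<lambda>_. 0)) {\<lambda>_. 0}" by (rule has_sum_finiteI) simp_all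
  qed (use z in auto)
  then have "((\<lambda>\<nu>. ?c \<nu> * (if \<nu> = (\<lambda>_. 0) then 1 else 0) + - (?c \<nu> * sparse_quad m x w \<Lambda> (hermite_multi \<nu>))) has_sum
      (\<integral>y. f y \<partial>gauss) + - sparse_quad m x w \<Lambda> f) multi_indices"
    using Q by (intro has_sum_add) (simp_all only: has_sum_uminus minus_minus)
  then have "((\<lambda>\<nu>. ?c \<nu> * e \<nu>) has_sum ((\<integral>y. f y \<partial>gauss) - sparse_quad m x w \<Lambda> f)) multi_indices"
    by (simp add: e_def right_diff_distrib)
  then have lim: "(sum (\<lambda>\<nu>. ?c \<nu> * e \<nu>) \<longlongrightarrow> ((\<integral>y. f y \<partial>gauss) - sparse_quad m x w \<Lambda> f)) (finite_subsets_at_top multi_indices)"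
    by (simp add: has_sum_def)
  have B0: "0 \<le> B" using energy[of "{}"] by simp
  have T0: "0 \<le> T" using tail[of "{}"] by simp
  \<comment> \<open>Cauchy-Schwarz is applied to finite partial sums only; the bound then passes to
    the limit over finite subsets.\<close>
  have bound: "\<bar>\<Sum>\<nu>\<in>F. ?c \<nu> * e \<nu>\<bar> \<le> sqrt B * sqrt T" if F: "finite F" "F \<subseteq> multi_indices" for F
  proof -
    let ?F = "F - \<Lambda>"
    have "\<bar>\<Sum>\<nu>\<in>F. ?c \<nu> * e \<nu>\<bar> = \<bar>\<Sum>\<nu>\<in>?F. ?c \<nu> * e \<nu>\<bar>"
      using F(1) e0 by (intro arg_cong[where f=abs] sum.mono_neutral_right) auto
    also have "\<dots> \<le> (\<Sum>\<nu>\<in>?F. \<bar>?c \<nu>\<bar> * quad_growth \<nu>)"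
      using F(2) by (intro sum_abs[THEN order_trans] sum_mono) (auto simp: abs_mult intro!: mult_left_mono e1)
    also have "\<dots> = (\<Sum>\<nu>\<in>?F. (sqrt (b \<nu>) * \<bar>?c \<nu>\<bar>) * (quad_growth \<nu> / sqrt (b \<nu>)))"
    proof (intro sum.cong refl)
      fix \<nu> assume "\<nu> \<in> ?F"
      then have "0 < b \<nu>" using F(2) bpos by blast
      then show "\<bar>?c \<nu>\<bar> * quad_growth \<nu> = (sqrt (b \<nu>) * \<bar>?c \<nu>\<bar>) * (quad_growth \<nu> / sqrt (b \<nu>))" by simp
    qed
    finally have le: "\<bar>\<Sum>\<nu>\<in>F. ?c \<nu> * e \<nu>\<bar> \<le> (\<Sum>\<nu>\<in>?F. (sqrt (b \<nu>) * \<bar>?c \<nu>\<bar>) * (quad_growth \<nu> / sqrt (b \<nu>)))" .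
    have "\<bar>\<Sum>\<nu>\<in>F. ?c \<nu> * e \<nu>\<bar>\<^sup>2 \<le> (\<Sum>\<nu>\<in>?F. (sqrt (b \<nu>) * \<bar>?c \<nu>\<bar>) * (quad_growth \<nu> / sqrt (b \<nu>)))\<^sup>2"
      using le by (intro power_mono) auto
    also have "\<dots> \<le> (\<Sum>\<nu>\<in>?F. (sqrt (b \<nu>) * \<bar>?c \<nu>\<bar>)\<^sup>2) * (\<Sum>\<nu>\<in>?F. (quad_growth \<nu> / sqrt (b \<nu>))\<^sup>2)"
      by (rule Cauchy_Schwarz_ineq_sum)
    also have "(\<Sum>\<nu>\<in>?F. (sqrt (b \<nu>) * \<bar>?c \<nu>\<bar>)\<^sup>2) = (\<Sum>\<nu>\<in>?F. b \<nu> * (?c \<nu>)\<^sup>2)"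
      using F(2) bpos by (intro sum.cong refl) (auto simp: power_mult_distrib subset_iff intro: less_imp_le)
    also have "(\<Sum>\<nu>\<in>?F. (quad_growth \<nu> / sqrt (b \<nu>))\<^sup>2) = (\<Sum>\<nu>\<in>?F. (quad_growth \<nu>)\<^sup>2 / b \<nu>)"
      using F(2) bpos by (intro sum.cong refl) (auto simp: power_divide subset_iff intro: less_imp_le)
    also have "(\<Sum>\<nu>\<in>?F. b \<nu> * (?c \<nu>)\<^sup>2) * (\<Sum>\<nu>\<in>?F. (quad_growth \<nu>)\<^sup>2 / b \<nu>) \<le> B * T"
      using F B0 bpos by (intro mult_mono energy tail sum_nonneg) (auto intro!: divide_nonneg_pos)
    finally have "\<bar>\<Sum>\<nu>\<in>F. ?c \<nu> * e \<nu>\<bar> \<le> sqrt (B * T)" by (rule real_le_rsqrt)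
    then show ?thesis by (simp add: real_sqrt_mult)
  qed
  show ?thesis
  proof (rule tendsto_upperbound[OF tendsto_rabs[OF lim]])
    show "\<forall>\<^sub>F F in finite_subsets_at_top multi_indices. \<bar>\<Sum>\<nu>\<in>F. ?c \<nu> * e \<nu>\<bar> \<le> sqrt B * sqrt T"
      by (rule eventually_finite_subsets_at_top_weakI) (rule bound)
  qed simp
qed

end

end

end


section \<open>Transfer from Banach-valued to real-valued functions\<close>

lemma funpow_deriv_eq_0_outside:
  fixes \<psi> :: "real \<Rightarrow> real"
  assumes "\<And>t. R < \<bar>t\<bar> \<Longrightarrow> \<psi> t = 0" "R < \<bar>t\<bar>"
  shows "(deriv ^^ k) \<psi> t = 0"
  using assms(2)
proof (induction k arbitrary: t)
  case (Suc k)
  have "open {t::real. R < \<bar>t\<bar>}" by (intro open_Collect_less continuous_intros)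
  then have "((deriv ^^ k) \<psi> has_real_derivative 0) (at t)"
    by (rule has_field_derivative_transform_within_open[OF DERIV_const]) (use Suc in auto)
  then show ?case by (simp add: DERIV_imp_deriv)
qed (use assms(1) in simp)

text \<open>The derivative keeps its compact support and the density has no zeros, so the quotient
  is continuous and bounded. This makes the integrands in \<open>weak_partial\<close> products of
  square integrable functions.\<close>

lemma test_function_quotient_L2:
  assumes "test_function \<psi>"
  shows "(\<lambda>t. (deriv ^^ k) \<psi> t / std_normal_density t) \<in> L2 gauss1" (is "?g \<in> _")
proof -
  obtain R where R: "\<And>t. \<psi> t \<noteq> 0 \<Longrightarrow> \<bar>t\<bar> \<le> R"
    using assms unfolding test_function_def bounded_iff by auto
  have zero: "(deriv ^^ k) \<psi> t = 0" if "R < \<bar>t\<bar>" for t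
  proof (rule funpow_deriv_eq_0_outside[OF _ that])
    show "\<psi> t = 0" if "R < \<bar>t\<bar>" for t using R[of t] that by linarith
  qed
  have "continuous_on UNIV ((deriv ^^ k) \<psi>)"
    using assms by (auto simp: test_function_def intro!: continuous_at_imp_continuous_on differentiable_imp_continuous_within)
  moreover have "continuous_on UNIV std_normal_density"
    unfolding std_normal_density_def by (intro continuous_intros) simp
  moreover have nz: "std_normal_density t \<noteq> 0" for t using normal_density_pos[of 1 0 t] by simp
  ultimately have cont: "continuous_on UNIV ?g"
    by (intro continuous_intros) auto
  obtain C where C: "\<And>t. t \<in> {-R..R} \<Longrightarrow> \<bar>(deriv ^^ k) \<psi> t / std_normal_density t\<bar> \<le> C"
    using continuous_bounded_on_interval[OF continuous_on_subset[OF cont subset_UNIV], of "-R" R] by blast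
  show ?thesis
  proof (rule L2_bound[OF L2_const(2)[of "max C 0"]])
    show "?g \<in> borel_measurable gauss1"
      using borel_measurable_continuous_onI[OF cont] by simp
    fix t
    show "\<bar>(deriv ^^ k) \<psi> t / std_normal_density t\<bar> \<le> max C 0"
    proof (cases "\<bar>t\<bar> \<le> R")
      case True
      then have "t \<in> {-R..R}" by auto
      then show ?thesis using C[of t] by simp
    qed (simp add: zero)
  qed
qed

lemma L2_norm:
  assumes "h \<in> L2 M"
  shows "(\<lambda>y. norm (h y)) \<in> L2 M"
proof -
  have "strongly_measurable M h" and int: "integrable M (\<lambda>y. (norm (h y))\<^sup>2)"
    using assms by (auto simp: L2_def)
  then have "(\<lambda>y. norm (h y)) \<in> borel_measurable M" by (intro strongly_measurable_norm)
  with int show ?thesis unfolding L2_real_iff by (rule conjI[rotated])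
qed

context
  fixes \<phi> :: "'s::banach \<Rightarrow> real"
  assumes lin: "linear \<phi>" and contraction: "\<And>z. \<bar>\<phi> z\<bar> \<le> norm z"
begin

lemma functional_L2:
  assumes h: "h \<in> L2 M"
  shows "(\<lambda>y. \<phi> (h y)) \<in> L2 M" "(\<integral>y. (\<phi> (h y))\<^sup>2 \<partial>M) \<le> (\<integral>y. (norm (h y))\<^sup>2 \<partial>M)"
proof -
  have "continuous_on UNIV \<phi>" by (rule contraction_continuous[OF lin contraction])
  moreover have "strongly_measurable M h" using h by (simp add: L2_def)
  ultimately have meas: "(\<lambda>y. \<phi> (h y)) \<in> borel_measurable M"
    unfolding strongly_measurable_iff_borel[symmetric] by (rule strongly_measurable_comp[rotated])
  have n: "(\<lambda>y. norm (h y)) \<in> L2 M"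
    by (rule L2_norm[OF h])
  show L: "(\<lambda>y. \<phi> (h y)) \<in> L2 M" by (rule L2_bound[OF n meas contraction])
  show "(\<integral>y. (\<phi> (h y))\<^sup>2 \<partial>M) \<le> (\<integral>y. (norm (h y))\<^sup>2 \<partial>M)"
  proof (rule integral_mono)
    show "integrable M (\<lambda>y. (\<phi> (h y))\<^sup>2)" "integrable M (\<lambda>y. (norm (h y))\<^sup>2)"
      using L n unfolding L2_real_iff by blast+
    show "(\<phi> (h y))\<^sup>2 \<le> (norm (h y))\<^sup>2" for y
      using power_mono[OF contraction[of "h y"] abs_ge_zero, of 2] unfolding power2_abs .
  qed
qed

lemma functional_bochner_int_scaleR:
  assumes h: "h \<in> L2 gauss" and c: "c \<in> L2 gauss"
  shows "\<phi> (bochner_int gauss (\<lambda>y. c y *\<^sub>R h y)) = (\<integral>y. c y * \<phi> (h y) \<partial>gauss)"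
proof -
  have n: "(\<lambda>y. norm (h y)) \<in> L2 gauss"
    by (rule L2_norm[OF h])
  have "\<phi> (bochner_int gauss (\<lambda>y. c y *\<^sub>R h y)) = (\<integral>y. \<phi> (c y *\<^sub>R h y) \<partial>gauss)"
  proof (rule functional_bochner_int[OF _ _ lin contraction])
    show "strongly_measurable gauss (\<lambda>y. c y *\<^sub>R h y)"
      using h by (intro strongly_measurable_scaleR[OF _ L2_measurable[OF c]]) (simp add: L2_def)
    show "integrable gauss (\<lambda>y. norm (c y *\<^sub>R h y))"
      using L2_mult_integrable[OF L2_abs[OF c] n] by simp
  qed
  then show ?thesis by (simp add: linear_scale[OF lin])
qed

lemma functional_bochner_int_L2: "h \<in> L2 gauss \<Longrightarrow> \<phi> (bochner_int gauss h) = (\<integral>y. \<phi> (h y) \<partial>gauss)"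
  using functional_bochner_int_scaleR[of h "\<lambda>_. 1"] L2_const by simp

text \<open>Each Bochner integral in the definition is of a scalar L^2 factor times an L^2 function,
  hence absolutely convergent, and \<phi> passes through it.\<close>

lemma functional_weak_partial:
  assumes f: "f \<in> L2 gauss" and g: "g \<in> L2 gauss" and weak: "weak_partial \<mu> f g"
  shows "weak_partial \<mu> (\<lambda>y. \<phi> (f y)) (\<lambda>y. \<phi> (g y))"
  unfolding weak_partial_def
proof (intro allI impI)
  fix I \<psi> assume a: "finite I \<and> supp \<mu> \<subseteq> I \<and> (\<forall>i\<in>I. test_function (\<psi> i))"
  let ?a = "\<lambda>y. \<Prod>i\<in>I. \<psi> i (y i) / std_normal_density (y i)"
    and ?b = "\<lambda>y. \<Prod>i\<in>I. (deriv ^^ \<mu> i) (\<psi> i) (y i) / std_normal_density (y i)"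
  have L: "(\<lambda>y. \<Prod>i\<in>I. (deriv ^^ k i) (\<psi> i) (y i) / std_normal_density (y i)) \<in> L2 gauss" for k
    using a by (intro L2_gauss_prod[of I "\<lambda>i t. (deriv ^^ k i) (\<psi> i) t / std_normal_density t"] test_function_quotient_L2) auto
  have L0: "?a \<in> L2 gauss"
    using L[of "\<lambda>_. 0"] by simp
  from weak a have "bochner_int gauss (\<lambda>y. ?a y *\<^sub>R g y) =
      (-1) ^ (\<Sum>i\<in>I. \<mu> i) *\<^sub>R
        bochner_int gauss (\<lambda>y. ?b y *\<^sub>R f y)"
    unfolding weak_partial_def by blast
  then have "\<phi> (bochner_int gauss (\<lambda>y. ?a y *\<^sub>R g y)) =
      (-1) ^ (\<Sum>i\<in>I. \<mu> i) *
        \<phi> (bochner_int gauss (\<lambda>y. ?b y *\<^sub>R f y))"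
    by (simp add: linear_scale[OF lin])
  then show "bochner_int gauss (\<lambda>y. ?a y *\<^sub>R \<phi> (g y)) =
      (-1) ^ (\<Sum>i\<in>I. \<mu> i) *\<^sub>R
        bochner_int gauss (\<lambda>y. ?b y *\<^sub>R \<phi> (f y))"
    unfolding functional_bochner_int_scaleR[OF g L0] functional_bochner_int_scaleR[OF f L]
    by (simp add: bochner_int_eq_integral)
qed

lemma functional_precise_at:
  assumes f: "f \<in> L2 gauss" and precise: "precise_at f y" and \<epsilon>: "\<epsilon> > 0"
  shows "\<forall>\<^sub>F K in sequentially. \<forall>\<^sub>F \<delta> in at_right 0.
    \<bar>(1 / measure gauss (cyl y K \<delta>)) * (\<integral>z. indicator (cyl y K \<delta>) z * \<phi> (f z) \<partial>gauss) - \<phi> (f y)\<bar> < \<epsilon>"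
proof -
  have "\<forall>\<^sub>F K in sequentially. \<forall>\<^sub>F \<delta> in at_right 0. norm (average f (cyl y K \<delta>) - f y) < \<epsilon>"
    using precise \<epsilon> by (simp add: precise_at_def)
  then show ?thesis
  proof eventually_elim
    case (elim K)
    \<comment> \<open>The filter supplies \<delta> > 0, for which the cylinder is known to be
      measurable and \<phi> commutes with the average.\<close>
    then show ?case using eventually_at_right_less[of "0::real"]
    proof eventually_elim
      case (elim \<delta>)
      have ind: "indicat_real (cyl y K \<delta>) \<in> L2 gauss"
        using borel_measurable_indicator[OF sets_cyl[OF elim(2)], of y K]
        by (intro L2_bound[OF L2_const(1)[of 1]]) (auto simp: indicator_def)
      have "\<phi> (average f (cyl y K \<delta>) - f y) =
          (1 / measure gauss (cyl y K \<delta>)) * (\<integral>z. indicator (cyl y K \<delta>) z * \<phi> (f z) \<partial>gauss) - \<phi> (f y)"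
        by (simp only: average_def linear_diff[OF lin] linear_scale[OF lin] functional_bochner_int_scaleR[OF f ind])
           simp
      then show ?case using contraction[of "average f (cyl y K \<delta>) - f y"] elim(1) by simp
    qed
  qed
qed

end

theorem theorem3p6:
  fixes m :: "nat \<Rightarrow> nat" and x w :: "nat \<Rightarrow> nat \<Rightarrow> real"
    and q :: real and \<tau> :: "nat \<Rightarrow> real" and r :: nat
    and f :: "(nat \<Rightarrow> real) \<Rightarrow> 's::banach"
    and D :: "(nat \<Rightarrow> nat) \<Rightarrow> (nat \<Rightarrow> real) \<Rightarrow> 's"
  assumes points: "m 0 = 1" "\<And>l. m l < m (Suc l)" "x 0 0 = 0" "w 0 0 = 1"
    and A1: "\<And>l (g :: real \<Rightarrow> 's). g \<in> poly_space l \<Longrightarrow> quad m x w l g = bochner_int gauss1 g"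
    and A1': "\<And>l n. n \<le> l \<Longrightarrow> quad m x w l (hermite n) = (\<integral>t. hermite n t \<partial>gauss1)"
    and A2: "\<And>l n. l < n \<Longrightarrow> \<bar>quad m x w l (hermite n)\<bar> < 2"
    and q: "0 < q" "q < 2"
    and \<tau>: "\<And>j. 0 < \<tau> j" "summable (\<lambda>j. (1 / \<tau> j) powr q)"
    and r: "r = (LEAST k::nat. 14 / q < real k)"
    and f: "f \<in> L2 gauss"
    and precise: "\<And>y. finite {j. y j \<noteq> 0} \<Longrightarrow> precise_at f y"
    and D: "\<And>\<mu>. \<mu> \<in> multi_indices_le r \<Longrightarrow> weak_partial \<mu> f (D \<mu>) \<and> D \<mu> \<in> L2 gauss"
    and D_sum: "(\<lambda>\<mu>. weight \<tau> \<mu> / mfact \<mu> * (\<integral>y. (norm (D \<mu> y))\<^sup>2 \<partial>gauss))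
                  summable_on multi_indices_le r"
  shows "\<exists>C::real. \<forall>N\<ge>1. \<exists>\<Lambda>. admissible \<Lambda> \<and> finite \<Lambda> \<and> card \<Lambda> = N \<and>
           (\<forall>\<nu>\<in>\<Lambda>. \<forall>\<nu>'\<in>multi_indices - \<Lambda>. b_val r \<tau> \<nu> \<le> b_val r \<tau> \<nu>') \<and>
           norm (bochner_int gauss f - sparse_quad m x w \<Lambda> f)
             \<le> C * (real N + 1) powr (- (1 / q - 1 / 2))"
proof -
  have r14: "14 / q < real r"
    unfolding r by (rule LeastI_ex) (rule reals_Archimedean2)
  have r0: "0 < r" using r14 q by (cases r) (auto simp: field_simps)
  obtain M where M: "\<And>F. finite F \<Longrightarrow> F \<subseteq> multi_indices \<Longrightarrow>
      (\<Sum>\<nu>\<in>F. b_powr_term r \<tau> q \<nu>) \<le> M"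
    using b_val_powr_sum_bounded[OF q(1) \<tau> r14] by blast
  have M0: "0 \<le> M" using M[of "{}"] by simp
  define B where "B = (\<Sum>\<^sub>\<infinity>\<mu>\<in>multi_indices_le r. weight \<tau> \<mu> / mfact \<mu> * (\<integral>y. (norm (D \<mu> y))\<^sup>2 \<partial>gauss))"
  have term0: "0 \<le> weight \<tau> \<mu> / mfact \<mu>" for \<mu>
    using weight_nonneg mfact_pos by (simp add: less_imp_le)
  have B: "(\<Sum>\<mu>\<in>S. weight \<tau> \<mu> / mfact \<mu> * (\<integral>y. (norm (D \<mu> y))\<^sup>2 \<partial>gauss)) \<le> B"
    if "finite S" "S \<subseteq> multi_indices_le r" for S
    unfolding B_def using that term0 by (intro finite_sum_le_infsum D_sum mult_nonneg_nonneg) simp_all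
  have exact: "quad m x w l (hermite n) = (if n = 0 then 1 else 0)" if "n \<le> l" for l n
    using A1'[OF that] by (simp add: integral_hermite)
  define T where "T N = M * (M / (real N + 1)) powr (2 / q - 1)" for N
  \<comment> \<open>\<Lambda> and \<phi> are arbitrary here because the functional used in the end
    norms the error of one particular \<Lambda>; for given \<open>N\<close> the bound depends on
    neither.\<close>
  have scalar: "\<bar>\<phi> (bochner_int gauss f - sparse_quad m x w \<Lambda> f)\<bar> \<le> sqrt B * sqrt (T N)"
    if lin: "linear \<phi>" and contraction: "\<And>z. \<bar>\<phi> z\<bar> \<le> norm z"
      and \<Lambda>: "admissible \<Lambda>" "finite \<Lambda>" "card \<Lambda> = N" "1 \<le> N"
        "\<And>\<nu> \<nu>'. \<nu> \<in> \<Lambda> \<Longrightarrow> \<nu>' \<in> multi_indices - \<Lambda> \<Longrightarrow> b_val r \<tau> \<nu> \<le> b_val r \<tau> \<nu>'"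
    for \<phi> :: "'s \<Rightarrow> real" and \<Lambda> N
  proof -
    let ?f = "\<lambda>y. \<phi> (f y)"
    have f\<phi>: "?f \<in> L2 gauss" by (rule functional_L2(1)[OF lin contraction f])
    have energy: "(\<Sum>\<nu>\<in>F. b_val r \<tau> \<nu> * (hcoeff ?f \<nu>)\<^sup>2) \<le> B" if "finite F" "F \<subseteq> multi_indices" for F
    proof (rule b_val_energy[OF f\<phi> _ _ that, of r "\<lambda>\<mu> y. \<phi> (D \<mu> y)"])
      show "weak_partial \<mu> ?f (\<lambda>y. \<phi> (D \<mu> y)) \<and> (\<lambda>y. \<phi> (D \<mu> y)) \<in> L2 gauss" if "\<mu> \<in> multi_indices_le r" for \<mu>
        using D[OF that] functional_weak_partial[OF lin contraction f] functional_L2(1)[OF lin contraction] by blast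
      fix S assume S: "finite S" "S \<subseteq> multi_indices_le r"
      have "(\<Sum>\<mu>\<in>S. weight \<tau> \<mu> / mfact \<mu> * (\<integral>y. (\<phi> (D \<mu> y))\<^sup>2 \<partial>gauss)) \<le>
          (\<Sum>\<mu>\<in>S. weight \<tau> \<mu> / mfact \<mu> * (\<integral>y. (norm (D \<mu> y))\<^sup>2 \<partial>gauss))"
        using D S(2) by (intro sum_mono mult_left_mono functional_L2(2)[OF lin contraction] term0) blast
      also have "\<dots> \<le> B" by (rule B[OF S])
      finally show "(\<Sum>\<mu>\<in>S. weight \<tau> \<mu> / mfact \<mu> * (\<integral>y. (\<phi> (D \<mu> y))\<^sup>2 \<partial>gauss)) \<le> B" .
    qed
    have "(\<lambda>\<nu>. \<bar>hcoeff ?f \<nu>\<bar>) summable_on multi_indices"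
    proof (rule nonneg_bdd_above_summable_on)
      \<comment> \<open>The tail bound for the empty index set with N = 0, which controls the sum of
        squared growth over weight on all finite sets.\<close>
      define t where "t = M * (M / (real 0 + 1)) powr (2 / q - 1)"
      have "(\<Sum>\<nu>\<in>F. \<bar>hcoeff ?f \<nu>\<bar>) \<le> B + t" if F: "finite F" "F \<subseteq> multi_indices" for F
      proof -
        have "(\<Sum>\<nu>\<in>F. \<bar>hcoeff ?f \<nu>\<bar>) \<le>
            (\<Sum>\<nu>\<in>F. b_val r \<tau> \<nu> * (hcoeff ?f \<nu>)\<^sup>2 + (quad_growth \<nu>)\<^sup>2 / b_val r \<tau> \<nu>)"
        proof (rule sum_mono)
          fix \<nu> assume "\<nu> \<in> F"
          then have b: "0 < b_val r \<tau> \<nu>" using F b_val_pos by blast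
          define c s where "c = \<bar>hcoeff ?f \<nu>\<bar>" and "s = sqrt (b_val r \<tau> \<nu>)"
          have s: "0 < s" "s\<^sup>2 = b_val r \<tau> \<nu>" using b by (simp_all add: s_def)
          have "1 \<le> (quad_growth \<nu>)\<^sup>2" using quad_growth_ge_1 by (rule one_le_power)
          then have p: "1 / s\<^sup>2 \<le> (quad_growth \<nu>)\<^sup>2 / s\<^sup>2" by (intro divide_right_mono) simp_all
          \<comment> \<open>From 2uv \<le> u^2 + v^2 with u = sqrt(b) c and v = 1/sqrt(b), so that
            uv = c; a growth factor of at least 1 then allows replacing 1/b by the summable
            term.\<close>
          have "2 * (s * c) * (1 / s) \<le> (s * c)\<^sup>2 + (1 / s)\<^sup>2" by (rule sum_squares_bound)
          then have "2 * c \<le> s\<^sup>2 * c\<^sup>2 + 1 / s\<^sup>2" using s by (simp add: power_mult_distrib power_divide)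
          moreover have "0 \<le> c" by (simp add: c_def)
          ultimately have "c \<le> s\<^sup>2 * c\<^sup>2 + (quad_growth \<nu>)\<^sup>2 / s\<^sup>2" using p by linarith
          then show "\<bar>hcoeff ?f \<nu>\<bar> \<le> b_val r \<tau> \<nu> * (hcoeff ?f \<nu>)\<^sup>2 + (quad_growth \<nu>)\<^sup>2 / b_val r \<tau> \<nu>"
            by (simp add: c_def s)
        qed
        also have "\<dots> \<le> B + t"
          unfolding sum.distrib t_def using F
          by (intro add_mono energy smallest_b_val_tail[OF M q, of "{}" 0]) auto
        finally show ?thesis .
      qed
      then show "bdd_above (sum (\<lambda>\<nu>. \<bar>hcoeff ?f \<nu>\<bar>) ` {F. F \<subseteq> multi_indices \<and> finite F})"
        by (intro bdd_aboveI[of _ "B + t"]) auto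
    qed simp
    then have expansion: "((\<lambda>\<nu>. hcoeff ?f \<nu> * hermite_multi \<nu> y) has_sum ?f y) multi_indices"
      if "finite {j. y j \<noteq> 0}" for y
      using functional_precise_at[OF lin contraction f precise[OF that]]
      by (intro precise_value_expansion[OF f\<phi> _ that]) auto
    have \<Lambda>m: "\<Lambda> \<subseteq> multi_indices" using \<Lambda>(1) by (simp add: admissible_def)
    have "\<bar>(\<integral>y. ?f y \<partial>gauss) - sparse_quad m x w \<Lambda> ?f\<bar> \<le> sqrt B * sqrt (T N)"
    proof (rule sparse_quad_error[OF points(1,3,4) exact A2 \<Lambda>(1,2) _ expansion b_val_pos energy])
      show "\<Lambda> \<noteq> {}" using \<Lambda>(3,4) by auto
      show "(\<Sum>\<nu>\<in>F. (quad_growth \<nu>)\<^sup>2 / b_val r \<tau> \<nu>) \<le> T N" if "finite F" "F \<subseteq> multi_indices - \<Lambda>" for F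
        unfolding T_def by (rule smallest_b_val_tail[OF M q \<Lambda>m \<Lambda>(2,3,5) that])
    qed auto
    then show ?thesis
      by (simp add: linear_diff[OF lin] linear_sparse_quad[OF lin] functional_bochner_int_L2[OF lin contraction f])
  qed
  define C where "C = sqrt B * sqrt (M * M powr (2 / q - 1))"
  have "\<exists>\<Lambda>. admissible \<Lambda> \<and> finite \<Lambda> \<and> card \<Lambda> = N \<and>
           (\<forall>\<nu>\<in>\<Lambda>. \<forall>\<nu>'\<in>multi_indices - \<Lambda>. b_val r \<tau> \<nu> \<le> b_val r \<tau> \<nu>') \<and>
           norm (bochner_int gauss f - sparse_quad m x w \<Lambda> f)
             \<le> C * (real N + 1) powr (- (1 / q - 1 / 2))" if N: "1 \<le> N" for N
  proof -
    obtain \<Lambda> where \<Lambda>: "\<Lambda> \<subseteq> multi_indices" "finite \<Lambda>" "card \<Lambda> = N"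
        "\<And>\<nu> \<nu>'. \<nu> \<in> \<Lambda> \<Longrightarrow> \<nu>' \<in> multi_indices - \<Lambda> \<Longrightarrow> b_val r \<tau> \<nu> \<le> b_val r \<tau> \<nu>'"
      using smallest_values_exist[of "b_val r \<tau>" N] finite_b_val_sublevel[OF M q(1)] by blast
    have adm: "admissible \<Lambda>" by (rule smallest_b_val_admissible[OF \<Lambda>(1,4) r0 \<tau>(1)])
    let ?e = "bochner_int gauss f - sparse_quad m x w \<Lambda> f"
    obtain \<phi> :: "'s \<Rightarrow> real" where \<phi>: "linear \<phi>" "\<And>z. \<bar>\<phi> z\<bar> \<le> norm z" "\<phi> ?e = norm ?e"
      using hahn_banach_norming[of ?e] by auto
    have "norm ?e \<le> sqrt B * sqrt (T N)"
      using scalar[OF \<phi>(1,2) adm \<Lambda>(2,3) N \<Lambda>(4)] \<phi>(3) by simp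
    \<comment> \<open>The power of N + 1 is split off from the constant, and the square root halves
      2/q - 1 to 1/q - 1/2.\<close>
    also have "sqrt (T N) = sqrt (M * M powr (2 / q - 1)) * (real N + 1) powr (- (1 / q - 1 / 2))"
    proof -
      have "T N = (M * M powr (2 / q - 1)) * (real N + 1) powr (- (2 / q - 1))"
        unfolding T_def powr_minus_divide[of _ "2 / q - 1"] using M0 by (simp add: powr_divide)
      also have "(real N + 1) powr (- (2 / q - 1)) = ((real N + 1) powr (- (1 / q - 1 / 2)))\<^sup>2"
        by (simp add: power2_eq_square powr_add[symmetric])
      finally show ?thesis by (simp add: real_sqrt_mult)
    qed
    finally have "norm ?e \<le> C * (real N + 1) powr (- (1 / q - 1 / 2))" by (simp add: C_def mult.assoc)
    with adm \<Lambda> show ?thesis by blast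
  qed
  then show ?thesis by blast
qed

end
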